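(* Let $M$ be a helix surface in $\mathbb{H}^3_{1,\tau}$, with $\lambda=g_\tau(N,N)$ and constant angle function $\nu\neq0$ such that $B=\nu^2(\tau^2-1)-\lambda<0$. Then, locally, the position vector of $M$ in $\mathbb{R}^4_2$, with respect to the local coordinates $(x,y)$ on $M$ described in the context, is given by $$F(x,y)=A(y)\,\gamma(x),$$ where the curve $\gamma(x)=(\gamma_1(x),\gamma_2(x),\gamma_3(x),\gamma_4(x))$ has components $$\begin{aligned}\gamma_1(x)&=\frac{2\sqrt{\lambda+\nu^2}}{\sqrt{-\kappa B}}\cos(\alpha x)\sinh(\beta x),\\ \gamma_2(x)&=\frac{2\sqrt{\lambda+\nu^2}}{\sqrt{-\kappa B}}\sin(\alpha x)\sinh(\beta x),\\ \gamma_3(x)&=\frac{2}{\sqrt\kappa}\cos(\alpha x)\cosh(\beta x)-\frac{2\lambda\tau|\nu|}{\sqrt{-\kappa B}}\sin(\alpha x)\sinh(\beta x),\\ \gamma_4(x)&=\frac{2}{\sqrt\kappa}\sin(\alpha x)\cosh(\beta x)+\frac{2\lambda\tau|\nu|}{\sqrt{-\kappa B}}\cos(\alpha x)\sinh(\beta x),\end{aligned}$$ with $$\alpha=-\frac{\sqrt\kappa}{2}\frac{B}{\lambda\tau},\qquad \beta=|\nu|\frac{\sqrt{-\kappa B}}{2},$$ and $A(y)=A(\xi,\xi_1,\xi_2,\xi_3)(y)$ is a $1$-parameter family of $4\times4$ pseudo-orthogonal matrices commuting with $J_1$ (of the form described in the context), where $\xi$ is a constant and $$\begin{aligned}&|\nu|\sqrt{\lambda+\nu^2}\,\big[2\cos(\xi_2(y)-\xi_3(y))\,\xi_1'(y)+(\xi_2'(y)+\xi_3'(y))\sin(\xi_2(y)-\xi_3(y))\sinh(2\xi_1(y))\big]\\&\quad+2\lambda\tau\nu^2\big[\cosh^2(\xi_1(y))\,\xi_2'(y)+\sinh^2(\xi_1(y))\,\xi_3'(y)\big]=0.\end{aligned}$$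 Conversely, a parametrization (immersion) $F(x,y)=A(y)\gamma(x)$, with $\gamma(x)$ and $A(y)$ as just described, defines a helix surface in $\mathbb{H}^3_{1,\tau}$ with constant angle function $\nu\neq0$ (for a suitable choice of the unit normal $N$).
   Context: Let $\kappa>0$ and $\tau>0$ be real constants. $\mathbb{R}^4_2$ is $\mathbb{R}^4$ with the metric $g_0=dx_1^2+dx_2^2-dx_3^2-dx_4^2$, also denoted $\langle\,,\rangle$. The anti-de Sitter space is $\mathbb{H}^3_1(\kappa/4)=\{x\in\mathbb{R}^4: x_1^2+x_2^2-x_3^2-x_4^2=-4/\kappa\}$ with the induced Lorentzian metric $\langle\,,\rangle$. Define linear maps of $\mathbb{R}^4$ by $J_1(x)=(-x_2,x_1,-x_4,x_3)$, $J_2(x)=(x_3,-x_4,x_1,-x_2)$, $J_3(x)=(x_4,x_3,x_2,x_1)$, and $X_i(q)=\frac{\sqrt\kappa}{2}J_iq$. The Berger-like metric is $g_\tau(X,Y)=\langle X,Y\rangle+(1-\tau^2)\langle X,X_1\rangle\langle Y,X_1\rangle$; $E_1=\tau^{-1}X_1$, $E_2=X_2$, $E_3=X_3$ is a $g_\tau$-pseudo-orthonormal frame with $E_1$ timelike; $\mathbb{H}^3_{1,\tau}=(\mathbb{H}^3_1(\kappa/4),g_\tau)$ with Levi-Civita connection $\nabla^\tau$. The wedge product is the bilinear skew product with $E_1\wedge E_2=E_3$, $E_2\wedge E_3=-E_1$, $E_3\wedge E_1=E_2$. For an oriented pseudo-Riemannian surface $M$ immersed in $\mathbb{H}^3_{1,\tau}$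 with unit normal $N$, put $\lambda=g_\tau(N,N)\in\{-1,1\}$, angle function $\nu=\lambda g_\tau(N,E_1)$, $E_1=T+\nu N$ with $T$ tangent to $M$, and $JX=N\wedge X$. $M$ is a helix surface if $\nu$ is constant; throughout $\nu\neq0$, and then $\lambda+\nu^2>0$ (this inequality is also part of the requirements on the constants $\lambda,\nu$ in the converse). On a helix surface the shape operator $A(X)=-\nabla^\tau_XN$ satisfies $A(JT)=-\frac{\sqrt\kappa}{2}\lambda\tau T+\mu JT$ for a smooth function $\mu$. Local coordinates (case $B<0$): $(x,y)$ are local coordinates on $M$ (on a product of intervals) with $\partial_x=T$, $\partial_y=a\,T+b\,JT$, where $\mu=\sqrt{-\kappa B}\tanh(\eta(y)+\nu\sqrt{-\kappa B}\,x)$ for a smooth function $\eta(y)$, $b=\cosh(\eta(y)+\nu\sqrt{-\kappa B}\,x)$ and $a=-\frac{\lambda\tau}{\sqrt{-B}}\sinh(\eta(y)+\nu\sqrt{-\kappa B}\,x)$. Pseudo-orthogonal matrices: those preserving $g_0$. For real functions $\xi,\xi_1,\xi_2,\xi_3$ of $y$, $A(\xi,\xi_1,\xi_2,\xi_3)(y)$ is the matrix (commuting with $J_1$) with rows $\mathbf r_1=(\cosh\xi_1\cos\xi_2,-\cosh\xi_1\sin\xi_2,\sinh\xi_1\cos\xi_3,-\sinh\xi_1\sin\xi_3)$, $\mathbf r_2=J_1\mathbf r_1$, $\mathbf r_3=\sin\xi\,J_2\mathbf r_1+\cos\xi\,J_3\mathbf r_1$, $\mathbf r_4=J_1\mathbf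 r_3=-\cos\xi\,J_2\mathbf r_1+\sin\xi\,J_3\mathbf r_1$. *)

theory Defs
  imports "HOL-Analysis.Analysis"
begin

subsection \<open>Smoothness\<close>

text \<open>Meant for open \<open>S\<close>: all iterated directional derivatives exist and are continuous on \<open>S\<close>.\<close>

primrec higher_differentiable_on ::
  "'a::real_normed_vector set \<Rightarrow> ('a \<Rightarrow> 'b::real_normed_vector) \<Rightarrow> nat \<Rightarrow> bool" where
  "higher_differentiable_on S f 0 \<longleftrightarrow> continuous_on S f"
| "higher_differentiable_on S f (Suc n) \<longleftrightarrow>
     (\<forall>x\<in>S. f differentiable (at x)) \<and>
     (\<forall>v. higher_differentiable_on S (\<lambda>x. frechet_derivative f (at x) v) n)"

definition smooth_on ::
  "'a::real_normed_vector set \<Rightarrow> ('a \<Rightarrow> 'b::real_normed_vector) \<Rightarrow> bool" where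
  "smooth_on S f \<longleftrightarrow> (\<forall>n. higher_differentiable_on S f n)"

definition open_interval :: "real set \<Rightarrow> bool" where
  "open_interval I \<longleftrightarrow> open I \<and> is_interval I \<and> I \<noteq> {}"

subsection \<open>The pseudo-Euclidean space and anti-de Sitter space\<close>

definition g0 :: "real^4 \<Rightarrow> real^4 \<Rightarrow> real" where
  "g0 u v = u$1 * v$1 + u$2 * v$2 - u$3 * v$3 - u$4 * v$4"

definition ads :: "real \<Rightarrow> (real^4) set" where
  "ads \<kappa> = {q. g0 q q = - 4 / \<kappa>}"

definition ads_tangent :: "real^4 \<Rightarrow> (real^4) set" where
  "ads_tangent q = {v. g0 v q = 0}"

definition J1 :: "real^4 \<Rightarrow> real^4" where
  "J1 q = vector [- q$2, q$1, - q$4, q$3]"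

definition J2 :: "real^4 \<Rightarrow> real^4" where
  "J2 q = vector [q$3, - q$4, q$1, - q$2]"

definition J3 :: "real^4 \<Rightarrow> real^4" where
  "J3 q = vector [q$4, q$3, q$2, q$1]"

definition X1 :: "real \<Rightarrow> real^4 \<Rightarrow> real^4" where
  "X1 \<kappa> q = (sqrt \<kappa> / 2) *\<^sub>R J1 q"

definition X2 :: "real \<Rightarrow> real^4 \<Rightarrow> real^4" where
  "X2 \<kappa> q = (sqrt \<kappa> / 2) *\<^sub>R J2 q"

definition X3 :: "real \<Rightarrow> real^4 \<Rightarrow> real^4" where
  "X3 \<kappa> q = (sqrt \<kappa> / 2) *\<^sub>R J3 q"

subsection \<open>The Berger-like metric, its frame and the wedge product\<close>

text \<open>The metric at the point \<open>q\<close>.\<close>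

definition gtau :: "real \<Rightarrow> real \<Rightarrow> real^4 \<Rightarrow> real^4 \<Rightarrow> real^4 \<Rightarrow> real" where
  "gtau \<kappa> \<tau> q u v = g0 u v + (1 - \<tau>^2) * g0 u (X1 \<kappa> q) * g0 v (X1 \<kappa> q)"

text \<open>The frame is indexed by \<open>{1..3}\<close>.\<close>

definition frame :: "real \<Rightarrow> real \<Rightarrow> nat \<Rightarrow> real^4 \<Rightarrow> real^4" where
  "frame \<kappa> \<tau> i q =
     (if i = 1 then (1 / \<tau>) *\<^sub>R X1 \<kappa> q else if i = 2 then X2 \<kappa> q else X3 \<kappa> q)"

text \<open>The coefficients of a tangent vector \<open>v\<close> at \<open>q\<close>, so that
  \<open>v = (\<Sum>i=1..3. coef \<kappa> \<tau> q i v *\<^sub>R frame \<kappa> \<tau> i q)\<close>; the first frame vector is timelike.\<close>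

definition coef :: "real \<Rightarrow> real \<Rightarrow> real^4 \<Rightarrow> nat \<Rightarrow> real^4 \<Rightarrow> real" where
  "coef \<kappa> \<tau> q i v = (if i = 1 then -1 else 1) * gtau \<kappa> \<tau> q v (frame \<kappa> \<tau> i q)"

definition wedge :: "real \<Rightarrow> real \<Rightarrow> real^4 \<Rightarrow> real^4 \<Rightarrow> real^4 \<Rightarrow> real^4" where
  "wedge \<kappa> \<tau> q u v =
     (let u' = (\<lambda>i. coef \<kappa> \<tau> q i u); v' = (\<lambda>i. coef \<kappa> \<tau> q i v) in
        (u' 1 * v' 2 - u' 2 * v' 1) *\<^sub>R frame \<kappa> \<tau> 3 q
      - (u' 2 * v' 3 - u' 3 * v' 2) *\<^sub>R frame \<kappa> \<tau> 1 q
      + (u' 3 * v' 1 - u' 1 * v' 3) *\<^sub>R frame \<kappa> \<tau> 2 q)"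

subsection \<open>The Levi-Civita connection\<close>

text \<open>Anti-de Sitter space is closed in \<open>\<real>\<^sup>4\<close>, so its smooth vector fields are the restrictions
  of the following ones, and all derivatives of them taken below are in tangent directions.\<close>

definition ads_fields :: "real \<Rightarrow> (real^4 \<Rightarrow> real^4) set" where
  "ads_fields \<kappa> = {X. smooth_on UNIV X \<and> (\<forall>q\<in>ads \<kappa>. X q \<in> ads_tangent q)}"

definition lie_bracket ::
  "(real^4 \<Rightarrow> real^4) \<Rightarrow> (real^4 \<Rightarrow> real^4) \<Rightarrow> real^4 \<Rightarrow> real^4" where
  "lie_bracket X Y q =
     frechet_derivative Y (at q) (X q) - frechet_derivative X (at q) (Y q)"

definition is_levi_civita :: "real \<Rightarrow> real \<Rightarrow>
    ((real^4 \<Rightarrow> real^4) \<Rightarrow> (real^4 \<Rightarrow> real^4) \<Rightarrow> real^4 \<Rightarrow> real^4) \<Rightarrow> bool" where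
  "is_levi_civita \<kappa> \<tau> D \<longleftrightarrow>
     (\<forall>X\<in>ads_fields \<kappa>. \<forall>Y\<in>ads_fields \<kappa>. D X Y \<in> ads_fields \<kappa>) \<and>
     (\<forall>X\<in>ads_fields \<kappa>. \<forall>Y\<in>ads_fields \<kappa>. \<forall>Z\<in>ads_fields \<kappa>. \<forall>q\<in>ads \<kappa>.
        D (\<lambda>p. X p + Y p) Z q = D X Z q + D Y Z q \<and>
        D X (\<lambda>p. Y p + Z p) q = D X Y q + D X Z q) \<and>
     (\<forall>f :: real^4 \<Rightarrow> real. \<forall>X\<in>ads_fields \<kappa>. \<forall>Y\<in>ads_fields \<kappa>. \<forall>q\<in>ads \<kappa>.
        smooth_on UNIV f \<longrightarrow>
          D (\<lambda>p. f p *\<^sub>R X p) Y q = f q *\<^sub>R D X Y q \<and>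
          D X (\<lambda>p. f p *\<^sub>R Y p) q =
            f q *\<^sub>R D X Y q + frechet_derivative f (at q) (X q) *\<^sub>R Y q) \<and>
     (\<forall>X\<in>ads_fields \<kappa>. \<forall>Y\<in>ads_fields \<kappa>. \<forall>q\<in>ads \<kappa>.
        D X Y q - D Y X q = lie_bracket X Y q) \<and>
     (\<forall>X\<in>ads_fields \<kappa>. \<forall>Y\<in>ads_fields \<kappa>. \<forall>Z\<in>ads_fields \<kappa>. \<forall>q\<in>ads \<kappa>.
        frechet_derivative (\<lambda>p. gtau \<kappa> \<tau> p (Y p) (Z p)) (at q) (X q) =
          gtau \<kappa> \<tau> q (D X Y q) (Z q) + gtau \<kappa> \<tau> q (Y q) (D X Z q))"

text \<open>By the Koszul formula the values on anti-de Sitter space do not depend on the choice;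
  off it they are irrelevant.\<close>

definition nabla :: "real \<Rightarrow> real \<Rightarrow>
    (real^4 \<Rightarrow> real^4) \<Rightarrow> (real^4 \<Rightarrow> real^4) \<Rightarrow> real^4 \<Rightarrow> real^4" where
  "nabla \<kappa> \<tau> = (SOME D. is_levi_civita \<kappa> \<tau> D)"

text \<open>The induced covariant derivative, at the parameter \<open>p\<close> and in the direction \<open>dF\<^sub>p w\<close>, of a
  vector field \<open>V\<close> along a map \<open>F\<close>. It is obtained by writing \<open>V = (\<Sum>i=1..3. v\<^sub>i (E\<^sub>i \<circ> F))\<close>;
  in the second term \<open>dF\<^sub>p w\<close> is extended to the field with the same, constant, coefficients.\<close>

definition cov_along :: "real \<Rightarrow> real \<Rightarrow> (real \<times> real \<Rightarrow> real^4) \<Rightarrow>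
    (real \<times> real \<Rightarrow> real^4) \<Rightarrow> real \<times> real \<Rightarrow> real \<times> real \<Rightarrow> real^4" where
  "cov_along \<kappa> \<tau> F V p w =
     (\<Sum>i=1..3.
        frechet_derivative (\<lambda>r. coef \<kappa> \<tau> (F r) i (V r)) (at p) w *\<^sub>R frame \<kappa> \<tau> i (F p)
      + coef \<kappa> \<tau> (F p) i (V p) *\<^sub>R
          nabla \<kappa> \<tau>
            (\<lambda>q. \<Sum>j=1..3. coef \<kappa> \<tau> (F p) j (frechet_derivative F (at p) w) *\<^sub>R frame \<kappa> \<tau> j q)
            (frame \<kappa> \<tau> i) (F p))"

subsection \<open>Oriented surfaces and helix surfaces\<close>

definition immersion_on ::
  "(real \<times> real) set \<Rightarrow> (real \<times> real \<Rightarrow> real^4) \<Rightarrow> bool" where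
  "immersion_on U F \<longleftrightarrow> (\<forall>p\<in>U. inj (frechet_derivative F (at p)))"

text \<open>A parametrized immersed surface \<open>F\<close> with unit normal \<open>N\<close>, a vector field along \<open>F\<close>;
  \<open>lam\<close> is the causal character of \<open>N\<close>.\<close>

definition oriented_surface :: "real \<Rightarrow> real \<Rightarrow> real \<Rightarrow> (real \<times> real) set \<Rightarrow>
    (real \<times> real \<Rightarrow> real^4) \<Rightarrow> (real \<times> real \<Rightarrow> real^4) \<Rightarrow> bool" where
  "oriented_surface \<kappa> \<tau> lam U F N \<longleftrightarrow>
     open U \<and> U \<noteq> {} \<and> smooth_on U F \<and> F ` U \<subseteq> ads \<kappa> \<and> immersion_on U F \<and>
     (\<forall>p\<in>U. \<forall>v. (\<forall>w. gtau \<kappa> \<tau> (F p) (frechet_derivative F (at p) v)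
                         (frechet_derivative F (at p) w) = 0) \<longrightarrow> v = 0) \<and>
     smooth_on U N \<and> lam \<in> {-1, 1} \<and>
     (\<forall>p\<in>U. N p \<in> ads_tangent (F p) \<and> gtau \<kappa> \<tau> (F p) (N p) (N p) = lam \<and>
        (\<forall>w. gtau \<kappa> \<tau> (F p) (N p) (frechet_derivative F (at p) w) = 0))"

definition angle :: "real \<Rightarrow> real \<Rightarrow> real \<Rightarrow> (real \<times> real \<Rightarrow> real^4) \<Rightarrow>
    (real \<times> real \<Rightarrow> real^4) \<Rightarrow> real \<times> real \<Rightarrow> real" where
  "angle \<kappa> \<tau> lam F N p = lam * gtau \<kappa> \<tau> (F p) (N p) (frame \<kappa> \<tau> 1 (F p))"

definition helix_surface :: "real \<Rightarrow> real \<Rightarrow> real \<Rightarrow> real \<Rightarrow> (real \<times> real) set \<Rightarrow>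
    (real \<times> real \<Rightarrow> real^4) \<Rightarrow> (real \<times> real \<Rightarrow> real^4) \<Rightarrow> bool" where
  "helix_surface \<kappa> \<tau> lam \<nu> U F N \<longleftrightarrow>
     oriented_surface \<kappa> \<tau> lam U F N \<and> (\<forall>p\<in>U. angle \<kappa> \<tau> lam F N p = \<nu>)"

definition shape_op :: "real \<Rightarrow> real \<Rightarrow> (real \<times> real \<Rightarrow> real^4) \<Rightarrow>
    (real \<times> real \<Rightarrow> real^4) \<Rightarrow> real \<times> real \<Rightarrow> real^4 \<Rightarrow> real^4" where
  "shape_op \<kappa> \<tau> F N p v =
     - cov_along \<kappa> \<tau> F N p (inv (frechet_derivative F (at p)) v)"

definition tangent_E1 :: "real \<Rightarrow> real \<Rightarrow> real \<Rightarrow> (real \<times> real \<Rightarrow> real^4) \<Rightarrow>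
    (real \<times> real \<Rightarrow> real^4) \<Rightarrow> real \<times> real \<Rightarrow> real^4" where
  "tangent_E1 \<kappa> \<tau> lam F N p = frame \<kappa> \<tau> 1 (F p) - angle \<kappa> \<tau> lam F N p *\<^sub>R N p"

definition B_const :: "real \<Rightarrow> real \<Rightarrow> real \<Rightarrow> real" where
  "B_const \<tau> lam \<nu> = \<nu>^2 * (\<tau>^2 - 1) - lam"

text \<open>The local coordinates \<open>(x, y)\<close> on a helix surface in the case \<open>B < 0\<close>; a surface given in
  these coordinates is its parametrization \<open>F\<close>. The third condition says that the function
  \<open>\<mu>\<close> determined by the shape operator is the stated one.\<close>

definition helix_coordinates :: "real \<Rightarrow> real \<Rightarrow> real \<Rightarrow> real \<Rightarrow> (real \<Rightarrow> real) \<Rightarrow>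
    real set \<Rightarrow> real set \<Rightarrow> (real \<times> real \<Rightarrow> real^4) \<Rightarrow> (real \<times> real \<Rightarrow> real^4) \<Rightarrow> bool" where
  "helix_coordinates \<kappa> \<tau> lam \<nu> \<eta> I J F N \<longleftrightarrow>
     open_interval I \<and> open_interval J \<and> smooth_on J \<eta> \<and>
     (\<forall>x\<in>I. \<forall>y\<in>J.
       let B = B_const \<tau> lam \<nu>;
           s = \<eta> y + \<nu> * sqrt (- \<kappa> * B) * x;
           \<mu> = sqrt (- \<kappa> * B) * tanh s;
           a = - (lam * \<tau> / sqrt (- B)) * sinh s;
           b = cosh s;
           T = tangent_E1 \<kappa> \<tau> lam F N (x, y);
           JT = wedge \<kappa> \<tau> (F (x, y)) (N (x, y)) T
       in frechet_derivative F (at (x, y)) (1, 0) = T \<and>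
          frechet_derivative F (at (x, y)) (0, 1) = a *\<^sub>R T + b *\<^sub>R JT \<and>
          shape_op \<kappa> \<tau> F N (x, y) JT = - (sqrt \<kappa> / 2 * lam * \<tau>) *\<^sub>R T + \<mu> *\<^sub>R JT)"

subsection \<open>The curve and the matrices\<close>

definition pseudo_orthogonal :: "real^4^4 \<Rightarrow> bool" where
  "pseudo_orthogonal A \<longleftrightarrow> (\<forall>u v. g0 (A *v u) (A *v v) = g0 u v)"

definition commutes_J1 :: "real^4^4 \<Rightarrow> bool" where
  "commutes_J1 A \<longleftrightarrow> (\<forall>v. A *v J1 v = J1 (A *v v))"

definition first_row :: "real \<Rightarrow> real \<Rightarrow> real \<Rightarrow> real^4" where
  "first_row \<xi>1 \<xi>2 \<xi>3 =
     vector [cosh \<xi>1 * cos \<xi>2, - cosh \<xi>1 * sin \<xi>2, sinh \<xi>1 * cos \<xi>3, - sinh \<xi>1 * sin \<xi>3]"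

definition Amat :: "real \<Rightarrow> real \<Rightarrow> real \<Rightarrow> real \<Rightarrow> real^4^4" where
  "Amat \<xi> \<xi>1 \<xi>2 \<xi>3 =
     (let r1 = first_row \<xi>1 \<xi>2 \<xi>3; r3 = sin \<xi> *\<^sub>R J2 r1 + cos \<xi> *\<^sub>R J3 r1
      in vector [r1, J1 r1, r3, J1 r3])"

definition helix_curve :: "real \<Rightarrow> real \<Rightarrow> real \<Rightarrow> real \<Rightarrow> real \<Rightarrow> real^4" where
  "helix_curve \<kappa> \<tau> lam \<nu> x =
     (let B = B_const \<tau> lam \<nu>;
          \<alpha> = - (sqrt \<kappa> / 2) * (B / (lam * \<tau>));
          \<beta> = \<bar>\<nu>\<bar> * (sqrt (- \<kappa> * B) / 2)
      in vector
        [2 * sqrt (lam + \<nu>^2) / sqrt (- \<kappa> * B) * cos (\<alpha> * x) * sinh (\<beta> * x),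
         2 * sqrt (lam + \<nu>^2) / sqrt (- \<kappa> * B) * sin (\<alpha> * x) * sinh (\<beta> * x),
         2 / sqrt \<kappa> * cos (\<alpha> * x) * cosh (\<beta> * x)
           - 2 * lam * \<tau> * \<bar>\<nu>\<bar> / sqrt (- \<kappa> * B) * sin (\<alpha> * x) * sinh (\<beta> * x),
         2 / sqrt \<kappa> * sin (\<alpha> * x) * cosh (\<beta> * x)
           + 2 * lam * \<tau> * \<bar>\<nu>\<bar> / sqrt (- \<kappa> * B) * cos (\<alpha> * x) * sinh (\<beta> * x)])"

definition helix_ode :: "real \<Rightarrow> real \<Rightarrow> real \<Rightarrow> (real \<Rightarrow> real) \<Rightarrow> (real \<Rightarrow> real) \<Rightarrow>
    (real \<Rightarrow> real) \<Rightarrow> real \<Rightarrow> bool" where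
  "helix_ode \<tau> lam \<nu> \<xi>1 \<xi>2 \<xi>3 y \<longleftrightarrow>
     \<bar>\<nu>\<bar> * sqrt (lam + \<nu>^2) *
       (2 * cos (\<xi>2 y - \<xi>3 y) * deriv \<xi>1 y
        + (deriv \<xi>2 y + deriv \<xi>3 y) * sin (\<xi>2 y - \<xi>3 y) * sinh (2 * \<xi>1 y))
     + 2 * lam * \<tau> * \<nu>^2 *
       ((cosh (\<xi>1 y))^2 * deriv \<xi>2 y + (sinh (\<xi>1 y))^2 * deriv \<xi>3 y) = 0"

end

theory Submission
  imports Defs
begin

text \<open>
  In the complex coordinates \<open>(x\<^sub>1 + \<i> x\<^sub>2, x\<^sub>3 + \<i> x\<^sub>4)\<close> the map \<open>J1\<close> is the multiplication by \<open>\<i>\<close>, and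
  everything needed of the Berger-like metric is expressed by \<open>g0\<close> and \<open>J1\<close>. On a helix surface
  \<open>T = E1 - \<nu> N\<close> is \<open>F\<^sub>x\<close>, so that \<open>g0 F\<^sub>x F\<close>, \<open>g0 F\<^sub>x (J1 F)\<close> and \<open>g0 F\<^sub>x F\<^sub>x\<close> are known constants and
  \<open>F\<^sub>y = a F\<^sub>x + (b / \<nu>) (J1 F\<^sub>x + c F)\<close>. Differentiating these identities, together with
  \<open>F\<^sub>x\<^sub>y = F\<^sub>y\<^sub>x\<close>, yields the complex linear equation \<open>F\<^sub>x\<^sub>x = (\<alpha>\<^sup>2 + \<beta>\<^sup>2) F + 2 \<alpha> J1 F\<^sub>x\<close>. Hence
  \<open>F = exp (\<i> \<alpha> x) (cosh (\<beta> x) C(y) + sinh (\<beta> x) D(y))\<close>, and the constants say that some \<open>A(y)\<close> in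
  \<open>U(1,1)\<close> maps the coefficients \<open>P\<close>, \<open>Q\<close> of the curve to \<open>C(y)\<close>, \<open>D(y)\<close>. The determinant of \<open>A(y)\<close>
  is constant because the complex linear flow in \<open>y\<close> is trace free; this makes \<open>\<xi>\<close> constant. The
  off-diagonal entry of \<open>A\<close> has only simple zeros, so it has a smooth polar form
  \<open>sinh \<xi>1 exp (\<i> \<xi>3)\<close> even through its zeros. Finally \<open>g\<^sub>\<tau>(N, F\<^sub>y) = 0\<close>, \<open>g0 D C' = 0\<close> and the equation
  for \<open>\<xi>1\<close>, \<open>\<xi>2\<close>, \<open>\<xi>3\<close> are equivalent, which also gives the converse, with \<open>N = (E1 - F\<^sub>x) / \<nu>\<close>.
\<close>

subsection \<open>Smooth functions\<close>

text \<open>Three facts carry the argument. The vectors \<open>g0\<close>-orthogonal to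
  \<open>F\<close> and \<open>J1 F\<close> form a positive definite complex line, so a vector such
  as T_x is determined by its pairings with \<open>F\<close>, \<open>J1 F\<close>, \<open>T\<close>
  and \<open>J1 T\<close>. Differentiation in x supplies three of them; the fourth comes from the
  y-derivative of \<open>g0 T T\<close>, with T_y replaced by the x-derivative of F_y and the
  nowhere vanishing factor cosh cancelled. An element of U(1,1) has rows (p, q) and e (cnj q, cnj
  p), where e is its determinant. Hence the single angle \<xi> records exactly the determinant, and
  only the first row needs a polar form. A smooth complex function with zeros has in general no
  smooth polar form. At a simple zero it has one, provided that the radius may change sign, because
  the squared phase \<open>u / cnj u\<close> ignores real factors. A zero of higher order of the
  first coordinate of C(y) is impossible: it would make cosh(\<eta> + \<omega> x) a constant
  multiple of sinh(\<omega> x) on an interval of x, with \<omega> = \<nu> k \<rho>.\<close>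

lemma has_derivative_cong_open:
  assumes "open S" "x \<in> S" "\<And>x. x \<in> S \<Longrightarrow> f x = g x"
  shows "(f has_derivative D) (at x) \<longleftrightarrow> (g has_derivative D) (at x)"
  using has_derivative_transform_within_open[OF _ assms(1,2), of f D UNIV g]
    has_derivative_transform_within_open[OF _ assms(1,2), of g D UNIV f] assms(3) by auto

lemma higher_differentiable_on_cong:
  assumes "open S" "\<And>x. x \<in> S \<Longrightarrow> f x = g x"
  shows "higher_differentiable_on S f n = higher_differentiable_on S g n"
  using assms(2)
proof (induction n arbitrary: f g)
  case 0
  then have "continuous_on S f \<longleftrightarrow> continuous_on S g"
    by (intro continuous_on_cong) auto
  then show ?case
    by simp
next
  case (Suc n)
  have D: "(f has_derivative D) (at x) = (g has_derivative D) (at x)" if "x \<in> S" for x D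
    using has_derivative_cong_open[OF assms(1) that Suc.prems] .
  have "f differentiable (at x) \<longleftrightarrow> g differentiable (at x)" if "x \<in> S" for x
    using D[OF that] by (simp add: differentiable_def)
  \<comment> \<open>\<open>frechet_derivative\<close> is a choice over the predicate
    \<open>has_derivative\<close>. The two predicates coincide at points of \<open>S\<close>, so the
    chosen values agree without any appeal to differentiability.\<close>
  moreover have "higher_differentiable_on S (\<lambda>x. frechet_derivative f (at x) v) n =
      higher_differentiable_on S (\<lambda>x. frechet_derivative g (at x) v) n" for v
    by (rule Suc.IH) (simp add: frechet_derivative_def D)
  ultimately show ?case
    unfolding higher_differentiable_on.simps by blast
qed

text \<open>Replaces the chosen \<open>frechet_derivative\<close> by an explicit formula, so that
  the closure properties below become inductions over the usual rules of differentiation.\<close>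

lemma higher_differentiable_on_SucI:
  assumes "open S"
    and "\<And>x. x \<in> S \<Longrightarrow> (f has_derivative f' x) (at x)"
    and "\<And>v. higher_differentiable_on S (\<lambda>x. f' x v) n"
  shows "higher_differentiable_on S f (Suc n)"
proof -
  have "frechet_derivative f (at x) v = f' x v" if "x \<in> S" for x v
    using frechet_derivative_at[OF assms(2)[OF that]] by simp
  then have "higher_differentiable_on S (\<lambda>x. frechet_derivative f (at x) v) n" for v
    using higher_differentiable_on_cong[OF assms(1), of "\<lambda>x. frechet_derivative f (at x) v" "\<lambda>x. f' x v"]
      assms(3) by blast
  moreover have "f differentiable (at x)" if "x \<in> S" for x
    using assms(2)[OF that] by (rule differentiableI)
  ultimately show ?thesis
    unfolding higher_differentiable_on.simps by blast
qed

lemma higher_differentiable_on_subset: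
  "higher_differentiable_on S f n \<Longrightarrow> T \<subseteq> S \<Longrightarrow> higher_differentiable_on T f n"
proof (induction n arbitrary: f)
  case 0
  then show ?case
    using continuous_on_subset by simp
next
  case (Suc n)
  have "higher_differentiable_on T (\<lambda>x. frechet_derivative f (at x) v) n" for v
    by (rule Suc.IH) (use Suc.prems in simp_all)
  then show ?case
    using Suc.prems by auto
qed

lemma higher_differentiable_on_Suc_imp:
  "higher_differentiable_on S f (Suc n) \<Longrightarrow> higher_differentiable_on S f n"
proof (induction n arbitrary: f)
  case 0
  then have "f differentiable (at x)" if "x \<in> S" for x
    using that by simp
  then show ?case
    by (simp add: continuous_at_imp_continuous_on differentiable_imp_continuous_within)
next
  case (Suc n)
  have "higher_differentiable_on S (\<lambda>x. frechet_derivative f (at x) v) n" for v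
    by (rule Suc.IH) (use Suc.prems in simp)
  then show ?case
    using Suc.prems by simp
qed

lemma higher_differentiable_on_const: "higher_differentiable_on S (\<lambda>x. c) n"
  by (induction n arbitrary: c) auto

lemma higher_differentiable_on_bounded_linear:
  assumes "open S" "bounded_linear L" "higher_differentiable_on S f n"
  shows "higher_differentiable_on S (\<lambda>x. L (f x)) n"
  using assms(3)
proof (induction n arbitrary: f)
  case 0
  then show ?case
    by (auto intro: bounded_linear.continuous_on[OF assms(2)])
next
  case (Suc n)
  show ?case
  proof (rule higher_differentiable_on_SucI[OF assms(1)])
    fix x assume "x \<in> S"
    then have "(f has_derivative frechet_derivative f (at x)) (at x)"
      using Suc.prems by (simp add: frechet_derivative_works)
    then show "((\<lambda>x. L (f x)) has_derivative (\<lambda>v. L (frechet_derivative f (at x) v))) (at x)"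
      by (rule bounded_linear.has_derivative[OF assms(2)])
  next
    fix v show "higher_differentiable_on S (\<lambda>x. L (frechet_derivative f (at x) v)) n"
      using Suc by auto
  qed
qed

lemma higher_differentiable_on_add:
  assumes "open S" "higher_differentiable_on S f n" "higher_differentiable_on S g n"
  shows "higher_differentiable_on S (\<lambda>x. f x + g x) n"
  using assms(2,3)
proof (induction n arbitrary: f g)
  case 0
  then show ?case
    by (auto intro: continuous_on_add)
next
  case (Suc n)
  show ?case
  proof (rule higher_differentiable_on_SucI[OF assms(1)])
    fix x assume "x \<in> S"
    then show "((\<lambda>x. f x + g x) has_derivative
        (\<lambda>v. frechet_derivative f (at x) v + frechet_derivative g (at x) v)) (at x)"
      using Suc.prems by (auto simp: frechet_derivative_works intro!: has_derivative_add)
  next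
    fix v show "higher_differentiable_on S
        (\<lambda>x. frechet_derivative f (at x) v + frechet_derivative g (at x) v) n"
      using Suc by auto
  qed
qed

lemma higher_differentiable_on_bounded_bilinear:
  assumes "open S" "bounded_bilinear pr" "higher_differentiable_on S f n"
    "higher_differentiable_on S g n"
  shows "higher_differentiable_on S (\<lambda>x. pr (f x) (g x)) n"
  using assms(3,4)
proof (induction n arbitrary: f g)
  case 0
  then show ?case
    by (auto intro: bounded_bilinear.continuous_on[OF assms(2)])
next
  case (Suc n)
  show ?case
  proof (rule higher_differentiable_on_SucI[OF assms(1)])
    fix x assume "x \<in> S"
    then show "((\<lambda>x. pr (f x) (g x)) has_derivative
        (\<lambda>v. pr (f x) (frechet_derivative g (at x) v) + pr (frechet_derivative f (at x) v) (g x))) (at x)"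
      using Suc.prems
      by (auto simp: frechet_derivative_works intro!: bounded_bilinear.FDERIV[OF assms(2)])
  next
    fix v
    have "higher_differentiable_on S f n" "higher_differentiable_on S g n"
      using Suc.prems by (blast intro: higher_differentiable_on_Suc_imp)+
    then show "higher_differentiable_on S
        (\<lambda>x. pr (f x) (frechet_derivative g (at x) v) + pr (frechet_derivative f (at x) v) (g x)) n"
      using Suc by (auto intro!: higher_differentiable_on_add assms(1))
  qed
qed

text \<open>For an outer function of one real variable the chain rule is a product: the real number
  \<open>f' x v\<close> scales the vector \<open>g' (f x) 1\<close>. The induction therefore closes
  with the bilinear rule.\<close>

lemma higher_differentiable_on_compose_real:
  fixes g :: "real \<Rightarrow> 'b::real_normed_vector"
  assumes "open S" "open T" "f ` S \<subseteq> T"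
    "higher_differentiable_on S f n" "higher_differentiable_on T g n"
  shows "higher_differentiable_on S (\<lambda>x. g (f x)) n"
  using assms(4,5)
proof (induction n arbitrary: g)
  case 0
  then show ?case
    using assms(3) by (auto intro: continuous_on_compose2)
next
  case (Suc n)
  show ?case
  proof (rule higher_differentiable_on_SucI[OF assms(1)])
    fix x assume "x \<in> S"
    then have f: "(f has_derivative frechet_derivative f (at x)) (at x)"
      and g: "(g has_derivative frechet_derivative g (at (f x))) (at (f x))"
      using Suc.prems assms(3) by (auto simp: frechet_derivative_works)
    have lin: "frechet_derivative g (at (f x)) r = r *\<^sub>R frechet_derivative g (at (f x)) 1" for r
      using linear_scale[OF has_derivative_linear[OF g], of r 1] by simp
    have "((\<lambda>x. g (f x)) has_derivative
       (\<lambda>v. frechet_derivative g (at (f x)) (frechet_derivative f (at x) v))) (at x)"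
      using has_derivative_compose[OF f g] .
    then show "((\<lambda>x. g (f x)) has_derivative
        (\<lambda>v. frechet_derivative f (at x) v *\<^sub>R frechet_derivative g (at (f x)) 1)) (at x)"
      by (subst (asm) lin)
  next
    fix v
    show "higher_differentiable_on S
        (\<lambda>x. frechet_derivative f (at x) v *\<^sub>R frechet_derivative g (at (f x)) 1) n"
      using Suc.prems Suc.IH[OF higher_differentiable_on_Suc_imp[OF Suc.prems(1)],
          of "\<lambda>t. frechet_derivative g (at t) 1"]
      by (intro higher_differentiable_on_bounded_bilinear[OF assms(1) bounded_bilinear_scaleR]) simp_all
  qed
qed

text \<open>Serves functions that have different smooth formulas near different points, such as the
  phase of a function near a zero and away from its zeros.\<close>

lemma higher_differentiable_on_locally:
  assumes "\<And>x. x \<in> S \<Longrightarrow> \<exists>T. open T \<and> x \<in> T \<and> higher_differentiable_on T f n"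
  shows "higher_differentiable_on S f n"
  using assms
proof (induction n arbitrary: f)
  case 0
  have "isCont f x" if "x \<in> S" for x
    using 0[OF that] by (auto simp: continuous_on_eq_continuous_at)
  then show ?case
    by (simp add: continuous_at_imp_continuous_on)
next
  case (Suc n)
  have "higher_differentiable_on S (\<lambda>x. frechet_derivative f (at x) v) n" for v
  proof (rule Suc.IH)
    fix x assume "x \<in> S"
    then obtain T where "open T" "x \<in> T" "higher_differentiable_on T f (Suc n)"
      using Suc.prems by blast
    then show "\<exists>T. open T \<and> x \<in> T \<and> higher_differentiable_on T (\<lambda>x. frechet_derivative f (at x) v) n"
      by auto
  qed
  moreover have "f differentiable (at x)" if x: "x \<in> S" for x
  proof -
    obtain T where "open T" "x \<in> T" "higher_differentiable_on T f (Suc n)"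
      using Suc.prems[OF x] by blast
    then show ?thesis by simp
  qed
  ultimately show ?case
    by simp
qed

lemma smooth_on_imp_continuous_on: "smooth_on S f \<Longrightarrow> continuous_on S f"
  by (drule smooth_on_def[THEN iffD1, THEN spec[of _ 0]]) simp

lemma smooth_on_has_derivative:
  "smooth_on S f \<Longrightarrow> x \<in> S \<Longrightarrow> (f has_derivative frechet_derivative f (at x)) (at x)"
  by (drule smooth_on_def[THEN iffD1, THEN spec[of _ 1]]) (simp add: frechet_derivative_works)

lemma smooth_on_frechet_derivative:
  "smooth_on S f \<Longrightarrow> smooth_on S (\<lambda>x. frechet_derivative f (at x) v)"
  unfolding smooth_on_def
proof
  fix n assume "\<forall>n. higher_differentiable_on S f n"
  then have "higher_differentiable_on S f (Suc n)" ..
  then show "higher_differentiable_on S (\<lambda>x. frechet_derivative f (at x) v) n"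
    by simp
qed

lemma smooth_on_cong:
  "open S \<Longrightarrow> (\<And>x. x \<in> S \<Longrightarrow> f x = g x) \<Longrightarrow> smooth_on S f \<longleftrightarrow> smooth_on S g"
  unfolding smooth_on_def using higher_differentiable_on_cong by blast

lemma smooth_on_derivativeI:
  assumes "open S" "\<And>x. x \<in> S \<Longrightarrow> (f has_derivative f' x) (at x)"
    "\<And>v. smooth_on S (\<lambda>x. f' x v)"
  shows "smooth_on S f"
  unfolding smooth_on_def
proof
  fix n show "higher_differentiable_on S f n"
    using higher_differentiable_on_Suc_imp higher_differentiable_on_SucI[OF assms(1,2)] assms(3)
    unfolding smooth_on_def by blast
qed

lemma smooth_on_subset: "smooth_on S f \<Longrightarrow> T \<subseteq> S \<Longrightarrow> smooth_on T f"
  unfolding smooth_on_def using higher_differentiable_on_subset by blast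

lemma smooth_on_locally:
  assumes "\<And>x. x \<in> S \<Longrightarrow> \<exists>T. open T \<and> x \<in> T \<and> smooth_on T f"
  shows "smooth_on S f"
  unfolding smooth_on_def
  by (intro allI higher_differentiable_on_locally) (metis assms smooth_on_def)

lemma smooth_on_const: "smooth_on S (\<lambda>x. c)"
  by (simp add: smooth_on_def higher_differentiable_on_const)

lemma smooth_on_bounded_linear:
  "bounded_linear L \<Longrightarrow> open S \<Longrightarrow> smooth_on S f \<Longrightarrow> smooth_on S (\<lambda>x. L (f x))"
  by (simp add: smooth_on_def higher_differentiable_on_bounded_linear)

lemma smooth_on_add:
  "open S \<Longrightarrow> smooth_on S f \<Longrightarrow> smooth_on S g \<Longrightarrow> smooth_on S (\<lambda>x. f x + g x)"
  by (simp add: smooth_on_def higher_differentiable_on_add)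

lemma smooth_on_bounded_bilinear:
  "bounded_bilinear pr \<Longrightarrow> open S \<Longrightarrow> smooth_on S f \<Longrightarrow> smooth_on S g \<Longrightarrow>
    smooth_on S (\<lambda>x. pr (f x) (g x))"
  by (simp add: smooth_on_def higher_differentiable_on_bounded_bilinear)

lemmas smooth_on_mult = smooth_on_bounded_bilinear[OF bounded_bilinear_mult]
lemmas smooth_on_scaleR = smooth_on_bounded_bilinear[OF bounded_bilinear_scaleR]
lemmas smooth_on_minus = smooth_on_bounded_linear[OF bounded_linear_minus[OF bounded_linear_ident]]
lemmas smooth_on_cnj = smooth_on_bounded_linear[OF bounded_linear_cnj]
lemmas smooth_on_Re = smooth_on_bounded_linear[OF bounded_linear_Re]
lemmas smooth_on_Im = smooth_on_bounded_linear[OF bounded_linear_Im]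
lemmas smooth_on_complex_of_real = smooth_on_bounded_linear[OF bounded_linear_of_real]

lemma smooth_on_diff:
  "open S \<Longrightarrow> smooth_on S f \<Longrightarrow> smooth_on S g \<Longrightarrow> smooth_on S (\<lambda>x. f x - g x)"
  using smooth_on_add[of S f "\<lambda>x. - g x"] smooth_on_minus by force

lemma smooth_on_ident: "open S \<Longrightarrow> smooth_on S (\<lambda>x. x)"
  by (rule smooth_on_derivativeI[where f' = "\<lambda>_ v. v"]) (auto intro: smooth_on_const)

lemmas smooth_on_fst = smooth_on_bounded_linear[OF bounded_linear_fst _ smooth_on_ident]
lemmas smooth_on_snd = smooth_on_bounded_linear[OF bounded_linear_snd _ smooth_on_ident]

lemma smooth_on_compose_real:
  fixes g :: "real \<Rightarrow> 'b::real_normed_vector"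
  assumes "smooth_on T g" "open S" "open T" "f ` S \<subseteq> T" "smooth_on S f"
  shows "smooth_on S (\<lambda>x. g (f x))"
  using assms higher_differentiable_on_compose_real unfolding smooth_on_def by blast

lemma smooth_on_Pair_left:
  fixes F :: "real \<times> real \<Rightarrow> 'b::real_normed_vector"
  assumes "open J" "x \<in> I" "smooth_on (I \<times> J) F"
  shows "smooth_on J (\<lambda>y. F (x, y))"
proof -
  have "higher_differentiable_on J (\<lambda>y. F (x, y)) n" if "higher_differentiable_on (I \<times> J) F n" for n
    using that
  proof (induction n arbitrary: F)
    case 0
    then show ?case
      using assms(2) by (auto intro!: continuous_on_compose2[of "I \<times> J" F] continuous_intros)
  next
    case (Suc n)
    show ?case
    proof (rule higher_differentiable_on_SucI[OF assms(1)])
      fix y assume "y \<in> J"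
      then have "(F has_derivative frechet_derivative F (at (x, y))) (at (x, y))"
        using Suc.prems assms(2) by (simp add: frechet_derivative_works)
      moreover have "(Pair x has_derivative (\<lambda>v. (0, v))) (at y)"
        by (intro derivative_eq_intros) auto
      ultimately show "((\<lambda>y. F (x, y)) has_derivative (\<lambda>v. frechet_derivative F (at (x, y)) (0, v))) (at y)"
        using has_derivative_compose by blast
    next
      fix v show "higher_differentiable_on J (\<lambda>y. frechet_derivative F (at (x, y)) (0, v)) n"
        using Suc.prems Suc.IH[of "\<lambda>p. frechet_derivative F (at p) (0, v)"] by auto
    qed
  qed
  then show ?thesis
    using assms(3) by (auto simp: smooth_on_def)
qed

text \<open>The direction from the derivative to the function gives smoothness of angles obtained by
  integration; the other one makes \<open>vector_derivative\<close> available as a smooth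
  function.\<close>

lemma smooth_on_real_iff:
  fixes f :: "real \<Rightarrow> 'b::real_normed_vector"
  assumes "open S" "\<And>x. x \<in> S \<Longrightarrow> (f has_vector_derivative f' x) (at x)"
  shows "smooth_on S f \<longleftrightarrow> smooth_on S f'"
proof
  assume f': "smooth_on S f'"
  show "smooth_on S f"
  proof (rule smooth_on_derivativeI[OF assms(1)])
    show "(f has_derivative (\<lambda>v. v *\<^sub>R f' x)) (at x)" if "x \<in> S" for x
      using assms(2)[OF that] by (simp add: has_vector_derivative_def)
    show "smooth_on S (\<lambda>x. v *\<^sub>R f' x)" for v
      using smooth_on_bounded_linear[OF bounded_linear_scaleR_right assms(1) f'] .
  qed
next
  assume "smooth_on S f"
  then have "smooth_on S (\<lambda>x. frechet_derivative f (at x) 1)"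
    by (rule smooth_on_frechet_derivative)
  moreover have "frechet_derivative f (at x) 1 = f' x" if "x \<in> S" for x
    using frechet_derivative_at[OF assms(2)[OF that, unfolded has_vector_derivative_def]]
    by (metis scaleR_one)
  ultimately show "smooth_on S f'"
    using smooth_on_cong[OF assms(1), of "\<lambda>x. frechet_derivative f (at x) 1" f'] by blast
qed

lemma smooth_on_vector_derivative:
  fixes f :: "real \<Rightarrow> 'b::real_normed_vector"
  assumes "smooth_on S f" "x \<in> S"
  shows "(f has_vector_derivative vector_derivative f (at x)) (at x)"
  using smooth_on_has_derivative[OF assms] differentiableI_vector differentiable_def
    vector_derivative_works by blast

section \<open>Smoothness of elementary functions\<close>

lemma smooth_on_exp: "smooth_on UNIV (\<lambda>x::real. exp (c * x))"
  unfolding smooth_on_def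
proof
  \<comment> \<open>The factor \<open>k\<close> is generalised because it is all that
    differentiation changes.\<close>
  have "higher_differentiable_on UNIV (\<lambda>x::real. k * exp (c * x)) n" for n k
  proof (induction n arbitrary: k)
    case 0
    show ?case by (auto intro!: continuous_intros)
  next
    case (Suc n)
    show ?case
    proof (rule higher_differentiable_on_SucI)
      show "((\<lambda>x. k * exp (c * x)) has_derivative (\<lambda>v. (v * k * c) * exp (c * x))) (at x)" for x
        by (auto intro!: derivative_eq_intros simp: algebra_simps)
      show "higher_differentiable_on UNIV (\<lambda>x. (v * k * c) * exp (c * x)) n" for v
        by (rule Suc)
    qed simp
  qed
  from this[of 1] show "higher_differentiable_on UNIV (\<lambda>x::real. exp (c * x)) n" for n by simp
qed

lemma smooth_on_cosh_sinh:
  "smooth_on UNIV (cosh :: real \<Rightarrow> real)" "smooth_on UNIV (sinh :: real \<Rightarrow> real)"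
proof -
  have e: "smooth_on UNIV (\<lambda>x::real. c * exp (d * x))" for c d
    by (intro smooth_on_mult smooth_on_const smooth_on_exp open_UNIV)
  have "cosh = (\<lambda>x::real. (1/2) * exp (1 * x) + (1/2) * exp ((-1) * x))"
    "sinh = (\<lambda>x::real. (1/2) * exp (1 * x) + (-1/2) * exp ((-1) * x))"
    by (auto simp: cosh_def sinh_def fun_eq_iff field_simps)
  then show "smooth_on UNIV (cosh :: real \<Rightarrow> real)" "smooth_on UNIV (sinh :: real \<Rightarrow> real)"
    using smooth_on_add[OF open_UNIV e e] by metis+
qed

lemma smooth_on_sin_cos:
  "smooth_on UNIV (sin :: real \<Rightarrow> real)" "smooth_on UNIV (cos :: real \<Rightarrow> real)"
proof -
  \<comment> \<open>The span of sin and cos is closed under differentiation, so the induction runs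
    over all of it.\<close>
  have "higher_differentiable_on UNIV (\<lambda>x::real. a * sin x + b * cos x) n" for n a b
  proof (induction n arbitrary: a b)
    case 0
    show ?case by (auto intro!: continuous_intros)
  next
    case (Suc n)
    show ?case
    proof (rule higher_differentiable_on_SucI)
      show "((\<lambda>x. a * sin x + b * cos x) has_derivative (\<lambda>v. (- b * v) * sin x + (a * v) * cos x)) (at x)" for x
        by (auto intro!: derivative_eq_intros simp: algebra_simps)
      show "higher_differentiable_on UNIV (\<lambda>x. (- b * v) * sin x + (a * v) * cos x) n" for v
        by (rule Suc)
    qed simp
  qed
  from this[of 1 0] this[of 0 1]
  show "smooth_on UNIV (sin :: real \<Rightarrow> real)" "smooth_on UNIV (cos :: real \<Rightarrow> real)"
    by (simp_all add: smooth_on_def)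
qed

lemma smooth_on_inverse_real: "smooth_on {x. x \<noteq> 0} (inverse :: real \<Rightarrow> real)"
  unfolding smooth_on_def
proof
  have op: "open {x::real. x \<noteq> 0}"
    by (auto intro!: open_Collect_neq continuous_intros)
  fix n show "higher_differentiable_on {x. x \<noteq> 0} (inverse :: real \<Rightarrow> real) n"
  proof (induction n)
    case 0
    show ?case by (auto intro!: continuous_intros)
  next
    case (Suc n)
    show ?case
    proof (rule higher_differentiable_on_SucI[OF op])
      show "(inverse has_derivative (\<lambda>v. (inverse x * inverse x) * (- v))) (at x)"
        if "x \<in> {x. x \<noteq> 0}" for x :: real
        using that by (auto intro!: derivative_eq_intros)
      show "higher_differentiable_on {x::real. x \<noteq> 0} (\<lambda>x. inverse x * inverse x * - v) n" for v
        by (intro higher_differentiable_on_bounded_bilinear[OF op bounded_bilinear_mult] Suc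
            higher_differentiable_on_const)
    qed
  qed
qed

lemma smooth_on_sqrt: "smooth_on {0<..} sqrt"
  unfolding smooth_on_def
proof
  fix n show "higher_differentiable_on {0<..} sqrt n"
  proof (induction n)
    case 0
    show ?case by (auto intro!: continuous_intros)
  next
    case (Suc n)
    have op: "open {x::real. x \<noteq> 0}"
      by (auto intro!: open_Collect_neq continuous_intros)
    show ?case
    proof (rule higher_differentiable_on_SucI)
      show "(sqrt has_derivative (\<lambda>v. inverse (sqrt x) * (v / 2))) (at x)"
        if "x \<in> {0<..}" for x :: real
        using that by (auto intro!: derivative_eq_intros simp: field_simps)
      have "higher_differentiable_on {0<..} (\<lambda>x. inverse (sqrt x)) n"
        by (rule higher_differentiable_on_compose_real[OF _ op _ Suc])
          (use smooth_on_inverse_real in \<open>auto simp: smooth_on_def\<close>)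
      then show "higher_differentiable_on {0<..} (\<lambda>x. inverse (sqrt x) * (v / 2)) n" for v
        by (intro higher_differentiable_on_bounded_bilinear[OF _ bounded_bilinear_mult]
            higher_differentiable_on_const) auto
    qed simp
  qed
qed

lemma smooth_on_inverse:
  fixes f :: "'a::real_normed_vector \<Rightarrow> real"
  assumes "open S" "smooth_on S f" "\<And>x. x \<in> S \<Longrightarrow> f x \<noteq> 0"
  shows "smooth_on S (\<lambda>x. inverse (f x))"
  by (rule smooth_on_compose_real[OF smooth_on_inverse_real _ _ _ assms(2)])
    (use assms in \<open>auto intro!: open_Collect_neq continuous_intros\<close>)

lemma smooth_on_arsinh: "smooth_on UNIV (arsinh :: real \<Rightarrow> real)"
proof -
  have pos: "x^2 + 1 > 0" for x :: real
    by (simp add: add_nonneg_pos)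
  have "smooth_on UNIV (\<lambda>x::real. x^2 + 1)"
    unfolding power2_eq_square
    by (intro smooth_on_add smooth_on_mult smooth_on_ident smooth_on_const open_UNIV)
  then have "smooth_on UNIV (\<lambda>x::real. sqrt (x^2 + 1))"
    by (intro smooth_on_compose_real[OF smooth_on_sqrt]) (use pos in auto)
  then have "smooth_on UNIV (\<lambda>x::real. inverse (sqrt (x^2 + 1)))"
    by (rule smooth_on_inverse[OF open_UNIV]) (use pos in \<open>auto simp: less_imp_neq[symmetric]\<close>)
  moreover have "(arsinh has_vector_derivative inverse (sqrt (x^2 + 1))) (at x)" for x :: real
    unfolding has_real_derivative_iff_has_vector_derivative[symmetric]
    by (auto intro!: derivative_eq_intros simp: field_simps)
  ultimately show ?thesis
    using smooth_on_real_iff[OF open_UNIV, of arsinh "\<lambda>x. inverse (sqrt (x^2 + 1))"] by simp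
qed

lemmas smooth_on_cosh_compose = smooth_on_compose_real[OF smooth_on_cosh_sinh(1) _ open_UNIV subset_UNIV]
lemmas smooth_on_sinh_compose = smooth_on_compose_real[OF smooth_on_cosh_sinh(2) _ open_UNIV subset_UNIV]
lemmas smooth_on_sin_compose = smooth_on_compose_real[OF smooth_on_sin_cos(1) _ open_UNIV subset_UNIV]
lemmas smooth_on_cos_compose = smooth_on_compose_real[OF smooth_on_sin_cos(2) _ open_UNIV subset_UNIV]
lemmas smooth_on_arsinh_compose = smooth_on_compose_real[OF smooth_on_arsinh _ open_UNIV subset_UNIV]

lemma smooth_on_cis:
  assumes "open S" "smooth_on S f"
  shows "smooth_on S (\<lambda>x. cis (f x))"
proof -
  have "cis (f x) = complex_of_real (cos (f x)) + \<i> * complex_of_real (sin (f x))" for x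
    by (simp add: complex_eq_iff)
  moreover have "smooth_on S (\<lambda>x. complex_of_real (cos (f x)) + \<i> * complex_of_real (sin (f x)))"
    by (intro smooth_on_add[OF assms(1)] smooth_on_mult[OF assms(1)] smooth_on_complex_of_real[OF assms(1)]
        smooth_on_const smooth_on_sin_compose smooth_on_cos_compose assms)
  ultimately show ?thesis
    by (simp only:)
qed

section \<open>Partial derivatives of maps on the plane\<close>

lemma partial_derivatives:
  fixes F :: "real \<times> real \<Rightarrow> 'b::real_normed_vector"
  assumes "(F has_derivative D) (at (x, y))"
  shows "((\<lambda>x. F (x, y)) has_vector_derivative D (1, 0)) (at x)"
    "((\<lambda>y. F (x, y)) has_vector_derivative D (0, 1)) (at y)"
    "D (v, w) = v *\<^sub>R D (1, 0) + w *\<^sub>R D (0, 1)"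
proof -
  have lin: "linear D"
    using assms has_derivative_linear by blast
  have v0: "D (v, 0) = v *\<^sub>R D (1, 0)" for v
    using linear_scale[OF lin, of v "(1, 0)"] by simp
  have w0: "D (0, w) = w *\<^sub>R D (0, 1)" for w
    using linear_scale[OF lin, of w "(0, 1)"] by simp
  have "((\<lambda>x. (x, y)) has_derivative (\<lambda>v. (v, 0))) (at x)"
    by (auto intro!: derivative_eq_intros)
  from has_derivative_compose[OF this assms]
  show "((\<lambda>x. F (x, y)) has_vector_derivative D (1, 0)) (at x)"
    unfolding has_vector_derivative_def v0[symmetric] .
  have "((\<lambda>y. (x, y)) has_derivative (\<lambda>v. (0, v))) (at y)"
    by (auto intro!: derivative_eq_intros)
  from has_derivative_compose[OF this assms]
  show "((\<lambda>y. F (x, y)) has_vector_derivative D (0, 1)) (at y)"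
    unfolding has_vector_derivative_def w0[symmetric] .
  show "D (v, w) = v *\<^sub>R D (1, 0) + w *\<^sub>R D (0, 1)"
    using linear_add[OF lin, of "(v, 0)" "(0, w)"] unfolding v0[symmetric] w0[symmetric] by simp
qed

text \<open>The increment of \<open>F\<close> in x is the integral of \<open>Fx\<close>.
  Differentiating this identity in y under the integral sign expresses the increment of
  \<open>Fy\<close> as an integral of the derivative of \<open>Fx\<close> in y, and differentiating
  in the upper limit yields the symmetry.\<close>

lemma mixed_partials:
  fixes F :: "real \<times> real \<Rightarrow> 'a::euclidean_space"
  assumes I: "open_interval I" and J: "open_interval J" and F: "smooth_on (I \<times> J) F"
    and x: "x \<in> I" and y: "y \<in> J"
  defines "Fx \<equiv> \<lambda>p. frechet_derivative F (at p) (1, 0)"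
    and "Fy \<equiv> \<lambda>p. frechet_derivative F (at p) (0, 1)"
  shows "frechet_derivative Fx (at (x, y)) (0, 1) = frechet_derivative Fy (at (x, y)) (1, 0)"
proof -
  have oI: "open I" and oJ: "open J" and cJ: "convex J"
    using I J is_interval_convex by (auto simp: open_interval_def)
  obtain e where e: "e > 0" "cball x e \<subseteq> I"
    using open_contains_cball oI x by blast
  \<comment> \<open>A compact segment inside \<open>I\<close> with x in its interior, so that
    derivatives within the segment are derivatives at x.\<close>
  define u v where "u = x - e" and "v = x + e"
  have uv: "u < x" "x < v" "{u..v} \<subseteq> I"
    using e by (auto simp: u_def v_def cball_eq_atLeastAtMost)
  have smx: "smooth_on (I \<times> J) Fx" and smy: "smooth_on (I \<times> J) Fy"
    unfolding Fx_def Fy_def by (intro smooth_on_frechet_derivative F)+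
  define K where "K t y = frechet_derivative Fx (at (t, y)) (0, 1)" for t y
  have smK: "smooth_on (I \<times> J) (\<lambda>p. frechet_derivative Fx (at p) (0, 1))"
    by (intro smooth_on_frechet_derivative smx)
  have Kc: "continuous_on (I \<times> J) (\<lambda>(t, y). K t y)"
    using smooth_on_imp_continuous_on[OF smK] by (simp add: K_def split_beta)
  have dF: "(F has_derivative frechet_derivative F (at p)) (at p)" if "p \<in> I \<times> J" for p
    using smooth_on_has_derivative[OF F that] .
  have Fx_at: "((\<lambda>x. F (x, y)) has_vector_derivative Fx (z, y)) (at z)"
    and Fy_at: "((\<lambda>y. F (z, y)) has_vector_derivative Fy (z, y)) (at y)"
    if "z \<in> I" "y \<in> J" for z y
    using partial_derivatives(1,2)[OF dF, of z y] that by (simp_all add: Fx_def Fy_def)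
  have ftc: "integral {u..z} (\<lambda>t. Fx (t, y')) = F (z, y') - F (u, y')"
    if "z \<in> {u..v}" "y' \<in> J" for z y'
  proof (rule integral_unique, rule fundamental_theorem_of_calculus)
    fix t assume "t \<in> {u..z}"
    then have "t \<in> I"
      using that uv by auto
    from Fx_at[OF this that(2)]
    show "((\<lambda>t. F (t, y')) has_vector_derivative Fx (t, y')) (at t within {u..z})"
      by (rule has_vector_derivative_at_within)
  qed (use that in simp)
  have Fy_int: "Fy (z, y) = Fy (u, y) + integral {u..z} (\<lambda>t. K t y)" if z: "z \<in> {u..v}" for z
  proof -
    have sub: "{u..z} \<subseteq> I"
      using z uv by auto
    have "((\<lambda>y. integral (cbox u z) (\<lambda>t. Fx (t, y))) has_vector_derivative
        integral (cbox u z) (\<lambda>t. K t y)) (at y within J)"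
    proof (rule leibniz_rule_vector_derivative[OF _ _ _ y cJ])
      fix y' t assume "y' \<in> J" "t \<in> cbox u z"
      then have "(t, y') \<in> I \<times> J"
        using sub by auto
      from partial_derivatives(2)[OF smooth_on_has_derivative[OF smx this]]
      show "((\<lambda>y. Fx (t, y)) has_vector_derivative K t y') (at y' within J)"
        unfolding K_def by (rule has_vector_derivative_at_within)
    next
      fix y' assume "y' \<in> J"
      then show "(\<lambda>t. Fx (t, y')) integrable_on cbox u z"
        using sub by (intro integrable_continuous
            continuous_on_compose2[OF smooth_on_imp_continuous_on[OF smx]] continuous_intros) auto
    next
      show "continuous_on (J \<times> cbox u z) (\<lambda>(y, t). K t y)"
        using continuous_on_compose2[OF Kc, of "J \<times> cbox u z" "\<lambda>p. (snd p, fst p)"] sub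
        by (force simp: split_beta intro!: continuous_intros)
    qed
    then have 1: "((\<lambda>y. integral (cbox u z) (\<lambda>t. Fx (t, y))) has_vector_derivative
        integral (cbox u z) (\<lambda>t. K t y)) (at y)"
      using at_within_open[OF y oJ] by simp
    have zI: "z \<in> I" "u \<in> I"
      using z uv by auto
    have "((\<lambda>y. F (z, y) - F (u, y)) has_vector_derivative Fy (z, y) - Fy (u, y)) (at y)"
      by (intro has_vector_derivative_diff Fy_at zI y)
    then have "((\<lambda>y. integral (cbox u z) (\<lambda>t. Fx (t, y))) has_vector_derivative
        Fy (z, y) - Fy (u, y)) (at y)"
      by (rule has_vector_derivative_transform_within_open[OF _ oJ y]) (simp add: ftc[OF z])
    from vector_derivative_unique_at[OF this 1] show ?thesis
      by (simp add: diff_eq_eq add.commute)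
  qed
  have "continuous_on {u..v} (\<lambda>t. K t y)"
    using continuous_on_compose2[OF Kc, of "{u..v}" "\<lambda>t. (t, y)"] uv y
    by (force intro!: continuous_intros)
  then have "((\<lambda>z. integral {u..z} (\<lambda>t. K t y)) has_vector_derivative K x y) (at x within {u..v})"
    by (rule integral_has_vector_derivative) (use uv in auto)
  then have "((\<lambda>z. Fy (u, y) + integral {u..z} (\<lambda>t. K t y)) has_vector_derivative K x y) (at x within {u..v})"
    by (rule has_vector_derivative_eq_rhs[OF has_vector_derivative_add[OF has_vector_derivative_const]]) simp
  from has_vector_derivative_transform[OF _ Fy_int this]
  have "((\<lambda>z. Fy (z, y)) has_vector_derivative K x y) (at x within {u..v})"
    using uv by simp
  moreover have "at x within {u..v} = at x"
    by (rule at_within_interior) (use uv in simp)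
  ultimately have "((\<lambda>z. Fy (z, y)) has_vector_derivative K x y) (at x)"
    by (simp only:)
  moreover have "((\<lambda>z. Fy (z, y)) has_vector_derivative frechet_derivative Fy (at (x, y)) (1, 0)) (at x)"
    by (rule partial_derivatives(1)[OF smooth_on_has_derivative[OF smy]]) (use x y in auto)
  ultimately show ?thesis
    unfolding K_def by (rule vector_derivative_unique_at)
qed

subsection \<open>Smooth polar decomposition\<close>

text \<open>The interval may be unbounded. Describing it by its extended real endpoints reduces the
  claim to the antiderivative on an \<open>einterval\<close>.\<close>

lemma open_interval_antiderivative:
  fixes f :: "real \<Rightarrow> 'a::euclidean_space"
  assumes J: "open_interval J" and f: "continuous_on J f"
  obtains F where "\<And>x. x \<in> J \<Longrightarrow> (F has_vector_derivative f x) (at x)"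
proof -
  have opn: "open J" and ivl: "is_interval J" and ne: "J \<noteq> {}"
    using J by (auto simp: open_interval_def)
  define a where "a = Inf (ereal ` J)"
  define b where "b = Sup (ereal ` J)"
  have J_iff: "x \<in> J \<longleftrightarrow> a < ereal x \<and> ereal x < b" for x
  proof
    assume "x \<in> J"
    then obtain e where e: "e > 0" "ball x e \<subseteq> J"
      using opn openE by blast
    have "x - e/2 \<in> ball x e" "x + e/2 \<in> ball x e"
      using e(1) by (auto simp: dist_real_def)
    then have m: "x - e/2 \<in> J" "x + e/2 \<in> J"
      using e by auto
    have "a \<le> ereal (x - e/2)" "ereal (x + e/2) \<le> b"
      unfolding a_def b_def using m by (auto intro: Inf_lower Sup_upper)
    moreover have "ereal (x - e/2) < ereal x" "ereal x < ereal (x + e/2)"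
      using e(1) by auto
    ultimately show "a < ereal x \<and> ereal x < b"
      by (meson le_less_trans less_le_trans)
  next
    assume "a < ereal x \<and> ereal x < b"
    then obtain u v where "u \<in> J" "v \<in> J" "u < x" "x < v"
      unfolding a_def b_def Inf_less_iff less_Sup_iff by auto
    then show "x \<in> J"
      using ivl unfolding is_interval_1 by (meson less_imp_le)
  qed
  have "a < b"
    using ne J_iff less_trans by blast
  moreover have "isCont f x" if "a < ereal x" "ereal x < b" for x
    using f opn J_iff that by (auto simp: continuous_on_eq_continuous_at)
  ultimately show ?thesis
    using einterval_antiderivative[of a b f] J_iff that by metis
qed

lemma cis_has_vector_derivative:
  assumes "(f has_real_derivative f') (at x)"
  shows "((\<lambda>x. cis (f x)) has_vector_derivative \<i> * of_real f' * cis (f x)) (at x)"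
proof -
  have re: "((\<lambda>x. cos (f x)) has_real_derivative - sin (f x) * f') (at x)"
    by (rule DERIV_chain2[OF DERIV_cos assms])
  have im: "((\<lambda>x. sin (f x)) has_real_derivative cos (f x) * f') (at x)"
    by (rule DERIV_chain2[OF DERIV_sin assms])
  have "((\<lambda>x. of_real (cos (f x)) + \<i> * of_real (sin (f x))) has_vector_derivative
      of_real (- sin (f x) * f') + \<i> * of_real (cos (f x) * f')) (at x)"
    by (intro has_vector_derivative_add has_vector_derivative_mult_right has_vector_derivative_of_real
        re im)
  moreover have "of_real (cos (f x)) + \<i> * of_real (sin (f x)) = cis (f x)" for x
    by (simp add: complex_eq_iff)
  moreover have "of_real (- sin (f x) * f') + \<i> * of_real (cos (f x) * f') = \<i> * of_real f' * cis (f x)"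
    by (simp add: complex_eq_iff)
  ultimately show ?thesis
    by simp
qed

text \<open>The angle is the integral of the angular velocity
  \<open>Im (cnj \<psi> * \<psi>')\<close>. Rotating \<psi> back by this angle gives a curve with
  zero derivative, and the argument of its constant value is the missing constant of
  integration.\<close>

lemma smooth_unit_lift:
  fixes \<psi> :: "real \<Rightarrow> complex"
  assumes J: "open_interval J" and \<psi>: "smooth_on J \<psi>" and unit: "\<And>y. y \<in> J \<Longrightarrow> cmod (\<psi> y) = 1"
  obtains \<phi> where "smooth_on J \<phi>" "\<And>y. y \<in> J \<Longrightarrow> \<psi> y = cis (\<phi> y)"
proof -
  have opn: "open J" and ivl: "is_interval J" and "J \<noteq> {}"
    using J by (auto simp: open_interval_def)
  then obtain y0 where y0: "y0 \<in> J" by blast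
  define \<psi>' where "\<psi>' y = vector_derivative \<psi> (at y)" for y
  have d: "(\<psi> has_vector_derivative \<psi>' y) (at y)" if "y \<in> J" for y
    unfolding \<psi>'_def using smooth_on_vector_derivative[OF \<psi> that] .
  define \<omega> where "\<omega> y = Im (cnj (\<psi> y) * \<psi>' y)" for y
  have sm: "smooth_on J \<psi>'"
    using smooth_on_real_iff[OF opn d] \<psi> by blast
  have sm\<omega>: "smooth_on J \<omega>"
    unfolding \<omega>_def by (intro smooth_on_Im[OF opn] smooth_on_mult[OF opn] smooth_on_cnj[OF opn] \<psi> sm)
  obtain \<phi>0 where \<phi>0: "\<And>y. y \<in> J \<Longrightarrow> (\<phi>0 has_vector_derivative \<omega> y) (at y)"
    using open_interval_antiderivative[OF J smooth_on_imp_continuous_on[OF sm\<omega>]] by blast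
  have one: "cnj (\<psi> y) * \<psi> y = 1" if "y \<in> J" for y
    using unit[OF that] by (metis complex_norm_square mult.commute of_real_1 one_power2)
  \<comment> \<open>The derivative of the constant \<open>cnj \<psi> * \<psi>\<close> is twice the
    real part of \<open>cnj \<psi> * \<psi>'\<close>, which is therefore purely imaginary.\<close>
  have im: "cnj (\<psi> y) * \<psi>' y = \<i> * of_real (\<omega> y)" if y: "y \<in> J" for y
  proof -
    have "((\<lambda>y. cnj (\<psi> y) * \<psi> y) has_vector_derivative cnj (\<psi> y) * \<psi>' y + cnj (\<psi>' y) * \<psi> y) (at y)"
      by (intro has_vector_derivative_mult has_vector_derivative_cnj d y)
    moreover have "((\<lambda>y. cnj (\<psi> y) * \<psi> y) has_vector_derivative 0) (at y)"
      by (rule has_vector_derivative_transform_within_open[OF has_vector_derivative_const opn y])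
        (use one in auto)
    ultimately have "cnj (\<psi> y) * \<psi>' y + cnj (\<psi>' y) * \<psi> y = 0"
      by (rule vector_derivative_unique_at)
    then have "Re (cnj (\<psi> y) * \<psi>' y) = 0"
      by (simp add: complex_eq_iff)
    then show ?thesis
      by (simp add: complex_eq_iff \<omega>_def)
  qed
  have \<psi>'_eq: "\<psi>' y = \<i> * of_real (\<omega> y) * \<psi> y" if "y \<in> J" for y
  proof -
    have "\<psi>' y = (cnj (\<psi> y) * \<psi> y) * \<psi>' y"
      using one[OF that] by simp
    also have "\<dots> = (cnj (\<psi> y) * \<psi>' y) * \<psi> y"
      by (simp add: mult_ac)
    finally show ?thesis
      using im[OF that] by simp
  qed
  define h where "h y = \<psi> y * cis (- \<phi>0 y)" for y
  have "(h has_vector_derivative 0) (at y)" if y: "y \<in> J" for y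
  proof -
    have "((\<lambda>y. - \<phi>0 y) has_real_derivative - \<omega> y) (at y)"
      using \<phi>0[OF y] unfolding has_real_derivative_iff_has_vector_derivative[symmetric]
      by (auto intro!: derivative_eq_intros)
    from has_vector_derivative_mult[OF d[OF y] cis_has_vector_derivative[OF this]]
    show ?thesis
      unfolding h_def by (simp add: \<psi>'_eq[OF y] mult_ac)
  qed
  then have "h constant_on J"
    using has_vector_derivative_zero_constant[of J h] is_interval_convex[OF ivl]
      has_vector_derivative_at_within unfolding constant_on_def by metis
  then have h: "h y = h y0" if "y \<in> J" for y
    using that y0 unfolding constant_on_def by metis
  define c where "c = Arg (h y0)"
  have "cmod (h y0) = 1"
    using unit[OF y0] by (simp add: h_def norm_mult)
  then have c: "h y0 = cis c"
    unfolding c_def using cis_Arg[of "h y0"] by (metis norm_zero sgn_eq zero_neq_one div_by_1 of_real_1)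
  have "\<psi> y = cis (\<phi>0 y + c)" if "y \<in> J" for y
  proof -
    have "\<psi> y = h y * cis (\<phi>0 y)"
      by (simp add: h_def cis_mult mult.assoc)
    then show ?thesis
      using h[OF that] c by (simp add: cis_mult add.commute)
  qed
  moreover have "smooth_on J (\<lambda>y. \<phi>0 y + c)"
    using smooth_on_real_iff[OF opn \<phi>0] sm\<omega> smooth_on_add[OF opn _ smooth_on_const] by blast
  ultimately show ?thesis
    using that by blast
qed

text \<open>Hadamard's lemma.\<close>

lemma smooth_divided_difference:
  fixes f :: "real \<Rightarrow> 'a::euclidean_space"
  assumes J: "open_interval J" and f: "smooth_on J f" and y0: "y0 \<in> J" and "f y0 = 0"
  obtains U where "smooth_on J U" "\<And>y. y \<in> J \<Longrightarrow> f y = (y - y0) *\<^sub>R U y"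
    "(f has_vector_derivative U y0) (at y0)"
proof -
  have opn: "open J" and ivl: "is_interval J"
    using J by (auto simp: open_interval_def)
  have seg: "y0 + t * (y - y0) \<in> J" if "y \<in> J" "t \<in> {0..1}" for t y
  proof -
    have "(1 - t) *\<^sub>R y0 + t *\<^sub>R y \<in> J"
      using convexD_alt[OF is_interval_convex[OF ivl] y0 that(1)] that(2) by auto
    then show ?thesis
      by (simp add: algebra_simps)
  qed
  \<comment> \<open>For k = 0 and g = f' this is the quotient of f y by y - y0. The weight
    \<open>t ^ k\<close> makes the family closed under differentiation in y, which sends (g, k) to
    (g', k + 1).\<close>
  define G where "G g k y = integral (cbox 0 1) (\<lambda>t::real. t ^ k *\<^sub>R g (y0 + t * (y - y0)))"
    for g :: "real \<Rightarrow> 'a" and k :: nat and y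
  have cont: "continuous_on (J \<times> cbox 0 1) (\<lambda>(y, t). t ^ k *\<^sub>R g (y0 + t * (y - y0)))"
    if "smooth_on J g" for g :: "real \<Rightarrow> 'a" and k
    unfolding split_beta
    by (intro continuous_intros continuous_on_compose2[OF smooth_on_imp_continuous_on[OF that]])
      (use seg in auto)
  have contt: "continuous_on (cbox 0 1) (\<lambda>t. t ^ k *\<^sub>R g (y0 + t * (y - y0)))"
    if "smooth_on J g" "y \<in> J" for g :: "real \<Rightarrow> 'a" and k y
    by (intro continuous_intros continuous_on_compose2[OF smooth_on_imp_continuous_on[OF that(1)]])
      (use seg that in auto)
  have dG: "(G g k has_vector_derivative G (\<lambda>y. vector_derivative g (at y)) (Suc k) y) (at y)"
    if g: "smooth_on J g" and y: "y \<in> J" for g k y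
  proof -
    have g': "smooth_on J (\<lambda>y. vector_derivative g (at y))"
      using smooth_on_real_iff[OF opn smooth_on_vector_derivative[OF g]] g by blast
    have "(G g k has_vector_derivative G (\<lambda>y. vector_derivative g (at y)) (Suc k) y) (at y within J)"
      unfolding G_def
    proof (rule leibniz_rule_vector_derivative[OF _ _ cont[OF g'] y is_interval_convex[OF ivl]])
      fix z t :: real assume z: "z \<in> J" and t: "t \<in> cbox 0 1"
      have "((\<lambda>z. y0 + t * (z - y0)) has_vector_derivative t) (at z within J)"
        by (auto intro!: derivative_eq_intros)
      moreover have "(g has_vector_derivative vector_derivative g (at (y0 + t * (z - y0))))
          (at (y0 + t * (z - y0)))"
        using seg z t by (intro smooth_on_vector_derivative[OF g]) auto
      ultimately have "((\<lambda>z. g (y0 + t * (z - y0))) has_vector_derivative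
          t *\<^sub>R vector_derivative g (at (y0 + t * (z - y0)))) (at z within J)"
        using vector_diff_chain_within[unfolded o_def] has_vector_derivative_at_within by blast
      from bounded_linear.has_vector_derivative[OF bounded_linear_scaleR_right this, of "t ^ k"]
      show "((\<lambda>z. t ^ k *\<^sub>R g (y0 + t * (z - y0))) has_vector_derivative
          t ^ Suc k *\<^sub>R vector_derivative g (at (y0 + t * (z - y0)))) (at z within J)"
        by (simp add: mult.commute)
    next
      fix z assume "z \<in> J"
      then show "(\<lambda>t. t ^ k *\<^sub>R g (y0 + t * (z - y0))) integrable_on cbox 0 1"
        by (intro integrable_continuous contt g)
    qed
    then show ?thesis
      using at_within_open[OF y opn] by simp
  qed
  have smG: "smooth_on J (G g k)" if "smooth_on J g" for g k
  proof -
    have "higher_differentiable_on J (G g k) n" if "smooth_on J g" for g k n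
      using that
    proof (induction n arbitrary: g k)
      case 0
      have "isCont (G g k) y" if "y \<in> J" for y
        using dG[OF 0 that] has_vector_derivative_continuous by blast
      then show ?case
        by (simp add: continuous_at_imp_continuous_on)
    next
      case (Suc n)
      let ?g' = "\<lambda>y. vector_derivative g (at y)"
      have g': "smooth_on J ?g'"
        using smooth_on_real_iff[OF opn smooth_on_vector_derivative[OF Suc.prems]] Suc.prems by blast
      show ?case
      proof (rule higher_differentiable_on_SucI[OF opn])
        show "(G g k has_derivative (\<lambda>v. v *\<^sub>R G ?g' (Suc k) y)) (at y)" if "y \<in> J" for y
          using dG[OF Suc.prems that] by (simp add: has_vector_derivative_def)
        show "higher_differentiable_on J (\<lambda>y. v *\<^sub>R G ?g' (Suc k) y) n" for v
          by (rule higher_differentiable_on_bounded_linear[OF opn bounded_linear_scaleR_right Suc.IH[OF g']])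
      qed
    qed
    then show ?thesis
      using that by (simp add: smooth_on_def)
  qed
  let ?f' = "\<lambda>y. vector_derivative f (at y)"
  have f': "smooth_on J ?f'"
    using smooth_on_real_iff[OF opn smooth_on_vector_derivative[OF f]] f by blast
  have eq: "f y = (y - y0) *\<^sub>R G ?f' 0 y" if y: "y \<in> J" for y
  proof -
    have "((\<lambda>t. (y - y0) *\<^sub>R ?f' (y0 + t * (y - y0))) has_integral
        f (y0 + 1 * (y - y0)) - f (y0 + 0 * (y - y0))) {0..1}"
    proof (rule fundamental_theorem_of_calculus)
      fix t :: real assume t: "t \<in> {0..1}"
      have "((\<lambda>t. y0 + t * (y - y0)) has_vector_derivative y - y0) (at t within {0..1})"
        by (auto intro!: derivative_eq_intros)
      moreover have "(f has_vector_derivative ?f' (y0 + t * (y - y0))) (at (y0 + t * (y - y0)))"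
        using seg y t by (intro smooth_on_vector_derivative[OF f]) auto
      ultimately show "((\<lambda>t. f (y0 + t * (y - y0))) has_vector_derivative
          (y - y0) *\<^sub>R ?f' (y0 + t * (y - y0))) (at t within {0..1})"
        using vector_diff_chain_within[unfolded o_def] has_vector_derivative_at_within by blast
    qed simp
    then have "integral {0..1} (\<lambda>t. (y - y0) *\<^sub>R ?f' (y0 + t * (y - y0)))
        = f (y0 + 1 * (y - y0)) - f (y0 + 0 * (y - y0))"
      by (rule integral_unique)
    also have "\<dots> = f y"
      using assms(4) by simp
    finally show ?thesis
      by (simp only: G_def cbox_interval power_0 scaleR_one integral_cmul)
  qed
  have "G ?f' 0 y0 = ?f' y0"
    by (simp add: G_def)
  then show ?thesis
    using that[OF smG[OF f'] eq] smooth_on_vector_derivative[OF f y0] by metis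
qed

text \<open>The quotient is the square of the phase of \<open>u\<close>. Written as u u divided by
  the squared modulus, it needs only the reciprocal of a nonvanishing real function.\<close>

lemma smooth_phase:
  fixes u :: "real \<Rightarrow> complex"
  assumes "open S" "smooth_on S u" "\<And>y. y \<in> S \<Longrightarrow> u y \<noteq> 0"
  shows "smooth_on S (\<lambda>y. u y / cnj (u y))"
proof -
  have sm: "smooth_on S (\<lambda>y. inverse (Re (u y * cnj (u y))))"
    by (rule smooth_on_inverse[OF assms(1)])
      (intro smooth_on_Re[OF assms(1)] smooth_on_mult[OF assms(1)] smooth_on_cnj[OF assms(1)] assms(2),
        use assms(3) in \<open>simp add: complex_eq_iff add_nonneg_eq_0_iff\<close>)
  have eq: "u y / cnj (u y) = u y * (u y * complex_of_real (inverse (Re (u y * cnj (u y)))))" for y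
  proof -
    have "complex_of_real (Re (u y * cnj (u y))) = u y * cnj (u y)"
      by (simp add: complex_eq_iff)
    then show ?thesis
      by (simp add: field_simps)
  qed
  show ?thesis
    unfolding eq by (intro smooth_on_mult[OF assms(1)] smooth_on_complex_of_real[OF assms(1)] assms(2) sm)
qed

text \<open>Near a simple zero y one has b z = (z - y) U z with U y nonzero, and the real factor z -
  y cancels in \<open>b / cnj b\<close>. So the squared phase extends smoothly through the zero, and
  half of a lift of it serves as the angle. The radius \<open>r\<close> is real but not nonnegative:
  it changes sign at such a zero.\<close>

lemma smooth_polar:
  fixes b :: "real \<Rightarrow> complex"
  assumes J: "open_interval J" and b: "smooth_on J b"
    and simple: "\<And>y. y \<in> J \<Longrightarrow> b y = 0 \<Longrightarrow> \<not> (b has_vector_derivative 0) (at y)"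
  obtains r \<phi> where "smooth_on J r" "smooth_on J \<phi>" "\<And>y. y \<in> J \<Longrightarrow> b y = of_real (r y) * cis (\<phi> y)"
proof -
  have opn: "open J"
    using J by (auto simp: open_interval_def)
  \<comment> \<open>At a zero the derivative replaces the value; this is the limit of the squared
    phase there.\<close>
  define \<psi> where "\<psi> y = (let u = (if b y = 0 then vector_derivative b (at y) else b y) in u / cnj u)" for y
  have nz: "(if b y = 0 then vector_derivative b (at y) else b y) \<noteq> 0" if "y \<in> J" for y
    using simple[OF that] smooth_on_vector_derivative[OF b that] by auto
  have "smooth_on J \<psi>"
  proof (rule smooth_on_locally)
    fix y assume y: "y \<in> J"
    show "\<exists>T. open T \<and> y \<in> T \<and> smooth_on T \<psi>"
    proof (cases "b y = 0")
      case False
      let ?T = "J \<inter> b -` (- {0})"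
      have T: "open ?T"
        by (rule continuous_open_preimage[OF smooth_on_imp_continuous_on[OF b] opn]) auto
      have "smooth_on ?T (\<lambda>y. b y / cnj (b y))"
        by (rule smooth_phase[OF T smooth_on_subset[OF b]]) auto
      then have "smooth_on ?T \<psi>"
        by (subst smooth_on_cong[OF T, of _ "\<lambda>y. b y / cnj (b y)"]) (auto simp: \<psi>_def Let_def)
      then show ?thesis
        using T y False by blast
    next
      case True
      obtain U where U: "smooth_on J U" and bU: "\<And>z. z \<in> J \<Longrightarrow> b z = (z - y) *\<^sub>R U z"
        and U': "(b has_vector_derivative U y) (at y)"
        by (rule smooth_divided_difference[OF J b y True]) blast
      have Uy: "U y = vector_derivative b (at y)"
        using vector_derivative_at[OF U'] by simp
      let ?T = "J \<inter> U -` (- {0})"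
      have T: "open ?T"
        by (rule continuous_open_preimage[OF smooth_on_imp_continuous_on[OF U] opn]) auto
      have "smooth_on ?T (\<lambda>y. U y / cnj (U y))"
        by (rule smooth_phase[OF T smooth_on_subset[OF U]]) auto
      moreover have "\<psi> z = U z / cnj (U z)" if z: "z \<in> ?T" for z
      proof (cases "z = y")
        case True
        then show ?thesis
          using \<open>b y = 0\<close> Uy by (simp add: \<psi>_def Let_def)
      next
        case False
        then have "b z \<noteq> 0"
          using z bU by auto
        then show ?thesis
          using z bU[of z] False by (simp add: \<psi>_def Let_def scaleR_conv_of_real)
      qed
      ultimately have "smooth_on ?T \<psi>"
        using smooth_on_cong[OF T, of \<psi> "\<lambda>y. U y / cnj (U y)"] by blast
      moreover have "y \<in> ?T"
        using y nz[OF y] True Uy by auto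
      ultimately show ?thesis
        using T by blast
    qed
  qed
  moreover have "cmod (\<psi> y) = 1" if "y \<in> J" for y
    using nz[OF that] unfolding \<psi>_def Let_def norm_divide complex_mod_cnj by simp
  ultimately obtain \<theta> where \<theta>: "smooth_on J \<theta>" "\<And>y. y \<in> J \<Longrightarrow> \<psi> y = cis (\<theta> y)"
    using smooth_unit_lift[OF J] by blast
  \<comment> \<open>Halving the lifted angle is a continuous choice of square root of the squared
    phase. It makes \<open>b y * cis (- \<phi> y)\<close> equal to its own conjugate, hence
    real.\<close>
  define \<phi> where "\<phi> y = \<theta> y * (1 / 2)" for y
  have sm\<phi>: "smooth_on J \<phi>"
    unfolding \<phi>_def by (intro smooth_on_mult[OF opn] \<theta>(1) smooth_on_const)
  define r where "r y = Re (b y * cis (- \<phi> y))" for y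
  have "smooth_on J r"
    unfolding r_def
    by (intro smooth_on_Re[OF opn] smooth_on_mult[OF opn] smooth_on_cis[OF opn] b sm\<phi> smooth_on_minus[OF opn])
  moreover have "b y = of_real (r y) * cis (\<phi> y)" if y: "y \<in> J" for y
  proof -
    have "b y = cnj (b y) * \<psi> y"
      using nz[OF y] by (simp add: \<psi>_def Let_def)
    also have "\<psi> y = cis (\<phi> y) * cis (\<phi> y)"
      using \<theta>(2)[OF y] by (simp add: cis_mult \<phi>_def)
    finally have "b y * cis (- \<phi> y) = cnj (b y) * (cis (\<phi> y) * cis (\<phi> y)) * cis (- \<phi> y)"
      by simp
    also have "\<dots> = cnj (b y * cis (- \<phi> y))"
      by (simp add: cis_mult cis_cnj mult.assoc)
    finally have "cnj (b y * cis (- \<phi> y)) = b y * cis (- \<phi> y)"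
      by (rule sym)
    then have "b y * cis (- \<phi> y) \<in> \<real>"
      by (rule Reals_cnj_iff[THEN iffD2])
    then have "of_real (r y) = b y * cis (- \<phi> y)"
      unfolding r_def by (rule of_real_Re)
    then show ?thesis
      by (simp add: cis_mult mult.assoc)
  qed
  ultimately show ?thesis
    by (rule that[OF _ sm\<phi>])
qed

subsection \<open>Complex coordinates\<close>

lemma vector_4:
  "(vector [a, b, c, d] :: 'a::zero^4)$1 = a" "(vector [a, b, c, d] :: 'a^4)$2 = b"
  "(vector [a, b, c, d] :: 'a^4)$3 = c" "(vector [a, b, c, d] :: 'a^4)$4 = d"
  by (simp_all add: vector_def)

text \<open>\<open>\<real>\<^sup>4\<close> is identified with \<open>\<complex>\<^sup>2\<close> in such a way that \<open>J1\<close> becomes the multiplication by \<open>\<i>\<close>.\<close>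

definition cfst :: "real^4 \<Rightarrow> complex" where "cfst v = Complex (v$1) (v$2)"

definition csnd :: "real^4 \<Rightarrow> complex" where "csnd v = Complex (v$3) (v$4)"

definition of_cpair :: "complex \<Rightarrow> complex \<Rightarrow> real^4" where
  "of_cpair z w = vector [Re z, Im z, Re w, Im w]"

lemma cfst_of_cpair [simp]: "cfst (of_cpair z w) = z"
  and csnd_of_cpair [simp]: "csnd (of_cpair z w) = w"
  by (simp_all add: cfst_def csnd_def of_cpair_def vector_4)

lemma of_cpair_cfst_csnd [simp]: "of_cpair (cfst v) (csnd v) = v"
  by (simp add: cfst_def csnd_def of_cpair_def vec_eq_iff forall_4 vector_4)

lemma real4_eqI: "cfst u = cfst v \<Longrightarrow> csnd u = csnd v \<Longrightarrow> u = v"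
  by (metis of_cpair_cfst_csnd)

lemma bounded_linear_cfst: "bounded_linear cfst"
  and bounded_linear_csnd: "bounded_linear csnd"
  by (auto intro!: linear_conv_bounded_linear[THEN iffD1] linearI
      simp: cfst_def csnd_def complex_eq_iff)

lemma bounded_linear_of_cpair_0: "bounded_linear (\<lambda>z. of_cpair z 0)"
  and bounded_linear_0_of_cpair: "bounded_linear (\<lambda>z. of_cpair 0 z)"
  by (auto intro!: linear_conv_bounded_linear[THEN iffD1] linearI
      simp: of_cpair_def vec_eq_iff forall_4 vector_4)

lemma of_cpair_split: "of_cpair z w = of_cpair z 0 + of_cpair 0 w"
  by (simp add: of_cpair_def vec_eq_iff forall_4 vector_4)

lemma bounded_linear_J1: "bounded_linear J1"
  by (auto intro!: linear_conv_bounded_linear[THEN iffD1] linearI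
      simp: J1_def vec_eq_iff forall_4 vector_4)

lemma bounded_bilinear_g0: "bounded_bilinear g0"
  by (auto intro!: bilinear_conv_bounded_bilinear[THEN iffD1]
      simp: bilinear_def linear_iff g0_def algebra_simps)

lemmas cfst_linear [simp] =
  bounded_linear.linear[OF bounded_linear_cfst, THEN linear_add]
  bounded_linear.linear[OF bounded_linear_cfst, THEN linear_diff]
  bounded_linear.linear[OF bounded_linear_cfst, THEN linear_neg]
  bounded_linear.linear[OF bounded_linear_cfst, THEN linear_scale]
  bounded_linear.linear[OF bounded_linear_cfst, THEN linear_0]

lemmas csnd_linear [simp] =
  bounded_linear.linear[OF bounded_linear_csnd, THEN linear_add]
  bounded_linear.linear[OF bounded_linear_csnd, THEN linear_diff]
  bounded_linear.linear[OF bounded_linear_csnd, THEN linear_neg]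
  bounded_linear.linear[OF bounded_linear_csnd, THEN linear_scale]
  bounded_linear.linear[OF bounded_linear_csnd, THEN linear_0]

lemmas J1_linear =
  bounded_linear.linear[OF bounded_linear_J1, THEN linear_add]
  bounded_linear.linear[OF bounded_linear_J1, THEN linear_diff]
  bounded_linear.linear[OF bounded_linear_J1, THEN linear_neg]
  bounded_linear.linear[OF bounded_linear_J1, THEN linear_scale]
  bounded_linear.linear[OF bounded_linear_J1, THEN linear_0]

lemmas g0_bilinear =
  bounded_bilinear.add_left[OF bounded_bilinear_g0] bounded_bilinear.add_right[OF bounded_bilinear_g0]
  bounded_bilinear.diff_left[OF bounded_bilinear_g0] bounded_bilinear.diff_right[OF bounded_bilinear_g0]
  bounded_bilinear.minus_left[OF bounded_bilinear_g0] bounded_bilinear.minus_right[OF bounded_bilinear_g0]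
  bounded_bilinear.scaleR_left[OF bounded_bilinear_g0] bounded_bilinear.scaleR_right[OF bounded_bilinear_g0]

lemma cfst_J1 [simp]: "cfst (J1 v) = \<i> * cfst v"
  and csnd_J1 [simp]: "csnd (J1 v) = \<i> * csnd v"
  by (simp_all add: cfst_def csnd_def J1_def vector_4 complex_eq_iff)

lemma J1_J1: "J1 (J1 v) = - v"
  by (rule real4_eqI) simp_all

section \<open>The Hermitian form of signature (1,1) behind \<open>g0\<close>\<close>

lemma g0_complex: "g0 u v = Re (cfst u * cnj (cfst v) - csnd u * cnj (csnd v))"
  by (simp add: g0_def cfst_def csnd_def)

lemma g0_commute: "g0 u v = g0 v u"
  by (simp add: g0_def mult.commute)

lemma g0_J1_left: "g0 (J1 u) v = - g0 u (J1 v)"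
  by (simp add: g0_complex)

lemma g0_J1_J1: "g0 (J1 u) (J1 v) = g0 u v"
  by (simp add: g0_complex)

lemma g0_J1_self: "g0 v (J1 v) = 0" "g0 (J1 v) v = 0"
  by (simp_all add: g0_complex)

text \<open>The two numbers are the real and the imaginary part of one Hermitian product, because
  \<open>J1\<close> is multiplication by the imaginary unit.\<close>

lemma hermitian_orthogonal_iff:
  "g0 u v = 0 \<and> g0 u (J1 v) = 0 \<longleftrightarrow> cfst u * cnj (cfst v) = csnd u * cnj (csnd v)"
  unfolding g0_complex by (simp add: complex_eq_iff) argo

text \<open>The Hermitian complement of a negative line in signature (1,1) is positive definite:
  orthogonality gives |u1| |q1| = |u2| |q2|, and |q1| < |q2| forces |u2| below |u1|, strictly unless
  \<open>u\<close> vanishes.\<close>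

lemma horizontal_definite:
  assumes q: "g0 q q < 0" and u: "g0 u q = 0" "g0 u (J1 q) = 0"
  shows "g0 u u \<ge> 0" "g0 u u = 0 \<Longrightarrow> u = 0"
proof -
  have n: "cmod z ^ 2 = Re (z * cnj z)" for z
    using cmod_power2[of z] by (simp add: power2_eq_square)
  have lt: "cmod (cfst q) < cmod (csnd q)"
    using q by (intro power2_less_imp_less[of "cmod (cfst q)"]) (auto simp: g0_complex n)
  then have pos: "cmod (csnd q) > 0"
    by (meson norm_ge_zero le_less_trans)
  have "cfst u * cnj (cfst q) = csnd u * cnj (csnd q)"
    using u hermitian_orthogonal_iff by blast
  then have eq: "cmod (cfst u) * cmod (cfst q) = cmod (csnd u) * cmod (csnd q)"
    by (metis complex_mod_cnj norm_mult)
  have g: "g0 u u = cmod (cfst u) ^ 2 - cmod (csnd u) ^ 2"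
    by (simp add: g0_complex n)
  have "cmod (csnd u) * cmod (csnd q) \<le> cmod (cfst u) * cmod (csnd q)"
    unfolding eq[symmetric] using lt by (intro mult_left_mono) auto
  then have le: "cmod (csnd u) \<le> cmod (cfst u)"
    using pos by simp
  then show "g0 u u \<ge> 0"
    unfolding g by simp
  assume "g0 u u = 0"
  then have same: "cmod (csnd u) = cmod (cfst u)"
    unfolding g by (simp add: power2_eq_iff_nonneg)
  have "cmod (cfst u) * cmod (cfst q) = cmod (cfst u) * cmod (csnd q)"
    using eq unfolding same .
  then have "cfst u = 0"
    using lt by auto
  then show "u = 0"
    using same by (intro real4_eqI) simp_all
qed

text \<open>The horizontal space is a complex line.\<close>

lemma horizontal_orthogonal_eq_0:
  assumes q: "g0 q q < 0" and h: "g0 h q = 0" "g0 h (J1 q) = 0" "h \<noteq> 0"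
    and v: "g0 v q = 0" "g0 v (J1 q) = 0" and vh: "g0 v h = 0" "g0 v (J1 h) = 0"
  shows "v = 0"
proof -
  let ?f1 = "cfst q" and ?f2 = "csnd q" and ?h1 = "cfst h" and ?h2 = "csnd h"
    and ?v1 = "cfst v" and ?v2 = "csnd v"
  have eqs: "?h1 * cnj ?f1 = ?h2 * cnj ?f2" "?v1 * cnj ?f1 = ?v2 * cnj ?f2"
    "?v1 * cnj ?h1 = ?v2 * cnj ?h2"
    using assms hermitian_orthogonal_iff by blast+
  have eqs1: "cnj ?h1 * ?f1 = cnj ?h2 * ?f2"
    using arg_cong[OF eqs(1), of cnj] by simp
  have D: "?f2 * cnj ?f2 - ?f1 * cnj ?f1 \<noteq> 0"
    using q by (auto simp: g0_complex complex_eq_iff)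
  have f2: "?f2 \<noteq> 0"
    using q by (auto simp: g0_complex not_sum_squares_lt_zero)
  \<comment> \<open>Orthogonality of \<open>v\<close> and of \<open>h\<close> to \<open>q\<close>
    eliminates the second coordinates from the orthogonality of \<open>v\<close> and
    \<open>h\<close>; what remains carries the factor - \<open>g0 q q\<close>, which is
    nonzero.\<close>
  have "?v1 * cnj ?h1 * (?f2 * cnj ?f2 - ?f1 * cnj ?f1) = 0"
    using eqs(2,3) eqs1 by algebra
  then consider "?v1 = 0" | "?h1 = 0"
    using D by auto
  then show "v = 0"
  proof cases
    case 1
    then show ?thesis
      using eqs(2) f2 by (intro real4_eqI) auto
  next
    case 2
    then have "h = 0"
      using eqs(1) f2 by (intro real4_eqI) auto
    then show ?thesis
      using h by simp
  qed
qed

text \<open>The left side is, up to sign, the quarter turn of the horizontal part of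
  \<open>u\<close> in the plane of \<open>J2 q\<close> and \<open>J3 q\<close>. The identity
  expresses it by \<open>J1\<close> alone, which removes \<open>J2\<close> and \<open>J3\<close>
  from the wedge product.\<close>

lemma J2_J3_identity:
  "g0 u (J3 q) *\<^sub>R J2 q - g0 u (J2 q) *\<^sub>R J3 q = g0 q q *\<^sub>R J1 u + g0 u (J1 q) *\<^sub>R q - g0 u q *\<^sub>R J1 q"
  by (simp add: g0_def J1_def J2_def J3_def vec_eq_iff forall_4 vector_4 algebra_simps)

lemma smooth_on_of_complex_coordinates:
  assumes "open S" "smooth_on S (\<lambda>p. cfst (F p))" "smooth_on S (\<lambda>p. csnd (F p))"
  shows "smooth_on S F"
proof -
  have "smooth_on S (\<lambda>p. of_cpair (cfst (F p)) 0 + of_cpair 0 (csnd (F p)))"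
    by (intro smooth_on_add assms smooth_on_bounded_linear[OF bounded_linear_of_cpair_0]
        smooth_on_bounded_linear[OF bounded_linear_0_of_cpair])
  then show ?thesis
    unfolding of_cpair_split[symmetric] by simp
qed

lemma has_vector_derivative_of_complex_coordinates:
  assumes "((\<lambda>x. cfst (f x)) has_vector_derivative z) (at x)"
    "((\<lambda>x. csnd (f x)) has_vector_derivative w) (at x)"
  shows "(f has_vector_derivative of_cpair z w) (at x)"
proof -
  have "((\<lambda>x. of_cpair (cfst (f x)) 0 + of_cpair 0 (csnd (f x))) has_vector_derivative
      of_cpair z 0 + of_cpair 0 w) (at x)"
    by (intro has_vector_derivative_add assms
        bounded_linear.has_vector_derivative[OF bounded_linear_of_cpair_0]
        bounded_linear.has_vector_derivative[OF bounded_linear_0_of_cpair])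
  then show ?thesis
    unfolding of_cpair_split[symmetric] by simp
qed

lemma has_vector_derivative_g0:
  assumes "(f has_vector_derivative f') (at x)" "(g has_vector_derivative g') (at x)"
  shows "((\<lambda>x. g0 (f x) (g x)) has_vector_derivative g0 f' (g x) + g0 (f x) g') (at x)"
  using bounded_bilinear.has_vector_derivative[OF bounded_bilinear_g0 assms] by (simp add: add.commute)

lemma constant_g0_derivative:
  assumes "open S" "x \<in> S" "\<And>x. x \<in> S \<Longrightarrow> g0 (f x) (g x) = c"
    and "(f has_vector_derivative f') (at x)" "(g has_vector_derivative g') (at x)"
  shows "g0 f' (g x) + g0 (f x) g' = 0"
proof -
  have "((\<lambda>x. g0 (f x) (g x)) has_vector_derivative 0) (at x)"
    by (rule has_vector_derivative_transform_within_open[OF has_vector_derivative_const assms(1,2)])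
      (simp add: assms(3))
  then show ?thesis
    using has_vector_derivative_g0[OF assms(4,5)] vector_derivative_unique_at by blast
qed

section \<open>The complex determinant of two vectors\<close>

definition det2 :: "real^4 \<Rightarrow> real^4 \<Rightarrow> complex" where
  "det2 u v = cfst u * csnd v - csnd u * cfst v"

lemma det2_simps:
  "det2 (u + u') v = det2 u v + det2 u' v" "det2 u (v + v') = det2 u v + det2 u v'"
  "det2 (r *\<^sub>R u) v = of_real r * det2 u v" "det2 u (r *\<^sub>R v) = of_real r * det2 u v"
  "det2 (J1 u) v = \<i> * det2 u v" "det2 u (J1 v) = \<i> * det2 u v" "det2 u u = 0"
  by (simp_all add: det2_def scaleR_conv_of_real[where 'a=complex] algebra_simps)

lemma has_vector_derivative_det2:
  assumes "(f has_vector_derivative f') (at x)" "(g has_vector_derivative g') (at x)"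
  shows "((\<lambda>x. det2 (f x) (g x)) has_vector_derivative det2 f' (g x) + det2 (f x) g') (at x)"
proof -
  note d = bounded_linear.has_vector_derivative[OF bounded_linear_cfst]
    bounded_linear.has_vector_derivative[OF bounded_linear_csnd]
  show ?thesis
    unfolding det2_def
    by (rule has_vector_derivative_eq_rhs[OF has_vector_derivative_diff[OF
          has_vector_derivative_mult[OF d(1)[OF assms(1)] d(2)[OF assms(2)]]
          has_vector_derivative_mult[OF d(2)[OF assms(1)] d(1)[OF assms(2)]]]])
      (simp add: algebra_simps)
qed

subsection \<open>The matrices\<close>

text \<open>In complex coordinates the matrix has the rows (a, b) and e (cnj b, cnj a) with a = cosh
  \<xi>1 cis \<xi>2, b = sinh \<xi>1 cis \<xi>3 and e = -i cis \<xi>. Its determinant is e, since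
  |a|^2 - |b|^2 = 1.\<close>

lemma cfst_Amat: "cfst (Amat \<xi> \<xi>1 \<xi>2 \<xi>3 *v w) =
    of_real (cosh \<xi>1) * cis \<xi>2 * cfst w + of_real (sinh \<xi>1) * cis \<xi>3 * csnd w"
  and csnd_Amat: "csnd (Amat \<xi> \<xi>1 \<xi>2 \<xi>3 *v w) = - \<i> * cis \<xi> *
    (cnj (of_real (sinh \<xi>1) * cis \<xi>3) * cfst w + cnj (of_real (cosh \<xi>1) * cis \<xi>2) * csnd w)"
  by (simp_all add: Amat_def Let_def first_row_def J1_def J2_def J3_def cfst_def csnd_def
      matrix_vector_mult_def sum_4 vector_4 complex_eq_iff algebra_simps)

lemma hermitian_matrix_identity:
  fixes a b e u1 u2 v1 v2 :: complex
  assumes "a * cnj a - b * cnj b = 1" "e * cnj e = 1"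
  shows "(a * u1 + b * u2) * cnj (a * v1 + b * v2)
      - (e * (cnj b * u1 + cnj a * u2)) * cnj (e * (cnj b * v1 + cnj a * v2))
    = u1 * cnj v1 - u2 * cnj v2"
proof -
  have "(e * (cnj b * u1 + cnj a * u2)) * cnj (e * (cnj b * v1 + cnj a * v2))
      = (e * cnj e) * ((cnj b * u1 + cnj a * u2) * (b * cnj v1 + a * cnj v2))"
    by (simp add: algebra_simps)
  also have "\<dots> = (cnj b * u1 + cnj a * u2) * (b * cnj v1 + a * cnj v2)"
    using assms(2) by simp
  finally have "(a * u1 + b * u2) * cnj (a * v1 + b * v2)
      - (e * (cnj b * u1 + cnj a * u2)) * cnj (e * (cnj b * v1 + cnj a * v2))
    = (a * cnj a - b * cnj b) * (u1 * cnj v1 - u2 * cnj v2)"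
    by (simp add: algebra_simps)
  then show ?thesis
    using assms(1) by simp
qed

lemma Amat_entries:
  "(of_real (cosh t) * cis r) * cnj (of_real (cosh t) * cis r)
    - (of_real (sinh t) * cis s) * cnj (of_real (sinh t) * cis s) = 1"
  "(- \<i> * cis \<xi>) * cnj (- \<i> * cis \<xi>) = 1"
proof -
  have cc: "cis r * cnj (cis r) = 1" for r
    by (simp add: cis_cnj cis_mult)
  have sq: "(of_real c * cis r) * cnj (of_real c * cis r) = of_real (c\<^sup>2)" for c r
  proof -
    have "(of_real c * cis r) * cnj (of_real c * cis r) = of_real c * of_real c * (cis r * cnj (cis r))"
      by simp
    then show ?thesis
      unfolding cc by (simp add: power2_eq_square)
  qed
  show "(of_real (cosh t) * cis r) * cnj (of_real (cosh t) * cis r)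
    - (of_real (sinh t) * cis s) * cnj (of_real (sinh t) * cis s) = 1"
    unfolding sq by (simp only: of_real_diff[symmetric] hyperbolic_pythagoras of_real_1)
  have "(- \<i> * z) * cnj (- \<i> * z) = z * cnj z" for z
    by (simp add: complex_eq_iff)
  then show "(- \<i> * cis \<xi>) * cnj (- \<i> * cis \<xi>) = 1"
    using cc[of \<xi>] by (simp only:)
qed

lemma pseudo_orthogonal_Amat: "pseudo_orthogonal (Amat \<xi> \<xi>1 \<xi>2 \<xi>3)"
  unfolding pseudo_orthogonal_def g0_complex cfst_Amat csnd_Amat
  by (simp only: hermitian_matrix_identity[OF Amat_entries])  simp

lemma commutes_J1_Amat: "commutes_J1 (Amat \<xi> \<xi>1 \<xi>2 \<xi>3)"
  unfolding commutes_J1_def by (auto intro!: real4_eqI simp: cfst_Amat csnd_Amat algebra_simps)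

lemma g0_Amat: "g0 (Amat \<xi> \<xi>1 \<xi>2 \<xi>3 *v u) (Amat \<xi> \<xi>1 \<xi>2 \<xi>3 *v v) = g0 u v"
  using pseudo_orthogonal_Amat by (simp add: pseudo_orthogonal_def)

lemma Amat_has_vector_derivative:
  assumes "(\<xi>1 has_real_derivative d1) (at y)" "(\<xi>2 has_real_derivative d2) (at y)"
    "(\<xi>3 has_real_derivative d3) (at y)"
  defines "a' \<equiv> (of_real (sinh (\<xi>1 y) * d1) + \<i> * of_real (cosh (\<xi>1 y) * d2)) * cis (\<xi>2 y)"
    and "b' \<equiv> (of_real (cosh (\<xi>1 y) * d1) + \<i> * of_real (sinh (\<xi>1 y) * d3)) * cis (\<xi>3 y)"
  shows "((\<lambda>y. Amat \<xi> (\<xi>1 y) (\<xi>2 y) (\<xi>3 y) *v w) has_vector_derivative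
    of_cpair (a' * cfst w + b' * csnd w) (- \<i> * cis \<xi> * (cnj b' * cfst w + cnj a' * csnd w))) (at y)"
proof -
  have ch: "((\<lambda>y. cosh (\<xi>1 y)) has_real_derivative sinh (\<xi>1 y) * d1) (at y)"
    and sh: "((\<lambda>y. sinh (\<xi>1 y)) has_real_derivative cosh (\<xi>1 y) * d1) (at y)"
    using assms(1) by (auto intro!: derivative_eq_intros)
  have a: "((\<lambda>y. of_real (cosh (\<xi>1 y)) * cis (\<xi>2 y)) has_vector_derivative a') (at y)"
    by (rule has_vector_derivative_eq_rhs[OF has_vector_derivative_mult[OF
        has_vector_derivative_of_real[OF ch] cis_has_vector_derivative[OF assms(2)]]])
      (simp add: a'_def algebra_simps)
  have b: "((\<lambda>y. of_real (sinh (\<xi>1 y)) * cis (\<xi>3 y)) has_vector_derivative b') (at y)"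
    by (rule has_vector_derivative_eq_rhs[OF has_vector_derivative_mult[OF
        has_vector_derivative_of_real[OF sh] cis_has_vector_derivative[OF assms(3)]]])
      (simp add: b'_def algebra_simps)
  show ?thesis
    by (rule has_vector_derivative_of_complex_coordinates; unfold cfst_Amat csnd_Amat)
      (intro has_vector_derivative_add has_vector_derivative_mult_left has_vector_derivative_mult_right
        has_vector_derivative_cnj a b)+
qed

text \<open>The columns are Hermitian orthonormal, of types 1 and -1, so the inverse matrix is the
  conjugate transpose up to signs. Comparing it with Cramer's rule expresses the second row by the
  first row and the determinant.\<close>

lemma unitary_completion:
  fixes a11 a12 a21 a22 :: complex
  assumes "a11 * cnj a11 - a21 * cnj a21 = 1" "a12 * cnj a12 - a22 * cnj a22 = - 1"
    and ort: "a11 * cnj a12 = a21 * cnj a22"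
  defines "\<Delta> \<equiv> a11 * a22 - a12 * a21"
  shows "a22 = \<Delta> * cnj a11" "a21 = \<Delta> * cnj a12" "\<Delta> * cnj \<Delta> = 1"
proof -
  have ort': "cnj a11 * a12 = cnj a21 * a22"
    using arg_cong[OF ort, of cnj] by simp
  show "a22 = \<Delta> * cnj a11" "a21 = \<Delta> * cnj a12"
    unfolding \<Delta>_def using assms(1-3) ort' by algebra+
  have "cnj \<Delta> = cnj a11 * cnj a22 - cnj a12 * cnj a21"
    by (simp add: \<Delta>_def)
  then show "\<Delta> * cnj \<Delta> = 1"
    unfolding \<Delta>_def using assms(1-3) ort' by algebra
qed

text \<open>Here \<open>C\<close>, \<open>S\<close> stand for cosh \<xi>1 and sinh \<xi>1,
  \<open>u\<close>, \<open>w\<close> for the phases of \<xi>2 and \<xi>3, \<open>u'\<close>,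
  \<open>w'\<close> for their conjugates, and \<open>j\<close> for the imaginary unit. With free
  variables the computation is a polynomial identity modulo the four relations. On the right only
  the phase difference \<open>u * w'\<close> is left.\<close>

lemma ode_identity:
  fixes u u' w w' C S d1 d2 d3 q1 q2 j :: complex
  assumes "u * u' = 1" "w * w' = 1" "C * C - S * S = 1" "j * j = - 1"
  shows "(C * u * q1 + S * w * (j * q2)) * ((C * d1 - j * S * d3) * w')
      - (S * w' * q1 + C * u' * (j * q2)) * ((S * d1 + j * C * d2) * u)
    = q1 * (d1 - j * S * C * (d2 + d3)) * (u * w') + q2 * (C * C * d2 + S * S * d3)"
  using assms by algebra

subsection \<open>Waves\<close>

definition rot :: "real \<Rightarrow> real^4 \<Rightarrow> real^4" where
  "rot \<theta> v = cos \<theta> *\<^sub>R v + sin \<theta> *\<^sub>R J1 v"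

text \<open>The general solution of f'' = (\<alpha>^2 + \<beta>^2) f + 2 \<alpha> J1 f', whose
  complex characteristic roots are i \<alpha> + \<beta> and i \<alpha> - \<beta>. Up to the term
  from the rotation and the factor \<beta>, differentiation exchanges \<open>C\<close> and
  \<open>D\<close>.\<close>

definition wave :: "real \<Rightarrow> real \<Rightarrow> real^4 \<Rightarrow> real^4 \<Rightarrow> real \<Rightarrow> real^4" where
  "wave \<alpha> \<beta> C D x = rot (\<alpha> * x) (cosh (\<beta> * x) *\<^sub>R C + sinh (\<beta> * x) *\<^sub>R D)"

lemma rot_linear: "rot \<theta> (u + v) = rot \<theta> u + rot \<theta> v" "rot \<theta> (r *\<^sub>R u) = r *\<^sub>R rot \<theta> u"
  "rot \<theta> (u - v) = rot \<theta> u - rot \<theta> v"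
  by (simp_all add: rot_def J1_linear algebra_simps)

lemma rot_J1: "rot \<theta> (J1 v) = J1 (rot \<theta> v)"
  by (simp add: rot_def J1_linear)

lemma rot_minus_rot: "rot (- \<theta>) (rot \<theta> v) = v"
proof -
  have "rot (- \<theta>) (rot \<theta> v) = (cos \<theta> * cos \<theta> + sin \<theta> * sin \<theta>) *\<^sub>R v"
    by (simp add: rot_def J1_linear J1_J1 algebra_simps del: sin_cos_squared_add3)
  then show ?thesis
    by simp
qed

lemma rot_rot_minus: "rot \<theta> (rot (- \<theta>) v) = v"
  using rot_minus_rot[of "- \<theta>"] by simp

lemma g0_rot: "g0 (rot \<theta> u) (rot \<theta> v) = g0 u v"
proof -
  have "g0 (rot \<theta> u) (rot \<theta> v) = (cos \<theta> * cos \<theta> + sin \<theta> * sin \<theta>) * g0 u v"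
    unfolding rot_def g0_bilinear g0_J1_left g0_J1_J1
    by (simp add: J1_J1 g0_bilinear algebra_simps del: sin_cos_squared_add3)
  then show ?thesis
    by simp
qed

lemma cfst_rot: "cfst (rot \<theta> v) = cis \<theta> * cfst v"
  and csnd_rot: "csnd (rot \<theta> v) = cis \<theta> * csnd v"
  by (simp_all add: rot_def complex_eq_iff)

lemma rot_has_vector_derivative:
  assumes "(f has_vector_derivative f') (at x)"
  shows "((\<lambda>x. rot (\<alpha> * x) (f x)) has_vector_derivative rot (\<alpha> * x) (f' + \<alpha> *\<^sub>R J1 (f x))) (at x)"
proof -
  have c: "((\<lambda>x. cos (\<alpha> * x)) has_real_derivative - \<alpha> * sin (\<alpha> * x)) (at x)"
    and s: "((\<lambda>x. sin (\<alpha> * x)) has_real_derivative \<alpha> * cos (\<alpha> * x)) (at x)"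
    by (auto intro!: derivative_eq_intros)
  note J = bounded_linear.has_vector_derivative[OF bounded_linear_J1 assms]
  show ?thesis
    unfolding rot_def
    by (rule has_vector_derivative_eq_rhs[OF has_vector_derivative_add[OF
          has_vector_derivative_scaleR[OF c assms] has_vector_derivative_scaleR[OF s J]]])
      (simp add: J1_linear J1_J1 algebra_simps)
qed

lemma wave_has_vector_derivative:
  "(wave \<alpha> \<beta> C D has_vector_derivative \<alpha> *\<^sub>R J1 (wave \<alpha> \<beta> C D x) + \<beta> *\<^sub>R wave \<alpha> \<beta> D C x) (at x)"
proof -
  have ch: "((\<lambda>x. cosh (\<beta> * x)) has_real_derivative \<beta> * sinh (\<beta> * x)) (at x)"
    and sh: "((\<lambda>x. sinh (\<beta> * x)) has_real_derivative \<beta> * cosh (\<beta> * x)) (at x)"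
    by (auto intro!: derivative_eq_intros)
  have "((\<lambda>x. cosh (\<beta> * x) *\<^sub>R C + sinh (\<beta> * x) *\<^sub>R D) has_vector_derivative
      (\<beta> * sinh (\<beta> * x)) *\<^sub>R C + (\<beta> * cosh (\<beta> * x)) *\<^sub>R D) (at x)"
    using has_vector_derivative_add[OF has_vector_derivative_scaleR[OF ch has_vector_derivative_const]
        has_vector_derivative_scaleR[OF sh has_vector_derivative_const]] by simp
  from rot_has_vector_derivative[OF this, of \<alpha>]
  show ?thesis
    unfolding wave_def[abs_def]
    by (rule has_vector_derivative_eq_rhs) (simp add: rot_linear rot_J1 J1_linear algebra_simps)
qed

lemma wave_has_vector_derivative_coeffs:
  assumes "(C has_vector_derivative C') (at y)" "(D has_vector_derivative D') (at y)"
  shows "((\<lambda>y. wave \<alpha> \<beta> (C y) (D y) x) has_vector_derivative wave \<alpha> \<beta> C' D' x) (at y)"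
  unfolding wave_def rot_def
  by (intro has_vector_derivative_add bounded_linear.has_vector_derivative[OF bounded_linear_J1]
      bounded_linear.has_vector_derivative[OF bounded_linear_scaleR_right] assms)

lemma g0_wave:
  "g0 (wave \<alpha> \<beta> C D x) (wave \<alpha> \<beta> C' D' x) =
    (cosh (\<beta> * x))\<^sup>2 * g0 C C' + (sinh (\<beta> * x))\<^sup>2 * g0 D D'
    + cosh (\<beta> * x) * sinh (\<beta> * x) * (g0 C D' + g0 D C')"
  unfolding wave_def g0_rot by (simp add: g0_bilinear algebra_simps power2_eq_square)

text \<open>With \<open>G\<close> the equation becomes the system F' = \<alpha> J1 F + \<beta> G, G'
  = \<alpha> J1 G + \<beta> F. Undoing the rotation and the hyperbolic rotation of its flow produces
  constants, which can be evaluated at any base point \<open>x0\<close>. The explicit formula later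
  shows that they depend smoothly on a parameter.\<close>

lemma wave_ode_unique:
  assumes I: "open_interval I" and \<beta>: "\<beta> \<noteq> 0"
    and F: "\<And>x. x \<in> I \<Longrightarrow> (F has_vector_derivative F' x) (at x)"
    and F': "\<And>x. x \<in> I \<Longrightarrow>
      (F' has_vector_derivative (\<alpha>\<^sup>2 + \<beta>\<^sup>2) *\<^sub>R F x + (2 * \<alpha>) *\<^sub>R J1 (F' x)) (at x)"
    and x0: "x0 \<in> I" and x: "x \<in> I"
  defines "G \<equiv> \<lambda>x. (1 / \<beta>) *\<^sub>R (F' x - \<alpha> *\<^sub>R J1 (F x))"
  shows "F x = wave \<alpha> \<beta> (rot (- \<alpha> * x0) (cosh (\<beta> * x0) *\<^sub>R F x0 - sinh (\<beta> * x0) *\<^sub>R G x0))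
    (rot (- \<alpha> * x0) (cosh (\<beta> * x0) *\<^sub>R G x0 - sinh (\<beta> * x0) *\<^sub>R F x0)) x"
proof -
  define C where "C x = rot (- \<alpha> * x) (cosh (\<beta> * x) *\<^sub>R F x - sinh (\<beta> * x) *\<^sub>R G x)" for x
  define D where "D x = rot (- \<alpha> * x) (cosh (\<beta> * x) *\<^sub>R G x - sinh (\<beta> * x) *\<^sub>R F x)" for x
  have dF: "(F has_vector_derivative \<alpha> *\<^sub>R J1 (F x) + \<beta> *\<^sub>R G x) (at x)" if "x \<in> I" for x
    using F[OF that] \<beta> by (simp add: G_def)
  have dG: "(G has_vector_derivative \<alpha> *\<^sub>R J1 (G x) + \<beta> *\<^sub>R F x) (at x)" if "x \<in> I" for x
  proof -
    have "(G has_vector_derivative (1 / \<beta>) *\<^sub>R (((\<alpha>\<^sup>2 + \<beta>\<^sup>2) *\<^sub>R F x + (2 * \<alpha>) *\<^sub>R J1 (F' x))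
        - \<alpha> *\<^sub>R J1 (F' x))) (at x)"
      unfolding G_def
      by (intro bounded_linear.has_vector_derivative[OF bounded_linear_scaleR_right]
          bounded_linear.has_vector_derivative[OF bounded_linear_J1] has_vector_derivative_diff
          F F' that)
    moreover have "(1 / \<beta>) *\<^sub>R (((\<alpha>\<^sup>2 + \<beta>\<^sup>2) *\<^sub>R F x + (2 * \<alpha>) *\<^sub>R J1 (F' x)) - \<alpha> *\<^sub>R J1 (F' x))
        = \<alpha> *\<^sub>R J1 (G x) + \<beta> *\<^sub>R F x"
    proof -
      have "(2 * \<alpha>) *\<^sub>R v - \<alpha> *\<^sub>R v = \<alpha> *\<^sub>R v" for v :: "real^4"
        by (simp add: scaleR_left_diff_distrib[symmetric])
      then have "(1 / \<beta>) *\<^sub>R (((\<alpha>\<^sup>2 + \<beta>\<^sup>2) *\<^sub>R F x + (2 * \<alpha>) *\<^sub>R J1 (F' x)) - \<alpha> *\<^sub>R J1 (F' x))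
        = (1 / \<beta>) *\<^sub>R ((\<alpha>\<^sup>2 + \<beta>\<^sup>2) *\<^sub>R F x + \<alpha> *\<^sub>R J1 (F' x))"
        by (simp only: add_diff_eq[symmetric])
      also have "\<dots> = \<alpha> *\<^sub>R J1 (G x) + \<beta> *\<^sub>R F x"
        using \<beta> by (simp add: G_def J1_linear J1_J1 algebra_simps power2_eq_square)
      finally show ?thesis .
    qed
    ultimately show ?thesis
      by simp
  qed
  have ch: "((\<lambda>x. cosh (\<beta> * x)) has_real_derivative \<beta> * sinh (\<beta> * x)) (at x)"
    and sh: "((\<lambda>x. sinh (\<beta> * x)) has_real_derivative \<beta> * cosh (\<beta> * x)) (at x)" for x
    by (auto intro!: derivative_eq_intros)
  have "(C has_vector_derivative 0) (at x)" "(D has_vector_derivative 0) (at x)" if "x \<in> I" for x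
  proof -
    have "((\<lambda>x. cosh (\<beta> * x) *\<^sub>R F x - sinh (\<beta> * x) *\<^sub>R G x) has_vector_derivative
        \<alpha> *\<^sub>R J1 (cosh (\<beta> * x) *\<^sub>R F x - sinh (\<beta> * x) *\<^sub>R G x)) (at x)"
      by (rule has_vector_derivative_eq_rhs[OF has_vector_derivative_diff[OF
            has_vector_derivative_scaleR[OF ch dF[OF that]] has_vector_derivative_scaleR[OF sh dG[OF that]]]])
        (simp add: J1_linear algebra_simps)
    from rot_has_vector_derivative[OF this, of "- \<alpha>"]
    show "(C has_vector_derivative 0) (at x)"
      unfolding C_def[abs_def] by (simp add: rot_def J1_linear)
    have "((\<lambda>x. cosh (\<beta> * x) *\<^sub>R G x - sinh (\<beta> * x) *\<^sub>R F x) has_vector_derivative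
        \<alpha> *\<^sub>R J1 (cosh (\<beta> * x) *\<^sub>R G x - sinh (\<beta> * x) *\<^sub>R F x)) (at x)"
      by (rule has_vector_derivative_eq_rhs[OF has_vector_derivative_diff[OF
            has_vector_derivative_scaleR[OF ch dG[OF that]] has_vector_derivative_scaleR[OF sh dF[OF that]]]])
        (simp add: J1_linear algebra_simps)
    from rot_has_vector_derivative[OF this, of "- \<alpha>"]
    show "(D has_vector_derivative 0) (at x)"
      unfolding D_def[abs_def] by (simp add: rot_def J1_linear)
  qed
  then have eqs: "C x = C x0" "D x = D x0"
    using has_vector_derivative_zero_constant[of I C] has_vector_derivative_zero_constant[of I D]
      has_vector_derivative_at_within is_interval_convex I x x0 unfolding open_interval_def by metis+
  have "F x = wave \<alpha> \<beta> (C x) (D x) x"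
  proof -
    have "rot (- (\<alpha> * x)) (F x)
      = rot (- (\<alpha> * x)) (((cosh (\<beta> * x))\<^sup>2 - (sinh (\<beta> * x))\<^sup>2) *\<^sub>R F x)"
      unfolding hyperbolic_pythagoras by simp
    also have "\<dots> = cosh (\<beta> * x) *\<^sub>R C x + sinh (\<beta> * x) *\<^sub>R D x"
      by (simp add: C_def D_def rot_linear algebra_simps power2_eq_square)
    finally show ?thesis
      using rot_rot_minus[of "\<alpha> * x" "F x"] by (simp add: wave_def)
  qed
  then have "F x = wave \<alpha> \<beta> (C x0) (D x0) x"
    unfolding eqs .
  then show ?thesis
    unfolding C_def D_def .
qed

lemma det2_rot: "det2 (rot \<theta> u) (rot \<theta> v) = cis \<theta> * cis \<theta> * det2 u v"
  by (simp add: det2_def cfst_rot csnd_rot algebra_simps)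

lemma det2_wave: "det2 (wave \<alpha> \<beta> C D x) (wave \<alpha> \<beta> D C x) = cis (\<alpha> * x) * cis (\<alpha> * x) * det2 C D"
proof -
  have anti: "det2 D C = - det2 C D"
    by (simp add: det2_def)
  have "det2 (cosh t *\<^sub>R C + sinh t *\<^sub>R D) (cosh t *\<^sub>R D + sinh t *\<^sub>R C)
    = of_real ((cosh t)\<^sup>2 - (sinh t)\<^sup>2) * det2 C D" for t
    by (simp add: det2_simps anti algebra_simps power2_eq_square)
  then show ?thesis
    unfolding wave_def det2_rot hyperbolic_pythagoras by simp
qed

text \<open>The derivative of the combination vanishes as well, and the two equations have
  determinant cosh^2 - sinh^2 = 1.\<close>

lemma cosh_sinh_independent:
  fixes u v :: "'a::real_normed_vector"
  assumes "open I" "x \<in> I" "\<beta> \<noteq> 0" and eq: "\<And>x. x \<in> I \<Longrightarrow> cosh (\<beta> * x) *\<^sub>R u + sinh (\<beta> * x) *\<^sub>R v = 0"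
  shows "u = 0"
proof -
  have ch: "((\<lambda>x. cosh (\<beta> * x)) has_real_derivative \<beta> * sinh (\<beta> * x)) (at x)"
    and sh: "((\<lambda>x. sinh (\<beta> * x)) has_real_derivative \<beta> * cosh (\<beta> * x)) (at x)"
    by (auto intro!: derivative_eq_intros)
  have "((\<lambda>x. cosh (\<beta> * x) *\<^sub>R u + sinh (\<beta> * x) *\<^sub>R v) has_vector_derivative
      \<beta> *\<^sub>R (sinh (\<beta> * x) *\<^sub>R u + cosh (\<beta> * x) *\<^sub>R v)) (at x)"
    using has_vector_derivative_add[OF has_vector_derivative_scaleR[OF ch has_vector_derivative_const]
        has_vector_derivative_scaleR[OF sh has_vector_derivative_const]] by (simp add: scaleR_add_right)
  moreover have "((\<lambda>x. cosh (\<beta> * x) *\<^sub>R u + sinh (\<beta> * x) *\<^sub>R v) has_vector_derivative 0) (at x)"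
    by (rule has_vector_derivative_transform_within_open[OF has_vector_derivative_const assms(1,2)])
      (simp add: eq)
  ultimately have "\<beta> *\<^sub>R (sinh (\<beta> * x) *\<^sub>R u + cosh (\<beta> * x) *\<^sub>R v) = 0"
    by (rule vector_derivative_unique_at)
  then have d: "sinh (\<beta> * x) *\<^sub>R u + cosh (\<beta> * x) *\<^sub>R v = 0"
    using assms(3) by simp
  have "u = ((cosh (\<beta> * x))\<^sup>2 - (sinh (\<beta> * x))\<^sup>2) *\<^sub>R u"
    by (simp only: hyperbolic_pythagoras scaleR_one)
  also have "\<dots> = cosh (\<beta> * x) *\<^sub>R (cosh (\<beta> * x) *\<^sub>R u + sinh (\<beta> * x) *\<^sub>R v)
      - sinh (\<beta> * x) *\<^sub>R (sinh (\<beta> * x) *\<^sub>R u + cosh (\<beta> * x) *\<^sub>R v)"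
    by (simp add: algebra_simps power2_eq_square)
  also have "\<dots> = 0"
    using d eq[OF assms(2)] by simp
  finally show ?thesis .
qed

lemma smooth_on_wave: "smooth_on UNIV (wave \<alpha> \<beta> C D)"
proof -
  have l: "smooth_on UNIV (\<lambda>x::real. r * x)" for r
    by (intro smooth_on_mult smooth_on_const smooth_on_ident open_UNIV)
  show ?thesis
    unfolding wave_def[abs_def] rot_def
    by (intro smooth_on_add smooth_on_scaleR smooth_on_bounded_linear[OF bounded_linear_J1] open_UNIV
        smooth_on_const smooth_on_sin_compose smooth_on_cos_compose smooth_on_cosh_compose
        smooth_on_sinh_compose l)
qed

lemma Amat_wave:
  "Amat \<xi> \<xi>1 \<xi>2 \<xi>3 *v wave \<alpha> \<beta> C D x = wave \<alpha> \<beta> (Amat \<xi> \<xi>1 \<xi>2 \<xi>3 *v C) (Amat \<xi> \<xi>1 \<xi>2 \<xi>3 *v D) x"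
proof -
  have "Amat \<xi> \<xi>1 \<xi>2 \<xi>3 *v J1 v = J1 (Amat \<xi> \<xi>1 \<xi>2 \<xi>3 *v v)" for v
    using commutes_J1_Amat by (simp add: commutes_J1_def)
  then show ?thesis
    by (simp add: wave_def rot_def matrix_vector_right_distrib matrix_vector_mult_scaleR)
qed

subsection \<open>The constants and the curve\<close>

locale helix_constants =
  fixes \<kappa> \<tau> lam \<nu> :: real
  assumes \<kappa>_pos: "\<kappa> > 0" and \<tau>_pos: "\<tau> > 0" and lam: "lam \<in> {-1, 1}" and \<nu>: "\<nu> \<noteq> 0"
    and B: "B_const \<tau> lam \<nu> < 0"
begin

text \<open>The normalisation by \<open>k\<close> gives \<open>g0 q q = - 1 / k\<^sup>2\<close> on
  anti-de Sitter space, and \<alpha> and \<beta> are the constants of the curve, with division by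
  \<open>lam\<close> written as multiplication. The constant \<open>c\<close> is the vertical
  coefficient of T: the vector T - c J1 F is \<open>g0\<close>-orthogonal to F and to J1 F.\<close>

definition "k = sqrt \<kappa> / 2"
definition "\<rho> = sqrt (- B_const \<tau> lam \<nu>)"
definition "\<alpha> = lam * k * \<rho>\<^sup>2 / \<tau>"
definition "\<beta> = \<bar>\<nu>\<bar> * k * \<rho>"
definition "c = k * lam * (lam + \<nu>\<^sup>2) / \<tau>"
definition "E q = (k / \<tau>) *\<^sub>R J1 q"

lemma k_pos: "k > 0"
  using \<kappa>_pos by (simp add: k_def)

lemma \<rho>_pos: "\<rho> > 0"
  using B by (simp add: \<rho>_def)

lemma \<beta>_pos: "\<beta> > 0"
  using \<nu> k_pos \<rho>_pos by (simp add: \<beta>_def)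

lemma lam_mult: "lam * lam = 1" "lam * (lam * x) = x"
  using lam by auto

lemma divide_lam: "x / lam = lam * x"
  using lam by auto

lemma k_sq: "k\<^sup>2 = \<kappa> / 4"
  using \<kappa>_pos by (simp add: k_def power_divide)

lemma sqrt_\<kappa>: "sqrt \<kappa> = 2 * k"
  by (simp add: k_def)

lemma \<rho>_sq: "\<rho>\<^sup>2 = lam + \<nu>\<^sup>2 - \<tau>\<^sup>2 * \<nu>\<^sup>2"
  using B by (simp add: \<rho>_def B_const_def algebra_simps)

lemma \<rho>_mult: "\<rho> * \<rho> = lam + \<nu> * \<nu> - \<tau> * \<tau> * \<nu> * \<nu>"
  using \<rho>_sq by (simp add: power2_eq_square)

lemma sqrt_\<kappa>B: "sqrt (- \<kappa> * B_const \<tau> lam \<nu>) = 2 * k * \<rho>"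
  by (simp add: real_sqrt_mult[of \<kappa> "- B_const \<tau> lam \<nu>", simplified] sqrt_\<kappa> \<rho>_def)

section \<open>The metric at a point in terms of \<open>g0\<close> and \<open>J1\<close>\<close>

lemma ads_iff: "q \<in> ads \<kappa> \<longleftrightarrow> g0 q q = - 1 / k\<^sup>2"
  by (simp add: ads_def k_sq)

lemma gtau_eq: "gtau \<kappa> \<tau> q u v = g0 u v + (1 - \<tau>\<^sup>2) * k\<^sup>2 * g0 u (J1 q) * g0 v (J1 q)"
  by (simp add: gtau_def X1_def g0_bilinear sqrt_\<kappa> power2_eq_square algebra_simps)

lemma frame_1: "frame \<kappa> \<tau> 1 q = E q"
  by (simp add: frame_def X1_def sqrt_\<kappa> E_def)

lemma g0_E: "g0 v (E q) = (k / \<tau>) * g0 v (J1 q)"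
  by (simp add: E_def g0_bilinear)

text \<open>On anti-de Sitter space the factor 1 + (1 - \<tau>^2) k^2 \<open>g0 q q\<close> equals
  \<tau>^2.\<close>

lemma gtau_E:
  assumes "q \<in> ads \<kappa>"
  shows "gtau \<kappa> \<tau> q v (E q) = \<tau> * k * g0 v (J1 q)"
proof -
  have "gtau \<kappa> \<tau> q v (E q) = (k / \<tau>) * g0 v (J1 q) * (1 + (1 - \<tau>\<^sup>2) * k\<^sup>2 * g0 q q)"
    by (simp add: gtau_eq g0_E g0_J1_J1 E_def g0_bilinear algebra_simps)
  also have "\<dots> = \<tau> * k * g0 v (J1 q)"
    using assms k_pos \<tau>_pos by (simp add: ads_iff power2_eq_square)
  finally show ?thesis .
qed

lemma gtau_commute: "gtau \<kappa> \<tau> q u v = gtau \<kappa> \<tau> q v u"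
  by (simp add: gtau_eq g0_commute algebra_simps)

lemma gtau_add_right: "gtau \<kappa> \<tau> q u (v + v') = gtau \<kappa> \<tau> q u v + gtau \<kappa> \<tau> q u v'"
  by (simp add: gtau_eq g0_bilinear algebra_simps)

lemma gtau_diff_left: "gtau \<kappa> \<tau> q (u - u') v = gtau \<kappa> \<tau> q u v - gtau \<kappa> \<tau> q u' v"
  by (simp add: gtau_eq g0_bilinear algebra_simps)

lemma gtau_scaleR_left: "gtau \<kappa> \<tau> q (r *\<^sub>R u) v = r * gtau \<kappa> \<tau> q u v"
  by (simp add: gtau_eq g0_bilinear algebra_simps)

lemma gtau_scaleR_right: "gtau \<kappa> \<tau> q u (r *\<^sub>R v) = r * gtau \<kappa> \<tau> q u v"
  by (simp add: gtau_eq g0_bilinear algebra_simps)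

lemma gtau_diff_right: "gtau \<kappa> \<tau> q u (v - v') = gtau \<kappa> \<tau> q u v - gtau \<kappa> \<tau> q u v'"
  by (simp add: gtau_eq g0_bilinear algebra_simps)

text \<open>\<open>t\<close> stands for the tangential part \<open>T\<close> of \<open>E1\<close> at the point \<open>q\<close>; the equations
  below are those satisfied by \<open>T = E1 - \<nu> N\<close> for a unit normal \<open>N\<close>.\<close>

definition axis_tangent :: "real^4 \<Rightarrow> real^4 \<Rightarrow> bool" where
  "axis_tangent q t \<longleftrightarrow> g0 q q = - 1 / k\<^sup>2 \<and> g0 t q = 0 \<and> g0 t (J1 q) = - c / k\<^sup>2 \<and>
     g0 t t = - (lam + \<nu>\<^sup>2) * \<rho>\<^sup>2 / \<tau>\<^sup>2"

text \<open>The vector \<open>E q - t\<close> is \<nu> N, so this turns normality of N into a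
  \<open>g0\<close>-equation. The rotation speed \<alpha> of the curve arises here, as \<tau> k + (1
  - \<tau>^2) c.\<close>

lemma gtau_E_minus:
  assumes "axis_tangent q t"
  shows "gtau \<kappa> \<tau> q (E q - t) w = - g0 (t - \<alpha> *\<^sub>R J1 q) w"
proof -
  have q: "q \<in> ads \<kappa>" and tJ: "g0 t (J1 q) = - c / k\<^sup>2"
    using assms by (auto simp: axis_tangent_def ads_iff)
  have "gtau \<kappa> \<tau> q (E q - t) w = \<tau> * k * g0 w (J1 q) - (g0 t w - (1 - \<tau>\<^sup>2) * c * g0 w (J1 q))"
    using gtau_E[OF q, of w] k_pos by (simp add: gtau_diff_left gtau_commute[of q "E q"] gtau_eq[of q t] tJ)
  also have "\<dots> = (\<tau> * k + (1 - \<tau>\<^sup>2) * c) * g0 w (J1 q) - g0 t w"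
    by (simp add: algebra_simps)
  also have "\<tau> * k + (1 - \<tau>\<^sup>2) * c = \<alpha>"
    using \<tau>_pos by (simp add: c_def \<alpha>_def \<rho>_mult field_simps lam_mult power2_eq_square)
  finally show ?thesis
    by (simp add: g0_bilinear g0_commute)
qed

text \<open>The unit length follows from the two other products: \<nu> \<open>gtau N N\<close> is
  the product of N with E1 minus the product of N with t, and these are \<open>lam * \<nu>\<close>
  and 0.\<close>

lemma axis_tangent_normal:
  assumes t: "axis_tangent q t"
  defines "N \<equiv> (1 / \<nu>) *\<^sub>R (E q - t)"
  shows "g0 N q = 0" "gtau \<kappa> \<tau> q N N = lam" "gtau \<kappa> \<tau> q N t = 0" "gtau \<kappa> \<tau> q N (E q) = lam * \<nu>"
proof -
  have q: "q \<in> ads \<kappa>" and tq: "g0 t q = 0" and tJ: "g0 t (J1 q) = - c / k\<^sup>2"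
    and tt: "g0 t t = - (lam + \<nu>\<^sup>2) * \<rho>\<^sup>2 / \<tau>\<^sup>2"
    using t by (auto simp: axis_tangent_def ads_iff)
  have qq: "g0 q q = - 1 / k\<^sup>2"
    using q by (simp add: ads_iff)
  show "g0 N q = 0"
    by (simp add: N_def E_def g0_bilinear tq g0_J1_self)
  have "g0 (t - \<alpha> *\<^sub>R J1 q) t = 0"
    using k_pos \<tau>_pos by (simp add: g0_bilinear g0_commute[of "J1 q"] tt tJ \<alpha>_def c_def field_simps lam_mult
        power2_eq_square)
  then show Nt: "gtau \<kappa> \<tau> q N t = 0"
    by (simp add: N_def gtau_scaleR_left gtau_E_minus[OF t])
  have "g0 (t - \<alpha> *\<^sub>R J1 q) (E q) = - lam * \<nu>\<^sup>2"
  proof -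
    have "g0 (t - \<alpha> *\<^sub>R J1 q) (E q) = (k / \<tau>) * (- c / k\<^sup>2 + \<alpha> / k\<^sup>2)"
      by (simp add: g0_E g0_bilinear tJ g0_J1_J1 qq)
    also have "\<dots> = - lam * \<nu>\<^sup>2"
      using k_pos \<tau>_pos by (simp add: c_def \<alpha>_def \<rho>_mult field_simps power2_eq_square)
    finally show ?thesis .
  qed
  then show NE: "gtau \<kappa> \<tau> q N (E q) = lam * \<nu>"
    using \<nu> by (simp add: N_def gtau_scaleR_left gtau_E_minus[OF t] power2_eq_square)
  have "gtau \<kappa> \<tau> q N N = (1 / \<nu>) * (gtau \<kappa> \<tau> q N (E q) - gtau \<kappa> \<tau> q N t)"
    by (subst (2) N_def) (simp add: gtau_scaleR_right gtau_diff_right)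
  then show "gtau \<kappa> \<tau> q N N = lam"
    using Nt NE \<nu> by simp
qed

text \<open>The angle condition fixes \<open>g0 N (J1 q)\<close> and then the length condition fixes
  \<open>g0 N N\<close>; all products of T = E1 - \<nu> N are combinations of these two.\<close>

lemma normal_axis_tangent:
  assumes q: "q \<in> ads \<kappa>" and N: "g0 N q = 0" "gtau \<kappa> \<tau> q N N = lam" "gtau \<kappa> \<tau> q N (E q) = lam * \<nu>"
  shows "axis_tangent q (E q - \<nu> *\<^sub>R N)"
proof -
  have qq: "g0 q q = - 1 / k\<^sup>2"
    using q by (simp add: ads_iff)
  have NJ: "g0 N (J1 q) = lam * \<nu> / (\<tau> * k)"
    using N(3) k_pos \<tau>_pos by (simp add: gtau_E[OF q] field_simps)
  have NN: "g0 N N = lam - (1 - \<tau>\<^sup>2) * \<nu>\<^sup>2 / \<tau>\<^sup>2"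
  proof -
    have "k\<^sup>2 * (lam * \<nu> / (\<tau> * k)) * (lam * \<nu> / (\<tau> * k)) = \<nu>\<^sup>2 / \<tau>\<^sup>2"
      using k_pos \<tau>_pos by (simp add: field_simps power2_eq_square lam_mult)
    moreover have "lam = g0 N N + (1 - \<tau>\<^sup>2) * (k\<^sup>2 * (lam * \<nu> / (\<tau> * k)) * (lam * \<nu> / (\<tau> * k)))"
      using N(2) by (simp add: gtau_eq NJ mult.assoc)
    ultimately show ?thesis
      by simp
  qed
  have tJ: "g0 (E q - \<nu> *\<^sub>R N) (J1 q) = - c / k\<^sup>2"
    using k_pos \<tau>_pos by (simp add: g0_bilinear E_def g0_J1_J1 qq NJ c_def field_simps power2_eq_square lam_mult)
  have tq: "g0 (E q - \<nu> *\<^sub>R N) q = 0"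
    by (simp add: g0_bilinear E_def N(1) g0_J1_self)
  have "g0 (E q - \<nu> *\<^sub>R N) (E q - \<nu> *\<^sub>R N) = (k / \<tau>) * g0 (E q - \<nu> *\<^sub>R N) (J1 q)
      - \<nu> * ((k / \<tau>) * g0 N (J1 q) - \<nu> * g0 N N)"
    by (simp add: g0_bilinear g0_E g0_commute[of "E q" N] algebra_simps)
  also have "\<dots> = - (lam + \<nu>\<^sup>2) * \<rho>\<^sup>2 / \<tau>\<^sup>2"
    using k_pos \<tau>_pos unfolding tJ NJ NN
    by (simp add: c_def \<rho>_mult field_simps power2_eq_square lam_mult)
  finally show ?thesis
    using qq tJ tq unfolding axis_tangent_def by blast
qed

text \<open>The relations between the coefficients of the wave in \<open>x\<close> at a fixed \<open>y\<close>; they make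
  the wave satisfy \<^term>\<open>axis_tangent\<close>, and conversely.\<close>

definition coefficient_relations :: "real^4 \<Rightarrow> real^4 \<Rightarrow> bool" where
  "coefficient_relations C D \<longleftrightarrow> g0 C C = - 1 / k\<^sup>2 \<and> g0 D D = 1 / k\<^sup>2 \<and> g0 C D = 0 \<and>
     g0 D (J1 C) = - lam * \<tau> * \<bar>\<nu>\<bar> / (\<rho> * k\<^sup>2)"

text \<open>Here \<open>w\<close> is the derivative freed from its rotational part. The equations
  separate one after another: given the first and the last relation, the one for
  \<open>g0 t t\<close> reduces to \<beta>^2 (\<open>g0 w w\<close> - 1 / k^2) = 0.\<close>

lemma axis_tangent_iff_relations:
  "axis_tangent q (\<alpha> *\<^sub>R J1 q + \<beta> *\<^sub>R w) \<longleftrightarrow> coefficient_relations q w"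
proof -
  let ?t = "\<alpha> *\<^sub>R J1 q + \<beta> *\<^sub>R w"
  have tq: "g0 ?t q = 0 \<longleftrightarrow> g0 q w = 0"
    using \<beta>_pos by (simp add: g0_bilinear g0_J1_self g0_commute[of w])
  have tJ: "g0 ?t (J1 q) = - c / k\<^sup>2 \<longleftrightarrow> g0 w (J1 q) = - lam * \<tau> * \<bar>\<nu>\<bar> / (\<rho> * k\<^sup>2)"
    if "g0 q q = - 1 / k\<^sup>2"
  proof -
    have "\<alpha> - c = - lam * k * \<tau> * \<nu>\<^sup>2"
      using \<tau>_pos by (simp add: c_def \<alpha>_def \<rho>_mult field_simps power2_eq_square)
    moreover have "\<nu>\<^sup>2 = \<bar>\<nu>\<bar> * \<bar>\<nu>\<bar>"
      by (simp add: power2_eq_square)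
    ultimately have e: "(\<alpha> - c) / k\<^sup>2 = \<beta> * (- lam * \<tau> * \<bar>\<nu>\<bar> / (\<rho> * k\<^sup>2))"
      using k_pos \<rho>_pos by (simp add: \<beta>_def)
    have "g0 ?t (J1 q) = - c / k\<^sup>2 \<longleftrightarrow> \<beta> * g0 w (J1 q) = (\<alpha> - c) / k\<^sup>2"
      by (simp add: g0_bilinear g0_J1_J1 that diff_divide_distrib) argo
    then show ?thesis
      unfolding e mult_cancel_left using \<beta>_pos by simp
  qed
  have tt: "g0 ?t ?t = - (lam + \<nu>\<^sup>2) * \<rho>\<^sup>2 / \<tau>\<^sup>2 \<longleftrightarrow> g0 w w = 1 / k\<^sup>2"
    if "g0 q q = - 1 / k\<^sup>2" "g0 w (J1 q) = - lam * \<tau> * \<bar>\<nu>\<bar> / (\<rho> * k\<^sup>2)"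
  proof -
    have "g0 ?t ?t = \<alpha>\<^sup>2 * (- 1 / k\<^sup>2) + 2 * \<alpha> * \<beta> * (- lam * \<tau> * \<bar>\<nu>\<bar> / (\<rho> * k\<^sup>2)) + \<beta>\<^sup>2 * g0 w w"
      by (simp add: g0_bilinear g0_J1_J1 g0_commute[of "J1 q" w] that power2_eq_square algebra_simps)
    also have "\<alpha>\<^sup>2 * (- 1 / k\<^sup>2) + 2 * \<alpha> * \<beta> * (- lam * \<tau> * \<bar>\<nu>\<bar> / (\<rho> * k\<^sup>2))
        = - (lam + \<nu>\<^sup>2) * \<rho>\<^sup>2 / \<tau>\<^sup>2 - \<beta>\<^sup>2 / k\<^sup>2"
    proof -
      have "\<alpha>\<^sup>2 * (- 1 / k\<^sup>2) = - (\<rho>\<^sup>2 * \<rho>\<^sup>2) / \<tau>\<^sup>2"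
        using k_pos \<tau>_pos by (simp add: \<alpha>_def power2_eq_square field_simps lam_mult)
      moreover have "2 * \<alpha> * \<beta> * (- lam * \<tau> * \<bar>\<nu>\<bar> / (\<rho> * k\<^sup>2)) = - 2 * \<rho>\<^sup>2 * \<nu>\<^sup>2"
      proof -
        have "2 * \<alpha> * \<beta> * (- lam * \<tau> * \<bar>\<nu>\<bar> / (\<rho> * k\<^sup>2)) = - 2 * (lam * lam) * \<rho>\<^sup>2 * (\<bar>\<nu>\<bar> * \<bar>\<nu>\<bar>)"
          using k_pos \<tau>_pos \<rho>_pos by (simp add: \<alpha>_def \<beta>_def power2_eq_square field_simps)
        then show ?thesis
          by (simp add: lam_mult power2_eq_square)
      qed
      moreover have "\<beta>\<^sup>2 / k\<^sup>2 = \<rho>\<^sup>2 * \<nu>\<^sup>2"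
        using k_pos by (simp add: \<beta>_def power2_eq_square field_simps)
      moreover have "- (lam + \<nu>\<^sup>2) * \<rho>\<^sup>2 / \<tau>\<^sup>2 = - (\<rho>\<^sup>2 * \<rho>\<^sup>2) / \<tau>\<^sup>2 - \<nu>\<^sup>2 * \<rho>\<^sup>2"
      proof -
        have "lam + \<nu>\<^sup>2 = \<rho>\<^sup>2 + \<tau>\<^sup>2 * \<nu>\<^sup>2"
          by (simp add: \<rho>_sq)
        then show ?thesis
          using \<tau>_pos by (simp add: field_simps)
      qed
      ultimately show ?thesis
        by (simp add: algebra_simps)
    qed
    finally have "g0 ?t ?t = - (lam + \<nu>\<^sup>2) * \<rho>\<^sup>2 / \<tau>\<^sup>2 + \<beta>\<^sup>2 * (g0 w w - 1 / k\<^sup>2)"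
      by (simp add: right_diff_distrib)
    then show ?thesis
      using \<beta>_pos by simp
  qed
  show ?thesis
    unfolding axis_tangent_def coefficient_relations_def using tq tJ tt by blast
qed

text \<open>The two waves arise from \<open>C\<close> and \<open>D\<close> by a hyperbolic rotation
  followed by a complex rotation. The first preserves the relations because \<open>C\<close> and
  \<open>D\<close> have opposite squares and \<open>g0 D (J1 C)\<close> is antisymmetric in them.
  Hence relations at a single x yield the relations of the coefficients.\<close>

lemma coefficient_relations_wave:
  "coefficient_relations (wave \<alpha> \<beta> C D x) (wave \<alpha> \<beta> D C x) \<longleftrightarrow> coefficient_relations C D"
proof -
  have rel: "coefficient_relations (rot \<theta> (cosh s *\<^sub>R C + sinh s *\<^sub>R D)) (rot \<theta> (cosh s *\<^sub>R D + sinh s *\<^sub>R C))"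
    if "coefficient_relations C D" for C D s \<theta>
  proof -
    have r: "g0 C C = - 1 / k\<^sup>2" "g0 D D = 1 / k\<^sup>2" "g0 C D = 0" "g0 D C = 0"
      "g0 D (J1 C) = - lam * \<tau> * \<bar>\<nu>\<bar> / (\<rho> * k\<^sup>2)"
      using that g0_commute[of C D] by (auto simp: coefficient_relations_def)
    have r': "g0 C (J1 D) = - g0 D (J1 C)"
      using g0_J1_left[of C D] g0_commute[of "J1 C" D] by simp
    have "(cosh s)\<^sup>2 * z - (sinh s)\<^sup>2 * z = z" for z :: real
      using hyperbolic_pythagoras[of s] by (metis left_diff_distrib mult_1)
    note h = this[of "1 / k\<^sup>2"] this[of "lam * \<tau> * \<bar>\<nu>\<bar> / (\<rho> * k\<^sup>2)"]
    show ?thesis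
      unfolding coefficient_relations_def rot_J1[symmetric] g0_rot J1_linear g0_bilinear r' r g0_J1_self
      using h by (auto simp: power2_eq_square algebra_simps)
  qed
  show ?thesis
  proof
    assume "coefficient_relations C D"
    from rel[OF this] show "coefficient_relations (wave \<alpha> \<beta> C D x) (wave \<alpha> \<beta> D C x)"
      by (simp add: wave_def)
  next
    assume "coefficient_relations (wave \<alpha> \<beta> C D x) (wave \<alpha> \<beta> D C x)"
    \<comment> \<open>The inverse of the move is a move of the same kind with both parameters
      negated, so one implication yields the other.\<close>
    moreover have inv: "rot (- (\<alpha> * x)) (cosh (- (\<beta> * x)) *\<^sub>R wave \<alpha> \<beta> C D x + sinh (- (\<beta> * x)) *\<^sub>R wave \<alpha> \<beta> D C x) = C"
      for C D
    proof -
      have "rot (- (\<alpha> * x)) (cosh (- (\<beta> * x)) *\<^sub>R wave \<alpha> \<beta> C D x + sinh (- (\<beta> * x)) *\<^sub>R wave \<alpha> \<beta> D C x)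
        = ((cosh (\<beta> * x))\<^sup>2 - (sinh (\<beta> * x))\<^sup>2) *\<^sub>R C"
        unfolding wave_def rot_linear rot_minus_rot
        by (simp add: algebra_simps power2_eq_square)
      then show ?thesis
        by (simp add: hyperbolic_pythagoras)
    qed
    ultimately show "coefficient_relations C D"
      using rel[of "wave \<alpha> \<beta> C D x" "wave \<alpha> \<beta> D C x" "- (\<alpha> * x)" "- (\<beta> * x)"]
      unfolding inv by blast
  qed
qed

text \<open>\<open>P\<close> and \<open>Q\<close> are the coefficients of cosh and sinh in the
  curve. \<open>P\<close> lies on the second complex axis, so k A P is the second column of A; the
  first column is then recovered from A Q.\<close>

definition "s = sqrt (lam + \<nu>\<^sup>2)"
definition "P = of_cpair 0 (of_real (1 / k))"
definition "Q = of_cpair (of_real (s / (k * \<rho>))) (\<i> * of_real (lam * \<tau> * \<bar>\<nu>\<bar> / (k * \<rho>)))"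

lemma helix_curve_eq: "helix_curve \<kappa> \<tau> lam \<nu> x = wave \<alpha> \<beta> P Q x"
proof -
  have al: "- (sqrt \<kappa> / 2) * (B_const \<tau> lam \<nu> / (lam * \<tau>)) = \<alpha>"
  proof -
    have "B_const \<tau> lam \<nu> = - \<rho>\<^sup>2"
      using B by (simp add: \<rho>_def)
    then have "- (sqrt \<kappa> / 2) * (B_const \<tau> lam \<nu> / (lam * \<tau>)) = k * (\<rho>\<^sup>2 / lam / \<tau>)"
      by (simp add: sqrt_\<kappa> field_simps)
    then show ?thesis
      by (simp add: divide_lam \<alpha>_def)
  qed
  have be: "\<bar>\<nu>\<bar> * (sqrt (- \<kappa> * B_const \<tau> lam \<nu>) / 2) = \<beta>"
    unfolding sqrt_\<kappa>B by (simp add: \<beta>_def)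
  have 2: "2 * z / (2 * k * \<rho>) = z / (k * \<rho>)" "2 / (2 * k) = 1 / k" for z
    by simp_all
  show ?thesis
    unfolding helix_curve_def Let_def al be unfolding sqrt_\<kappa>B sqrt_\<kappa>
    by (rule real4_eqI)
      (simp_all add: wave_def cfst_rot csnd_rot P_def Q_def s_def[symmetric] 2 mult.assoc[of 2] del: mult_divide_mult_cancel_left_if,
       simp_all add: cfst_def csnd_def vector_4 complex_eq_iff algebra_simps)
qed

text \<open>The amplitudes of the curve are chosen so that
  \<open>s\<^sup>2 - \<tau>\<^sup>2 \<nu>\<^sup>2 = \<rho>\<^sup>2\<close>, which normalises
  \<open>Q\<close>.\<close>

lemma coefficient_relations_P_Q:
  assumes "lam + \<nu>\<^sup>2 > 0"
  shows "coefficient_relations P Q"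
proof -
  have "s * s = lam + \<nu>\<^sup>2"
    using assms by (simp add: s_def)
  moreover have "(\<tau> * \<bar>\<nu>\<bar>) * (\<tau> * \<bar>\<nu>\<bar>) = \<tau>\<^sup>2 * \<nu>\<^sup>2"
    by (simp add: power2_eq_square)
  ultimately have "s * s - (\<tau> * \<bar>\<nu>\<bar>) * (\<tau> * \<bar>\<nu>\<bar>) = \<rho> * \<rho>"
    using \<rho>_sq by (simp add: power2_eq_square)
  moreover have "g0 Q Q = (s * s - (lam * lam) * ((\<tau> * \<bar>\<nu>\<bar>) * (\<tau> * \<bar>\<nu>\<bar>))) / (k\<^sup>2 * (\<rho> * \<rho>))"
    by (simp add: g0_complex Q_def diff_divide_distrib power2_eq_square mult_ac)
  ultimately have "g0 Q Q = 1 / k\<^sup>2"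
    using \<rho>_pos by (simp add: lam_mult)
  then show ?thesis
    by (simp add: coefficient_relations_def g0_complex P_def Q_def power2_eq_square mult_ac)
qed

lemma coefficient_relations_Amat:
  assumes "coefficient_relations C D"
  shows "coefficient_relations (Amat \<xi> \<xi>1 \<xi>2 \<xi>3 *v C) (Amat \<xi> \<xi>1 \<xi>2 \<xi>3 *v D)"
proof -
  have "J1 (Amat \<xi> \<xi>1 \<xi>2 \<xi>3 *v C) = Amat \<xi> \<xi>1 \<xi>2 \<xi>3 *v J1 C"
    using commutes_J1_Amat by (simp add: commutes_J1_def)
  then show ?thesis
    using assms by (simp add: coefficient_relations_def g0_Amat)
qed

lemma axis_tangent_wave:
  assumes "coefficient_relations C D"
  shows "axis_tangent (wave \<alpha> \<beta> C D x) (\<alpha> *\<^sub>R J1 (wave \<alpha> \<beta> C D x) + \<beta> *\<^sub>R wave \<alpha> \<beta> D C x)"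
  using assms by (simp add: axis_tangent_iff_relations coefficient_relations_wave)

text \<open>The derivatives in y of the relations kill the diagonal products and make the two mixed
  ones opposite, so the x-dependence is the factor cosh^2 - sinh^2. Normality to F_y is thus a
  condition on y alone.\<close>

lemma g0_wave_partials:
  assumes "open J" "y \<in> J" "\<And>y. y \<in> J \<Longrightarrow> coefficient_relations (C y) (D y)"
    and "(C has_vector_derivative C') (at y)" "(D has_vector_derivative D') (at y)"
  shows "g0 (wave \<alpha> \<beta> (D y) (C y) x) (wave \<alpha> \<beta> C' D' x) = g0 (D y) C'"
proof -
  have "g0 C' (C y) + g0 (C y) C' = 0" "g0 D' (D y) + g0 (D y) D' = 0" "g0 C' (D y) + g0 (C y) D' = 0"
    using assms(3)
    by (intro constant_g0_derivative[OF assms(1,2)] assms(4,5); simp add: coefficient_relations_def)+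
  then have "g0 (C y) C' = 0" "g0 (D y) D' = 0" "g0 (C y) D' = - g0 (D y) C'"
    by (simp_all add: g0_commute[of C'] g0_commute[of D'])
  then have "g0 (wave \<alpha> \<beta> (D y) (C y) x) (wave \<alpha> \<beta> C' D' x)
    = ((cosh (\<beta> * x))\<^sup>2 - (sinh (\<beta> * x))\<^sup>2) * g0 (D y) C'"
    by (simp add: g0_wave algebra_simps)
  then show ?thesis
    by (simp only: hyperbolic_pythagoras)
qed

text \<open>The left side of the differential equation is 2 k^2 \<rho> |\<nu>| times
  \<open>g0 (A Q) (A P)'\<close>.\<close>

lemma helix_ode_iff:
  assumes "(\<xi>1 has_real_derivative d1) (at y)" "(\<xi>2 has_real_derivative d2) (at y)"
    "(\<xi>3 has_real_derivative d3) (at y)"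
    and P': "((\<lambda>y. Amat \<xi> (\<xi>1 y) (\<xi>2 y) (\<xi>3 y) *v P) has_vector_derivative P') (at y)"
  shows "helix_ode \<tau> lam \<nu> \<xi>1 \<xi>2 \<xi>3 y \<longleftrightarrow> g0 (Amat \<xi> (\<xi>1 y) (\<xi>2 y) (\<xi>3 y) *v Q) P' = 0"
proof -
  let ?C = "cosh (\<xi>1 y)" and ?S = "sinh (\<xi>1 y)" and ?e = "- \<i> * cis \<xi>"
    and ?u = "cis (\<xi>2 y)" and ?w = "cis (\<xi>3 y)"
    and ?q1 = "s / (k * \<rho>)" and ?q2 = "lam * \<tau> * \<bar>\<nu>\<bar> / (k * \<rho>)"
  let ?a' = "(of_real (?S * d1) + \<i> * of_real (?C * d2)) * ?u"
  let ?b' = "(of_real (?C * d1) + \<i> * of_real (?S * d3)) * ?w"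
  have P'_eq: "P' = of_cpair (?b' * of_real (1 / k)) (?e * (cnj ?a' * of_real (1 / k)))"
    using vector_derivative_unique_at[OF P' Amat_has_vector_derivative[OF assms(1-3), of \<xi> P]]
    by (simp add: P_def)
  have ee: "?e * cnj ?e = 1"
    by (rule Amat_entries)
  have cc: "cis r * cnj (cis r) = 1" for r
    by (simp add: cis_cnj cis_mult)
  have CS: "complex_of_real ?C * of_real ?C - of_real ?S * of_real ?S = 1"
    using arg_cong[OF hyperbolic_pythagoras[of "\<xi>1 y"], of complex_of_real]
    by (simp only: power2_eq_square of_real_diff of_real_mult of_real_1)
  let ?X = "(of_real ?C * ?u * of_real ?q1 + of_real ?S * ?w * (\<i> * of_real ?q2)) *
      ((of_real ?C * of_real d1 - \<i> * of_real ?S * of_real d3) * cnj ?w)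
    - (of_real ?S * cnj ?w * of_real ?q1 + of_real ?C * cnj ?u * (\<i> * of_real ?q2)) *
      ((of_real ?S * of_real d1 + \<i> * of_real ?C * of_real d2) * ?u)"
  have "g0 (Amat \<xi> (\<xi>1 y) (\<xi>2 y) (\<xi>3 y) *v Q) P' = Re ?X / k"
  proof -
    let ?a = "of_real ?C * ?u" and ?b = "of_real ?S * ?w" and ?r = "complex_of_real (1 / k)"
    \<comment> \<open>Isolates \<open>e * cnj e\<close>, which is 1; this is how the angle \<xi>
      leaves the equation.\<close>
    have general: "(a * q1 + b * z) * cnj (b' * of_real r) - e * (cnj b * q1 + cnj a * z) * cnj (e * (cnj a' * of_real r))
      = ((a * q1 + b * z) * cnj b' - (e * cnj e) * ((cnj b * q1 + cnj a * z) * a')) * of_real r"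
      for a b a' b' e q1 z :: complex and r
      by (simp add: algebra_simps)
    have "cfst (Amat \<xi> (\<xi>1 y) (\<xi>2 y) (\<xi>3 y) *v Q) * cnj (cfst P')
        - csnd (Amat \<xi> (\<xi>1 y) (\<xi>2 y) (\<xi>3 y) *v Q) * cnj (csnd P')
      = ((?a * of_real ?q1 + ?b * (\<i> * of_real ?q2)) * cnj ?b'
        - (?e * cnj ?e) * ((cnj ?b * of_real ?q1 + cnj ?a * (\<i> * of_real ?q2)) * ?a')) * ?r"
      unfolding cfst_Amat csnd_Amat P'_eq Q_def cfst_of_cpair csnd_of_cpair by (rule general)
    also have "\<dots> = ?X * of_real (1 / k)"
      unfolding ee by (simp add: mult.assoc)
    finally show ?thesis
      by (simp add: g0_complex)
  qed
  also have "?X = of_real ?q1 * (of_real d1 - \<i> * of_real ?S * of_real ?C * (of_real d2 + of_real d3)) * (?u * cnj ?w)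
      + of_real ?q2 * (of_real ?C * of_real ?C * of_real d2 + of_real ?S * of_real ?S * of_real d3)"
    by (rule ode_identity[OF cc cc CS]) simp
  also have "Re \<dots> = ?q1 * (d1 * cos (\<xi>2 y - \<xi>3 y) + ?S * ?C * (d2 + d3) * sin (\<xi>2 y - \<xi>3 y))
      + ?q2 * (?C * ?C * d2 + ?S * ?S * d3)"
  proof -
    have "?u * cnj ?w = cis (\<xi>2 y - \<xi>3 y)"
      by (simp add: cis_cnj cis_mult)
    then show ?thesis
      by (simp add: algebra_simps)
  qed
  finally have g: "g0 (Amat \<xi> (\<xi>1 y) (\<xi>2 y) (\<xi>3 y) *v Q) P' = (?q1 * (d1 * cos (\<xi>2 y - \<xi>3 y)
      + ?S * ?C * (d2 + d3) * sin (\<xi>2 y - \<xi>3 y)) + ?q2 * (?C * ?C * d2 + ?S * ?S * d3)) / k" .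
  have "helix_ode \<tau> lam \<nu> \<xi>1 \<xi>2 \<xi>3 y \<longleftrightarrow>
      \<bar>\<nu>\<bar> * s * (2 * cos (\<xi>2 y - \<xi>3 y) * d1 + (d2 + d3) * sin (\<xi>2 y - \<xi>3 y) * (2 * ?S * ?C))
      + 2 * lam * \<tau> * (\<bar>\<nu>\<bar> * \<bar>\<nu>\<bar>) * (?C * ?C * d2 + ?S * ?S * d3) = 0"
    unfolding helix_ode_def sinh_double DERIV_imp_deriv[OF assms(1)] DERIV_imp_deriv[OF assms(2)]
      DERIV_imp_deriv[OF assms(3)] s_def by (simp add: power2_eq_square)
  also have "\<bar>\<nu>\<bar> * s * (2 * cos (\<xi>2 y - \<xi>3 y) * d1 + (d2 + d3) * sin (\<xi>2 y - \<xi>3 y) * (2 * ?S * ?C))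
      + 2 * lam * \<tau> * (\<bar>\<nu>\<bar> * \<bar>\<nu>\<bar>) * (?C * ?C * d2 + ?S * ?S * d3)
    = 2 * k\<^sup>2 * \<rho> * \<bar>\<nu>\<bar> * g0 (Amat \<xi> (\<xi>1 y) (\<xi>2 y) (\<xi>3 y) *v Q) P'"
  proof -
    have "n * s * (2 * X * d1 + (d2 + d3) * Y * (2 * S * C)) + 2 * lam * \<tau> * (n * n) * Z
      = 2 * k\<^sup>2 * \<rho> * n * ((s / (k * \<rho>) * (d1 * X + S * C * (d2 + d3) * Y) + lam * \<tau> * n / (k * \<rho>) * Z) / k)"
      for n X Y Z S C
      using k_pos \<rho>_pos by (simp add: power2_eq_square field_simps)
    then show ?thesis
      unfolding g .
  qed
  finally show ?thesis
    using k_pos \<rho>_pos \<nu> by simp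
qed

section \<open>Relations between the constants\<close>

lemma \<alpha>_minus_c: "\<alpha> = c - lam * k * \<tau> * \<nu>\<^sup>2"
  using \<tau>_pos by (simp add: c_def \<alpha>_def \<rho>_mult field_simps power2_eq_square)

lemma \<alpha>_times_c: "\<alpha> * c = k\<^sup>2 * ((lam + \<nu>\<^sup>2) * \<rho>\<^sup>2 / \<tau>\<^sup>2)"
  by (simp add: c_def \<alpha>_def field_simps power2_eq_square lam_mult)

text \<open>Since \<alpha> (c - \<alpha>) = \<beta>^2, the constant in \<open>g0 T T\<close> is also
  the coefficient of F in the equation for T_x.\<close>

lemma \<alpha>_\<beta>_sq: "\<alpha>\<^sup>2 + \<beta>\<^sup>2 = \<alpha> * c"
proof -
  have "\<alpha> * (c - \<alpha>) = (lam * lam) * (k * k) * (\<rho> * \<rho>) * (\<nu> * \<nu>)"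
  proof -
    have "c - \<alpha> = lam * k * \<tau> * \<nu>\<^sup>2"
      by (simp add: \<alpha>_minus_c)
    then have "\<alpha> * (c - \<alpha>) = (lam * k * \<rho>\<^sup>2 / \<tau>) * (lam * k * \<tau> * \<nu>\<^sup>2)"
      by (simp only: \<alpha>_def)
    then show ?thesis
      using \<tau>_pos by (simp add: power2_eq_square mult_ac)
  qed
  moreover have "\<beta>\<^sup>2 = (k * k) * (\<rho> * \<rho>) * (\<nu> * \<nu>)"
    by (simp add: \<beta>_def power_mult_distrib power2_eq_square)
  ultimately show ?thesis
    by (simp add: lam_mult power2_eq_square algebra_simps)
qed

text \<open>As N wedge N vanishes, this is N wedge E1 = n3 E2 - n2 E3, with n2 and n3 the
  coefficients of N. \<open>J2_J3_identity\<close> rewrites the right side.\<close>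

lemma wedge_normal_tangent:
  assumes q: "q \<in> ads \<kappa>" and N: "g0 N q = 0"
  shows "wedge \<kappa> \<tau> q N (E q - \<nu> *\<^sub>R N) = k\<^sup>2 *\<^sub>R (g0 N (J1 q) *\<^sub>R q) - J1 N"
proof -
  have "frame \<kappa> \<tau> 2 q = k *\<^sub>R J2 q" "frame \<kappa> \<tau> 3 q = k *\<^sub>R J3 q"
    by (simp_all add: frame_def X2_def X3_def sqrt_\<kappa>)
  note fr = frame_1 this
  have J: "g0 (J2 q) (J1 q) = 0" "g0 (J3 q) (J1 q) = 0"
    by (simp_all add: g0_def J1_def J2_def J3_def vector_4)
  have "coef \<kappa> \<tau> q 1 v = - gtau \<kappa> \<tau> q v (E q)" for v
    unfolding coef_def frame_1 by simp
  moreover have "coef \<kappa> \<tau> q 2 v = k * g0 v (J2 q)"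
    "coef \<kappa> \<tau> q 3 v = k * g0 v (J3 q)" for v
    by (simp_all add: coef_def fr(2,3) gtau_eq g0_bilinear J)
  ultimately have co: "coef \<kappa> \<tau> q 1 v = - gtau \<kappa> \<tau> q v (E q)" "coef \<kappa> \<tau> q 2 v = k * g0 v (J2 q)"
    "coef \<kappa> \<tau> q 3 v = k * g0 v (J3 q)" for v
    by blast+
  have qq: "g0 q q = - 1 / k\<^sup>2"
    using q by (simp add: ads_iff)
  have EE: "gtau \<kappa> \<tau> q (E q) (E q) = - 1"
    using k_pos \<tau>_pos by (simp add: gtau_E[OF q]) (simp add: E_def g0_bilinear g0_J1_J1 qq power2_eq_square)
  have JJ: "g0 (E q) (J2 q) = 0" "g0 (E q) (J3 q) = 0"
    using J by (simp_all add: E_def g0_bilinear g0_commute[of "J1 q"])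
  have "wedge \<kappa> \<tau> q N (E q - \<nu> *\<^sub>R N)
      = (k * g0 N (J3 q)) *\<^sub>R (k *\<^sub>R J2 q) - (k * g0 N (J2 q)) *\<^sub>R (k *\<^sub>R J3 q)"
    unfolding wedge_def Let_def fr co
    by (simp add: gtau_diff_left gtau_scaleR_left EE g0_bilinear JJ algebra_simps)
  also have "\<dots> = k\<^sup>2 *\<^sub>R (g0 N (J3 q) *\<^sub>R J2 q - g0 N (J2 q) *\<^sub>R J3 q)"
    by (simp add: algebra_simps power2_eq_square)
  also have "\<dots> = k\<^sup>2 *\<^sub>R (g0 N (J1 q) *\<^sub>R q) - J1 N"
    unfolding J2_J3_identity qq N using k_pos by (simp add: algebra_simps)
  finally show ?thesis .
qed

text \<open>Eliminates N from JT, so that the coordinate condition expresses F_y by F and F_x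
  alone.\<close>

lemma wedge_axis_tangent:
  assumes q: "q \<in> ads \<kappa>" and N: "g0 N q = 0" "gtau \<kappa> \<tau> q N (E q) = lam * \<nu>"
    and t: "t = E q - \<nu> *\<^sub>R N"
  shows "wedge \<kappa> \<tau> q N t = (1 / \<nu>) *\<^sub>R (J1 t + c *\<^sub>R q)"
proof -
  have NJ: "g0 N (J1 q) = lam * \<nu> / (\<tau> * k)"
    using N(2) k_pos \<tau>_pos by (simp add: gtau_E[OF q] field_simps)
  have e: "k\<^sup>2 * g0 N (J1 q) = k * lam * \<nu> / \<tau>"
    unfolding NJ using k_pos by (simp add: power2_eq_square)
  have "J1 t = - (k / \<tau>) *\<^sub>R q - \<nu> *\<^sub>R J1 N"
    by (simp add: t E_def J1_linear J1_J1)
  then have "J1 t + c *\<^sub>R q = (c - k / \<tau>) *\<^sub>R q - \<nu> *\<^sub>R J1 N"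
    by (simp add: scaleR_left_diff_distrib)
  also have "c - k / \<tau> = \<nu> * (k * lam * \<nu> / \<tau>)"
    using \<tau>_pos by (simp add: c_def field_simps power2_eq_square lam_mult)
  finally have "(1 / \<nu>) *\<^sub>R (J1 t + c *\<^sub>R q) = (k * lam * \<nu> / \<tau>) *\<^sub>R q - J1 N"
    using \<nu> by (simp add: scaleR_diff_right)
  moreover have "wedge \<kappa> \<tau> q N t = (k * lam * \<nu> / \<tau>) *\<^sub>R q - J1 N"
    unfolding t wedge_normal_tangent[OF q N(1)] scaleR_scaleR e ..
  ultimately show ?thesis
    by (simp only:)
qed

text \<open>The entries of the matrix that maps \<^term>\<open>P\<close>, \<^term>\<open>Q\<close> to \<open>C\<close>, \<open>D\<close>.\<close>

lemma coefficient_relations_unitary: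
  assumes pos: "lam + \<nu>\<^sup>2 > 0" and rel: "coefficient_relations C D"
  defines "q1 \<equiv> complex_of_real (s / (k * \<rho>))" and "q2 \<equiv> \<i> * complex_of_real (lam * \<tau> * \<bar>\<nu>\<bar> / (k * \<rho>))"
  defines "a12 \<equiv> of_real k * cfst C" and "a22 \<equiv> of_real k * csnd C"
  defines "a11 \<equiv> (cfst D - a12 * q2) / q1" and "a21 \<equiv> (csnd D - a22 * q2) / q1"
  shows "a11 * cnj a11 - a21 * cnj a21 = 1" "a12 * cnj a12 - a22 * cnj a22 = - 1"
    "a11 * cnj a12 = a21 * cnj a22"
    "cfst C * csnd D - csnd C * cfst D = - (q1 / of_real k) * (a11 * a22 - a12 * a21)"
    "q1 \<noteq> 0"
proof -
  let ?l = "lam * \<tau> * \<bar>\<nu>\<bar> / (k * \<rho>)" and ?r = "s / (k * \<rho>)"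
  have spos: "s > 0"
    using pos by (simp add: s_def)
  then show q1: "q1 \<noteq> 0"
    using k_pos \<rho>_pos by (simp add: q1_def)
  have CC: "cfst C * cnj (cfst C) - csnd C * cnj (csnd C) = - of_real (1 / k\<^sup>2)"
    using rel by (simp add: coefficient_relations_def g0_complex complex_eq_iff)
  have DD: "cfst D * cnj (cfst D) - csnd D * cnj (csnd D) = of_real (1 / k\<^sup>2)"
    using rel by (simp add: coefficient_relations_def g0_complex complex_eq_iff)
  have DC: "cfst D * cnj (cfst C) - csnd D * cnj (csnd C) = - q2 * of_real (1 / k)"
  proof -
    have "g0 D C = 0" "g0 D (J1 C) = - ?l / k"
      using rel by (simp_all add: coefficient_relations_def g0_commute power2_eq_square mult_ac)
    then show ?thesis
      unfolding q2_def g0_complex by (simp add: complex_eq_iff)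
  qed
  have CD: "cfst C * cnj (cfst D) - csnd C * cnj (csnd D) = q2 * of_real (1 / k)"
    using arg_cong[OF DC, of cnj] by (simp add: q2_def mult.commute)
  have kk: "complex_of_real (1 / k) * of_real k = 1" "complex_of_real (1 / k\<^sup>2) = of_real (1 / k) * of_real (1 / k)"
    using k_pos by (simp_all add: power2_eq_square)
  show "a12 * cnj a12 - a22 * cnj a22 = - 1"
  proof -
    have "a12 * cnj a12 - a22 * cnj a22
      = of_real k * of_real k * (cfst C * cnj (cfst C) - csnd C * cnj (csnd C))"
      by (simp add: a12_def a22_def algebra_simps)
    then show ?thesis
      unfolding CC using k_pos by (simp add: power2_eq_square)
  qed
  have q2c: "cnj q2 = - q2" "cnj q1 = q1"
    by (simp_all add: q2_def q1_def)
  \<comment> \<open>\<open>D\<close> is q1 times the first column plus q2 times the second, so the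
    first column is normalised once \<open>D\<close> minus q2 times the second column has Hermitian
    square q1^2. The cross terms combine because q2 is purely imaginary.\<close>
  have num1: "(cfst D - a12 * q2) * cnj (cfst D - a12 * q2) - (csnd D - a22 * q2) * cnj (csnd D - a22 * q2) = q1 * q1"
  proof -
    have "(cfst D - a12 * q2) * cnj (cfst D - a12 * q2) - (csnd D - a22 * q2) * cnj (csnd D - a22 * q2)
      = (cfst D * cnj (cfst D) - csnd D * cnj (csnd D))
        + of_real k * q2 * (cfst D * cnj (cfst C) - csnd D * cnj (csnd C))
        - of_real k * q2 * (cfst C * cnj (cfst D) - csnd C * cnj (csnd D))
        - of_real k * of_real k * q2 * q2 * (cfst C * cnj (cfst C) - csnd C * cnj (csnd C))"
      by (simp add: a12_def a22_def q2c algebra_simps)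
    also have "\<dots> = of_real (1 / k\<^sup>2) - q2 * q2"
      unfolding CC DD DC CD using k_pos by (simp add: power2_eq_square algebra_simps)
    also have "\<dots> = of_real (1 / k\<^sup>2 + ?l * ?l)"
    proof -
      have "(\<i> * z) * (\<i> * z) = - (z * z)" for z
        by (simp add: power2_eq_square[symmetric] power_mult_distrib)
      then have "q2 * q2 = - of_real (?l * ?l)"
        unfolding q2_def by (simp only: of_real_mult)
      then show ?thesis
        by (simp only: of_real_add diff_minus_eq_add)
    qed
    also have "1 / k\<^sup>2 + ?l * ?l = ?r * ?r"
    proof -
      have "s * s = lam + \<nu>\<^sup>2"
        using pos by (simp add: s_def)
      then have ss: "s * s = \<rho> * \<rho> + (lam * lam) * (\<tau> * \<tau>) * (\<nu> * \<nu>)"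
        by (simp add: \<rho>_mult lam_mult power2_eq_square)
      have "?l * ?l = (lam * lam) * (\<tau> * \<tau>) * (\<bar>\<nu>\<bar> * \<bar>\<nu>\<bar>) / ((k * \<rho>) * (k * \<rho>))"
        by simp
      also have "\<bar>\<nu>\<bar> * \<bar>\<nu>\<bar> = \<nu> * \<nu>"
        by simp
      finally have ll: "?l * ?l = (lam * lam) * (\<tau> * \<tau>) * (\<nu> * \<nu>) / ((k * \<rho>) * (k * \<rho>))" .
      have "?r * ?r = (s * s) / ((k * \<rho>) * (k * \<rho>))"
        by simp
      then show ?thesis
        unfolding ss ll using k_pos \<rho>_pos by (simp add: field_simps power2_eq_square)
    qed
    finally show ?thesis
      by (simp add: q1_def)
  qed
  have "a11 * cnj a11 - a21 * cnj a21
      = ((cfst D - a12 * q2) * cnj (cfst D - a12 * q2) - (csnd D - a22 * q2) * cnj (csnd D - a22 * q2)) / (q1 * q1)"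
    unfolding a11_def a21_def complex_cnj_divide q2c(2) times_divide_times_eq
    by (rule diff_divide_distrib[symmetric])
  then show "a11 * cnj a11 - a21 * cnj a21 = 1"
    unfolding num1 using q1 by simp
  have "(cfst D - a12 * q2) * cnj a12 - (csnd D - a22 * q2) * cnj a22
    = of_real k * (cfst D * cnj (cfst C) - csnd D * cnj (csnd C))
      - of_real k * of_real k * q2 * (cfst C * cnj (cfst C) - csnd C * cnj (csnd C))"
    by (simp add: a12_def a22_def algebra_simps)
  also have "\<dots> = 0"
    unfolding CC DC using k_pos by (simp add: power2_eq_square)
  finally show "a11 * cnj a12 = a21 * cnj a22"
    unfolding a11_def a21_def times_divide_eq_left by simp
  show "cfst C * csnd D - csnd C * cfst D = - (q1 / of_real k) * (a11 * a22 - a12 * a21)"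
  proof -
    have qa: "q1 * a11 = cfst D - a12 * q2" "q1 * a21 = csnd D - a22 * q2"
      using q1 by (simp_all add: a11_def a21_def)
    have "q1 * (a11 * a22 - a12 * a21) = (q1 * a11) * a22 - a12 * (q1 * a21)"
      by (simp add: algebra_simps)
    also have "\<dots> = of_real k * (cfst D * csnd C - cfst C * csnd D)"
      unfolding qa by (simp add: a12_def a22_def algebra_simps)
    finally have "q1 / of_real k * (a11 * a22 - a12 * a21) = cfst D * csnd C - cfst C * csnd D"
      using k_pos by (simp add: field_simps)
    then show ?thesis
      by (simp add: mult.commute)
  qed
qed

subsection \<open>The converse\<close>

theorem helix_surface_of_ode:
  assumes pos: "lam + \<nu>\<^sup>2 > 0" and I: "open_interval I" and J: "open_interval J"
    and sm: "smooth_on J \<xi>1" "smooth_on J \<xi>2" "smooth_on J \<xi>3"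
    and ode: "\<And>y. y \<in> J \<Longrightarrow> helix_ode \<tau> lam \<nu> \<xi>1 \<xi>2 \<xi>3 y"
    and F: "F = (\<lambda>(x, y). Amat \<xi> (\<xi>1 y) (\<xi>2 y) (\<xi>3 y) *v helix_curve \<kappa> \<tau> lam \<nu> x)"
    and imm: "immersion_on (I \<times> J) F"
  shows "\<exists>N. helix_surface \<kappa> \<tau> lam \<nu> (I \<times> J) F N"
proof -
  have oI: "open I" "I \<noteq> {}" and oJ: "open J" "J \<noteq> {}"
    using I J by (auto simp: open_interval_def)
  have oU: "open (I \<times> J)"
    using oI oJ by (simp add: open_Times)
  have lift: "smooth_on (I \<times> J) (\<lambda>p. f (snd p))" if "smooth_on J f" for f :: "real \<Rightarrow> real"
    by (rule smooth_on_compose_real[OF that oU oJ(1) _ smooth_on_snd[OF oU]]) (use oU in auto)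
  have curve: "smooth_on (I \<times> J) (\<lambda>p. wave \<alpha> \<beta> P Q (fst p))"
    by (rule smooth_on_compose_real[OF smooth_on_wave oU open_UNIV subset_UNIV smooth_on_fst[OF oU]]) fact
  have F_eq: "F p = Amat \<xi> (\<xi>1 (snd p)) (\<xi>2 (snd p)) (\<xi>3 (snd p)) *v wave \<alpha> \<beta> P Q (fst p)" for p
    by (simp add: F helix_curve_eq split_beta)
  have smF: "smooth_on (I \<times> J) F"
    by (rule smooth_on_of_complex_coordinates[OF oU]; unfold F_eq cfst_Amat csnd_Amat)
      (intro smooth_on_add[OF oU] smooth_on_mult[OF oU] smooth_on_cnj[OF oU] smooth_on_complex_of_real[OF oU]
        smooth_on_const smooth_on_cosh_compose smooth_on_sinh_compose smooth_on_cis[OF oU] oU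
        smooth_on_bounded_linear[OF bounded_linear_cfst] smooth_on_bounded_linear[OF bounded_linear_csnd]
        lift sm curve)+
  define CC where "CC y = Amat \<xi> (\<xi>1 y) (\<xi>2 y) (\<xi>3 y) *v P" for y
  define DD where "DD y = Amat \<xi> (\<xi>1 y) (\<xi>2 y) (\<xi>3 y) *v Q" for y
  have Fw: "F (x, y) = wave \<alpha> \<beta> (CC y) (DD y) x" for x y
    by (simp add: F_eq Amat_wave CC_def DD_def)
  have rel: "coefficient_relations (CC y) (DD y)" for y
    unfolding CC_def DD_def by (intro coefficient_relations_Amat coefficient_relations_P_Q pos)
  define dF where "dF p = frechet_derivative F (at p)" for p
  have dF: "(F has_derivative dF p) (at p)" if "p \<in> I \<times> J" for p
    unfolding dF_def using smooth_on_has_derivative[OF smF that] .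
  have Fx: "dF (x, y) (1, 0) = \<alpha> *\<^sub>R J1 (F (x, y)) + \<beta> *\<^sub>R wave \<alpha> \<beta> (DD y) (CC y) x"
    if "x \<in> I" "y \<in> J" for x y
  proof -
    have "(wave \<alpha> \<beta> (CC y) (DD y) has_vector_derivative dF (x, y) (1, 0)) (at x)"
      using partial_derivatives(1)[OF dF, of x y] that by (simp add: Fw)
    from vector_derivative_unique_at[OF this wave_has_vector_derivative]
    show ?thesis
      by (simp add: Fw)
  qed
  have tangent: "axis_tangent (F (x, y)) (dF (x, y) (1, 0))" if "x \<in> I" "y \<in> J" for x y
    unfolding Fx[OF that] unfolding Fw by (rule axis_tangent_wave[OF rel])
  have orth: "g0 (dF (x, y) (1, 0) - \<alpha> *\<^sub>R J1 (F (x, y))) (dF (x, y) (0, 1)) = 0"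
    if x: "x \<in> I" and y: "y \<in> J" for x y
  proof -
    have d: "(\<xi>i has_real_derivative vector_derivative \<xi>i (at y)) (at y)" if "smooth_on J \<xi>i" for \<xi>i
      unfolding has_real_derivative_iff_has_vector_derivative using smooth_on_vector_derivative[OF that y] .
    note d' = d[OF sm(1)] d[OF sm(2)] d[OF sm(3)]
    obtain C' where C': "(CC has_vector_derivative C') (at y)"
      unfolding CC_def using Amat_has_vector_derivative[OF d'] by blast
    obtain D' where D': "(DD has_vector_derivative D') (at y)"
      unfolding DD_def using Amat_has_vector_derivative[OF d'] by blast
    have "((\<lambda>y. wave \<alpha> \<beta> (CC y) (DD y) x) has_vector_derivative dF (x, y) (0, 1)) (at y)"
      using partial_derivatives(2)[OF dF, of x y] x y by (simp add: Fw)
    from vector_derivative_unique_at[OF this wave_has_vector_derivative_coeffs[OF C' D']]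
    have "dF (x, y) (0, 1) = wave \<alpha> \<beta> C' D' x" .
    moreover have "g0 (DD y) C' = 0"
      using ode[OF y] helix_ode_iff[OF d' C'[unfolded CC_def]] by (simp add: DD_def)
    ultimately show ?thesis
      using g0_wave_partials[OF oJ(1) y rel C' D'] by (simp add: Fx[OF x y] g0_bilinear)
  qed
  define N where "N p = (1 / \<nu>) *\<^sub>R (E (F p) - dF p (1, 0))" for p
  have smN: "smooth_on (I \<times> J) N"
    unfolding N_def dF_def E_def
    by (intro smooth_on_scaleR oU smooth_on_const smooth_on_diff smF
        smooth_on_bounded_linear[OF bounded_linear_J1] smooth_on_frechet_derivative)
  have main: "F p \<in> ads \<kappa> \<and> N p \<in> ads_tangent (F p) \<and> gtau \<kappa> \<tau> (F p) (N p) (N p) = lam \<and>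
      gtau \<kappa> \<tau> (F p) (N p) (E (F p)) = lam * \<nu> \<and> (\<forall>w. gtau \<kappa> \<tau> (F p) (N p) (dF p w) = 0) \<and>
      (\<forall>v. (\<forall>w. gtau \<kappa> \<tau> (F p) (dF p v) (dF p w) = 0) \<longrightarrow> v = 0)" if p: "p \<in> I \<times> J" for p
  proof -
    obtain x y where xy: "p = (x, y)" "x \<in> I" "y \<in> J"
      using p by auto
    let ?q = "F p" and ?t = "dF p (1, 0)"
    have t: "axis_tangent ?q ?t"
      unfolding xy(1) by (rule tangent[OF xy(2,3)])
    have qq: "g0 (F (x', y')) (F (x', y')) = - 1 / k\<^sup>2" if "x' \<in> I" "y' \<in> J" for x' y'
      using tangent[OF that] by (simp add: axis_tangent_def)
    have split: "dF p w = fst w *\<^sub>R ?t + snd w *\<^sub>R dF p (0, 1)" for w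
      using partial_derivatives(3)[OF dF[OF p, unfolded xy(1)], of "fst w" "snd w"] by (simp add: xy(1))
    have q: "?q \<in> ads \<kappa>"
      using qq[OF xy(2,3)] by (simp add: ads_iff xy(1))
    note n = axis_tangent_normal[OF t, folded N_def]
    have Nw: "gtau \<kappa> \<tau> ?q (N p) (dF p w) = 0" for w
    proof -
      have "gtau \<kappa> \<tau> ?q (N p) (dF p (0, 1)) = 0"
        using orth[OF xy(2,3)] gtau_E_minus[OF t, of "dF p (0, 1)"]
        by (simp add: N_def gtau_scaleR_left xy(1))
      then show ?thesis
        unfolding split[of w] using n(3) by (simp add: gtau_add_right gtau_scaleR_right)
    qed
    \<comment> \<open>A vector in the radical is orthogonal to F_x and to N, hence to E1 = F_x +
      \<nu> N. It is therefore horizontal and null, and the horizontal space is definite.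
      Injectivity of the differential finishes.\<close>
    have nondeg: "v = 0" if v: "\<forall>w. gtau \<kappa> \<tau> ?q (dF p v) (dF p w) = 0" for v
    proof -
      let ?u = "dF p v"
      have "gtau \<kappa> \<tau> ?q ?u (E ?q) = gtau \<kappa> \<tau> ?q ?u (\<nu> *\<^sub>R N p) + gtau \<kappa> \<tau> ?q ?u ?t"
        using \<nu> by (simp add: N_def gtau_diff_right)
      also have "\<dots> = 0"
        using v Nw[of v] by (simp add: gtau_scaleR_right gtau_commute[of _ ?u "N p"])
      finally have uJ: "g0 ?u (J1 ?q) = 0"
        using gtau_E[OF q] k_pos \<tau>_pos by simp
      have "g0 ?t ?q = 0"
        using t by (simp add: axis_tangent_def)
      moreover have "g0 (dF p (0, 1)) ?q = 0"
        using constant_g0_derivative[OF oJ(1) xy(3), of "\<lambda>y. F (x, y)" "\<lambda>y. F (x, y)",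
            OF qq[OF xy(2)] partial_derivatives(2)[OF dF[OF p, unfolded xy(1)]]
            partial_derivatives(2)[OF dF[OF p, unfolded xy(1)]]]
        by (simp add: xy(1) g0_commute)
      ultimately have uq: "g0 ?u ?q = 0"
        unfolding split[of v] by (simp add: g0_bilinear)
      have "g0 ?u ?u = 0"
        using v[rule_format, of v] by (simp add: gtau_eq uJ)
      moreover have "g0 ?q ?q < 0"
        using qq[OF xy(2,3)] k_pos by (simp add: xy(1))
      ultimately have "?u = 0"
        using horizontal_definite(2) uq uJ by blast
      moreover have "dF p 0 = 0"
        using linear_0 has_derivative_linear[OF dF[OF p]] by blast
      ultimately show "v = 0"
        using imm p unfolding immersion_on_def dF_def by (metis injD)
    qed
    show ?thesis
      using q n Nw nondeg by (simp add: ads_tangent_def)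
  qed
  have "helix_surface \<kappa> \<tau> lam \<nu> (I \<times> J) F N"
    unfolding helix_surface_def oriented_surface_def angle_def frame_1
    using oU oI oJ smF smN imm lam main lam_mult unfolding dF_def by auto
  then show ?thesis
    by blast
qed

end

subsection \<open>Helix surfaces in adapted coordinates\<close>

locale adapted_helix = helix_constants +
  fixes \<eta> :: "real \<Rightarrow> real" and I J :: "real set" and F N :: "real \<times> real \<Rightarrow> real^4"
  assumes surface: "helix_surface \<kappa> \<tau> lam \<nu> (I \<times> J) F N"
    and coordinates: "helix_coordinates \<kappa> \<tau> lam \<nu> \<eta> I J F N"
begin

definition "T p = frechet_derivative F (at p) (1, 0)"
definition "Y p = frechet_derivative F (at p) (0, 1)"
definition "phase x y = \<eta> y + \<nu> * (2 * k * \<rho>) * x"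
definition "a x y = - (lam * \<tau> / \<rho>) * sinh (phase x y)"
definition "b x y = cosh (phase x y)"

lemma I: "open_interval I" and J: "open_interval J"
  using coordinates by (auto simp: helix_coordinates_def)

lemma open_I: "open I" and open_J: "open J"
  using I J by (auto simp: open_interval_def)

lemma smooth_F: "smooth_on (I \<times> J) F"
  using surface by (simp add: helix_surface_def oriented_surface_def)

lemma smooth_T: "smooth_on (I \<times> J) T" and smooth_Y: "smooth_on (I \<times> J) Y"
  unfolding T_def Y_def by (intro smooth_on_frechet_derivative smooth_F)+

lemma has_derivative_F: "p \<in> I \<times> J \<Longrightarrow> (F has_derivative frechet_derivative F (at p)) (at p)"
  by (rule smooth_on_has_derivative[OF smooth_F])

lemma F_dx: "x \<in> I \<Longrightarrow> y \<in> J \<Longrightarrow> ((\<lambda>x. F (x, y)) has_vector_derivative T (x, y)) (at x)"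
  and F_dy: "x \<in> I \<Longrightarrow> y \<in> J \<Longrightarrow> ((\<lambda>y. F (x, y)) has_vector_derivative Y (x, y)) (at y)"
  unfolding T_def Y_def using partial_derivatives(1,2)[OF has_derivative_F, of x y] by simp_all

lemma normal:
  assumes "p \<in> I \<times> J"
  shows "F p \<in> ads \<kappa>" "g0 (N p) (F p) = 0" "gtau \<kappa> \<tau> (F p) (N p) (N p) = lam"
    "gtau \<kappa> \<tau> (F p) (N p) (E (F p)) = lam * \<nu>" "gtau \<kappa> \<tau> (F p) (N p) (Y p) = 0"
proof -
  have o: "oriented_surface \<kappa> \<tau> lam (I \<times> J) F N" and ang: "angle \<kappa> \<tau> lam F N p = \<nu>"
    using surface assms unfolding helix_surface_def by blast+
  show "F p \<in> ads \<kappa>" "gtau \<kappa> \<tau> (F p) (N p) (N p) = lam" "gtau \<kappa> \<tau> (F p) (N p) (Y p) = 0"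
    using o assms unfolding oriented_surface_def Y_def by blast+
  have "N p \<in> ads_tangent (F p)"
    using o assms unfolding oriented_surface_def by blast
  then show "g0 (N p) (F p) = 0"
    by (simp add: ads_tangent_def)
  have "lam * (lam * gtau \<kappa> \<tau> (F p) (N p) (E (F p))) = lam * \<nu>"
    using ang unfolding angle_def frame_1 by (rule arg_cong)
  then show "gtau \<kappa> \<tau> (F p) (N p) (E (F p)) = lam * \<nu>"
    by (simp only: lam_mult)
qed

lemma T_eq:
  assumes "p \<in> I \<times> J"
  shows "T p = E (F p) - \<nu> *\<^sub>R N p"
proof -
  have "T p = tangent_E1 \<kappa> \<tau> lam F N p"
    using coordinates assms by (auto simp: helix_coordinates_def Let_def T_def)
  moreover have "angle \<kappa> \<tau> lam F N p = \<nu>"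
    using surface assms by (auto simp: helix_surface_def)
  ultimately show ?thesis
    by (simp only: tangent_E1_def frame_1)
qed

lemma tangent: "p \<in> I \<times> J \<Longrightarrow> axis_tangent (F p) (T p)"
  using normal_axis_tangent[OF normal(1-4)] T_eq by simp

lemma Y_eq:
  assumes "x \<in> I" "y \<in> J"
  shows "Y (x, y) = a x y *\<^sub>R T (x, y) + (b x y / \<nu>) *\<^sub>R (J1 (T (x, y)) + c *\<^sub>R F (x, y))"
proof -
  have p: "(x, y) \<in> I \<times> J"
    using assms by simp
  have t: "tangent_E1 \<kappa> \<tau> lam F N (x, y) = T (x, y)"
    using coordinates assms by (auto simp: helix_coordinates_def Let_def T_def)
  have "Y (x, y) = a x y *\<^sub>R T (x, y) + b x y *\<^sub>R wedge \<kappa> \<tau> (F (x, y)) (N (x, y)) (T (x, y))"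
    using coordinates assms unfolding helix_coordinates_def Let_def t sqrt_\<kappa>B
    by (simp add: Y_def a_def b_def phase_def \<rho>_def t)
  then show ?thesis
    unfolding wedge_axis_tangent[OF normal(1,2,4)[OF p] T_eq[OF p]] by simp
qed

lemma orthogonal_Y:
  assumes p: "p \<in> I \<times> J"
  shows "g0 (T p - \<alpha> *\<^sub>R J1 (F p)) (Y p) = 0"
proof -
  have "gtau \<kappa> \<tau> (F p) (E (F p) - T p) (Y p) = 0"
    using normal(5)[OF p] by (simp add: T_eq[OF p] gtau_scaleR_left)
  then show ?thesis
    by (simp add: gtau_E_minus[OF tangent[OF p]])
qed

lemma T_dx: "x \<in> I \<Longrightarrow> y \<in> J \<Longrightarrow>
    ((\<lambda>x. T (x, y)) has_vector_derivative frechet_derivative T (at (x, y)) (1, 0)) (at x)"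
  and T_dy: "x \<in> I \<Longrightarrow> y \<in> J \<Longrightarrow>
    ((\<lambda>y. T (x, y)) has_vector_derivative frechet_derivative T (at (x, y)) (0, 1)) (at y)"
  using partial_derivatives(1,2)[OF smooth_on_has_derivative[OF smooth_T], of x y] by simp_all

text \<open>By symmetry T_y is the x-derivative of F_y, and in \<open>Y_eq\<close> the dependence of
  \<open>a\<close> and \<open>b\<close> on x is explicit. \<open>Txx\<close> is the x-derivative of
  T.\<close>

lemma T_dy_eq:
  assumes x: "x \<in> I" and y: "y \<in> J"
  defines "Txx \<equiv> frechet_derivative T (at (x, y)) (1, 0)"
  shows "frechet_derivative T (at (x, y)) (0, 1) =
    (- (2 * lam * \<tau> * k * \<nu>) * b x y) *\<^sub>R T (x, y) + a x y *\<^sub>R Txx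
    + (2 * k * \<rho> * sinh (phase x y)) *\<^sub>R (J1 (T (x, y)) + c *\<^sub>R F (x, y))
    + (b x y / \<nu>) *\<^sub>R (J1 Txx + c *\<^sub>R T (x, y))"
proof -
  have eq: "frechet_derivative T (at (x, y)) (0, 1) = frechet_derivative Y (at (x, y)) (1, 0)"
    unfolding T_def[abs_def] Y_def[abs_def] by (rule mixed_partials[OF I J smooth_F x y])
  have d1: "((\<lambda>x. Y (x, y)) has_vector_derivative frechet_derivative Y (at (x, y)) (1, 0)) (at x)"
    using partial_derivatives(1)[OF smooth_on_has_derivative[OF smooth_Y], of x y] x y by simp
  have d2: "((\<lambda>x. Y (x, y)) has_vector_derivative
    (a x y *\<^sub>R Txx + (- (2 * lam * \<tau> * k * \<nu>) * b x y) *\<^sub>R T (x, y))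
    + ((b x y / \<nu>) *\<^sub>R (J1 Txx + c *\<^sub>R T (x, y))
      + (2 * k * \<rho> * sinh (phase x y)) *\<^sub>R (J1 (T (x, y)) + c *\<^sub>R F (x, y)))) (at x)"
  proof (rule has_vector_derivative_transform_within_open[OF _ open_I x])
    have "((\<lambda>x. phase x y) has_real_derivative \<nu> * (2 * k * \<rho>)) (at x)"
      unfolding phase_def by (auto intro!: derivative_eq_intros)
    note ph = this
    have "((\<lambda>x. a x y) has_real_derivative - (lam * \<tau> / \<rho>) * (cosh (phase x y) * (\<nu> * (2 * k * \<rho>)))) (at x)"
      unfolding a_def by (intro DERIV_cmult DERIV_chain2[OF has_field_derivative_sinh[OF DERIV_ident] ph, simplified])
    then have da: "((\<lambda>x. a x y) has_real_derivative - (2 * lam * \<tau> * k * \<nu>) * b x y) (at x)"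
      by (rule DERIV_cong) (use \<rho>_pos in \<open>simp add: b_def\<close>)
    have "((\<lambda>x. b x y) has_real_derivative sinh (phase x y) * (\<nu> * (2 * k * \<rho>))) (at x)"
      unfolding b_def by (rule DERIV_chain2[OF has_field_derivative_cosh[OF DERIV_ident] ph, simplified])
    from DERIV_cdivide[OF this, of \<nu>]
    have db: "((\<lambda>x. b x y / \<nu>) has_real_derivative 2 * k * \<rho> * sinh (phase x y)) (at x)"
      by (rule DERIV_cong) (use \<nu> in simp)
    have dT: "((\<lambda>x. T (x, y)) has_vector_derivative Txx) (at x)"
      unfolding Txx_def by (rule T_dx[OF x y])
    have "((\<lambda>x. J1 (T (x, y)) + c *\<^sub>R F (x, y)) has_vector_derivative J1 Txx + c *\<^sub>R T (x, y)) (at x)"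
      by (intro has_vector_derivative_add bounded_linear.has_vector_derivative[OF bounded_linear_J1] dT
          bounded_linear.has_vector_derivative[OF bounded_linear_scaleR_right] F_dx x y)
    from has_vector_derivative_add[OF has_vector_derivative_scaleR[OF da dT] has_vector_derivative_scaleR[OF db this]]
    show "((\<lambda>x. a x y *\<^sub>R T (x, y) + (b x y / \<nu>) *\<^sub>R (J1 (T (x, y)) + c *\<^sub>R F (x, y))) has_vector_derivative
      (a x y *\<^sub>R Txx + (- (2 * lam * \<tau> * k * \<nu>) * b x y) *\<^sub>R T (x, y))
      + ((b x y / \<nu>) *\<^sub>R (J1 Txx + c *\<^sub>R T (x, y))
        + (2 * k * \<rho> * sinh (phase x y)) *\<^sub>R (J1 (T (x, y)) + c *\<^sub>R F (x, y)))) (at x)" .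
  qed (use Y_eq y in simp)
  show ?thesis
    unfolding eq vector_derivative_unique_at[OF d1 d2] by (simp only: add_ac)
qed

lemma g0_F_F: "p \<in> I \<times> J \<Longrightarrow> g0 (F p) (F p) = - 1 / k\<^sup>2"
  and g0_T_F: "p \<in> I \<times> J \<Longrightarrow> g0 (T p) (F p) = 0"
  and g0_T_J1_F: "p \<in> I \<times> J \<Longrightarrow> g0 (T p) (J1 (F p)) = - c / k\<^sup>2"
  using tangent[of p] by (simp_all add: axis_tangent_def)

lemma g0_T_T: "p \<in> I \<times> J \<Longrightarrow> g0 (T p) (T p) = - (\<alpha> * c) / k\<^sup>2"
proof -
  assume "p \<in> I \<times> J"
  then have "g0 (T p) (T p) = - (lam + \<nu>\<^sup>2) * \<rho>\<^sup>2 / \<tau>\<^sup>2"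
    using tangent[of p] unfolding axis_tangent_def by blast
  also have "\<dots> = - ((lam + \<nu>\<^sup>2) * \<rho>\<^sup>2 / \<tau>\<^sup>2)"
    by (simp only: mult_minus_left minus_divide_left)
  finally show ?thesis
    unfolding \<alpha>_times_c using k_pos by simp
qed

text \<open>The square of \<open>h\<close> is \<nu>^2 (lam + \<nu>^2), nonnegative by definiteness.
  If it were zero, both \<open>h\<close> and \<open>c\<close> would vanish, hence F_x too, and F
  would not be an immersion.\<close>

lemma horizontal_part:
  assumes p: "p \<in> I \<times> J"
  defines "h \<equiv> T p - c *\<^sub>R J1 (F p)"
  shows "g0 h (F p) = 0" "g0 h (J1 (F p)) = 0" "h \<noteq> 0" "lam + \<nu>\<^sup>2 > 0"
proof -
  show hF: "g0 h (F p) = 0" and hJ: "g0 h (J1 (F p)) = 0"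
    unfolding h_def by (simp_all add: g0_bilinear g0_T_F[OF p] g0_T_J1_F[OF p] g0_J1_self g0_J1_J1 g0_F_F[OF p])
  have neg: "g0 (F p) (F p) < 0"
    using k_pos by (simp add: g0_F_F[OF p])
  have "g0 h h = c * (c - \<alpha>) / k\<^sup>2"
  proof -
    have "g0 h h = g0 h (T p)"
      using hJ by (simp add: h_def[of] g0_bilinear)
    also have "\<dots> = c * (c - \<alpha>) / k\<^sup>2"
      unfolding h_def by (simp add: g0_bilinear g0_T_T[OF p] g0_commute[of "J1 (F p)"] g0_T_J1_F[OF p]
          diff_divide_distrib algebra_simps)
    finally show ?thesis .
  qed
  also have "\<dots> = \<nu>\<^sup>2 * (lam + \<nu>\<^sup>2)"
  proof -
    have "c * (c - \<alpha>) = k\<^sup>2 * (\<nu>\<^sup>2 * (lam + \<nu>\<^sup>2))"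
      using \<tau>_pos by (simp add: \<alpha>_minus_c) (simp add: c_def power2_eq_square lam_mult)
    then show ?thesis
      using k_pos by simp
  qed
  finally have hh: "g0 h h = \<nu>\<^sup>2 * (lam + \<nu>\<^sup>2)" .
  have "lam + \<nu>\<^sup>2 \<noteq> 0"
  proof
    assume 0: "lam + \<nu>\<^sup>2 = 0"
    then have "h = 0"
      using horizontal_definite(2)[OF neg hF hJ] hh by simp
    moreover have "c = 0"
      using 0 by (simp add: c_def)
    ultimately have "frechet_derivative F (at p) (1, 0) = 0"
      by (simp add: h_def T_def)
    moreover have "frechet_derivative F (at p) 0 = 0"
      using linear_0 has_derivative_linear[OF has_derivative_F[OF p]] by blast
    moreover have "inj (frechet_derivative F (at p))"
      using surface p by (auto simp: helix_surface_def oriented_surface_def immersion_on_def)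
    ultimately have "(1::real, 0::real) = 0"
      by (metis injD)
    then show False
      by (simp add: zero_prod_def)
  qed
  moreover have "0 \<le> \<nu>\<^sup>2 * (lam + \<nu>\<^sup>2)"
    using horizontal_definite(1)[OF neg hF hJ] hh by simp
  ultimately show "lam + \<nu>\<^sup>2 > 0"
    using \<nu> by (simp add: zero_le_mult_iff)
  then have "g0 h h \<noteq> 0"
    using hh \<nu> by simp
  then show "h \<noteq> 0"
    by (auto simp: g0_def)
qed

text \<open>Differentiating the equations of \<^term>\<open>axis_tangent\<close> in \<open>x\<close> determines \<open>T\<^sub>x\<close> up to one
  real function, and the derivative of \<open>g0 T T\<close> in \<open>y\<close> determines that function.\<close>

lemma T_dx_eq:
  assumes x: "x \<in> I" and y: "y \<in> J"
  shows "frechet_derivative T (at (x, y)) (1, 0)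
    = (\<alpha>\<^sup>2 + \<beta>\<^sup>2) *\<^sub>R F (x, y) + (2 * \<alpha>) *\<^sub>R J1 (T (x, y))"
proof -
  let ?p = "(x, y)"
  have p: "?p \<in> I \<times> J"
    using x y by simp
  let ?F = "F ?p" and ?T = "T ?p"
  define Txx where "Txx = frechet_derivative T (at ?p) (1, 0)"
  have dT: "((\<lambda>x. T (x, y)) has_vector_derivative Txx) (at x)"
    unfolding Txx_def by (rule T_dx[OF x y])
  have pI: "(x', y) \<in> I \<times> J" if "x' \<in> I" for x'
    using that y by simp
  have pJ: "(x, y') \<in> I \<times> J" if "y' \<in> J" for y'
    using that x by simp
  note dF = F_dx[OF x y]
  have 1: "g0 Txx ?F = \<alpha> * c / k\<^sup>2"
    using constant_g0_derivative[OF open_I x g0_T_F[OF pI] dT dF] g0_T_T[OF p] by simp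
  have 2: "g0 Txx (J1 ?F) = 0"
    using constant_g0_derivative[OF open_I x g0_T_J1_F[OF pI] dT
        bounded_linear.has_vector_derivative[OF bounded_linear_J1 dF]] by (simp add: g0_J1_self)
  have 3: "g0 Txx ?T = 0"
    using constant_g0_derivative[OF open_I x g0_T_T[OF pI] dT dT] by (simp add: g0_commute)
  have "g0 (J1 ?T) ?F = c / k\<^sup>2"
    using g0_T_J1_F[OF p] by (simp add: g0_J1_left)
  moreover have "g0 (J1 ?T) (J1 ?F) = 0"
    using g0_T_F[OF p] by (simp add: g0_J1_J1)
  ultimately have JT: "g0 (J1 ?T) ?F = c / k\<^sup>2" "g0 (J1 ?T) (J1 ?F) = 0" .
  \<comment> \<open>The fourth product comes from the y-derivative of the constant
    \<open>g0 T T\<close>. In it every term containing T_x survives only through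
    \<open>g0 (J1 Txx) T\<close>, and the common factor \<open>b\<close>, a value of cosh,
    cancels.\<close>
  have 4: "g0 Txx (J1 ?T) = (2 * lam * \<tau> * k * \<nu>\<^sup>2 - c) * (\<alpha> * c / k\<^sup>2)"
  proof -
    have "g0 (frechet_derivative T (at ?p) (0, 1)) ?T = 0"
      using constant_g0_derivative[OF open_J y g0_T_T[OF pJ] T_dy[OF x y] T_dy[OF x y]]
      by (simp add: g0_commute)
    then have "- (2 * lam * \<tau> * k * \<nu>) * b x y * g0 ?T ?T + (b x y / \<nu>) * (g0 (J1 Txx) ?T + c * g0 ?T ?T) = 0"
      unfolding T_dy_eq[OF x y] Txx_def[symmetric]
      by (simp add: g0_bilinear 3 g0_J1_self g0_commute[of ?F] g0_T_F[OF p])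
    then have "b x y * (g0 (J1 Txx) ?T + c * g0 ?T ?T - 2 * lam * \<tau> * k * \<nu>\<^sup>2 * g0 ?T ?T) = 0"
      using \<nu> by (simp add: field_simps power2_eq_square)
    then have "g0 (J1 Txx) ?T + c * g0 ?T ?T - 2 * lam * \<tau> * k * \<nu>\<^sup>2 * g0 ?T ?T = 0"
      using cosh_real_pos[of "phase x y"] by (simp add: b_def)
    then show ?thesis
      by (simp add: g0_J1_left g0_T_T[OF p] algebra_simps)
  qed
  \<comment> \<open>The defect of the claimed equation. It is horizontal and orthogonal to T and J1
    T, hence to the complex line of \<open>h\<close>, which is the whole horizontal space.\<close>
  define V where "V = Txx - (\<alpha> * c) *\<^sub>R ?F - (2 * \<alpha>) *\<^sub>R J1 ?T"
  have VF: "g0 V ?F = 0" and VJF: "g0 V (J1 ?F) = 0"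
    using k_pos by (simp_all add: V_def g0_bilinear 1 2 JT g0_F_F[OF p] g0_J1_self)
  have VT: "g0 V ?T = 0"
    by (simp add: V_def g0_bilinear 3 g0_commute[of ?F] g0_T_F[OF p] g0_J1_self)
  have VJT: "g0 V (J1 ?T) = 0"
  proof -
    have e: "2 * lam * \<tau> * k * \<nu>\<^sup>2 - c = c - 2 * \<alpha>"
      by (simp add: \<alpha>_minus_c)
    show ?thesis
      unfolding V_def g0_bilinear 4 e g0_J1_J1 g0_commute[of ?F] JT g0_T_T[OF p]
      by (simp add: algebra_simps diff_divide_distrib)
  qed
  have "V = 0"
  proof (rule horizontal_orthogonal_eq_0[OF _ horizontal_part(1-3)[OF p] VF VJF])
    show "g0 ?F ?F < 0"
      using k_pos by (simp add: g0_F_F[OF p])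
    show "g0 V (?T - c *\<^sub>R J1 ?F) = 0" "g0 V (J1 (?T - c *\<^sub>R J1 ?F)) = 0"
      by (simp_all add: J1_linear J1_J1 g0_bilinear VT VJT VF VJF)
  qed
  then show ?thesis
    by (simp add: V_def Txx_def \<alpha>_\<beta>_sq algebra_simps)
qed

section \<open>The wave coefficients as functions of \<open>y\<close>\<close>

definition "x0 = (SOME x. x \<in> I)"
definition "G p = (1 / \<beta>) *\<^sub>R (T p - \<alpha> *\<^sub>R J1 (F p))"
text \<open>The coefficients of \<open>wave_ode_unique\<close>, evaluated on the slice x = x0; in
  this form their smoothness in y is inherited from F and T.\<close>

definition "CC y = rot (- \<alpha> * x0) (cosh (\<beta> * x0) *\<^sub>R F (x0, y) - sinh (\<beta> * x0) *\<^sub>R G (x0, y))"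
definition "DD y = rot (- \<alpha> * x0) (cosh (\<beta> * x0) *\<^sub>R G (x0, y) - sinh (\<beta> * x0) *\<^sub>R F (x0, y))"
definition "CC' y = vector_derivative CC (at y)"
definition "DD' y = vector_derivative DD (at y)"

lemma x0: "x0 \<in> I"
proof -
  have "\<exists>x. x \<in> I"
    using I unfolding open_interval_def by blast
  then show ?thesis
    unfolding x0_def by (rule someI_ex)
qed

lemma T_eq_G: "T p = \<alpha> *\<^sub>R J1 (F p) + \<beta> *\<^sub>R G p"
  using \<beta>_pos by (simp add: G_def)

lemma F_eq_wave:
  assumes x: "x \<in> I" and y: "y \<in> J"
  shows "F (x, y) = wave \<alpha> \<beta> (CC y) (DD y) x"
  unfolding CC_def DD_def G_def
proof (rule wave_ode_unique[OF I _ _ _ x0 x, where F = "\<lambda>x. F (x, y)" and F' = "\<lambda>x. T (x, y)"])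
  show "\<beta> \<noteq> 0"
    using \<beta>_pos by simp
  show "((\<lambda>x. F (x, y)) has_vector_derivative T (x, y)) (at x)" if "x \<in> I" for x
    by (rule F_dx[OF that y])
  show "((\<lambda>x. T (x, y)) has_vector_derivative
      (\<alpha>\<^sup>2 + \<beta>\<^sup>2) *\<^sub>R F (x, y) + (2 * \<alpha>) *\<^sub>R J1 (T (x, y))) (at x)" if "x \<in> I" for x
    using T_dx[OF that y] unfolding T_dx_eq[OF that y] .
qed

lemma G_eq_wave:
  assumes x: "x \<in> I" and y: "y \<in> J"
  shows "G (x, y) = wave \<alpha> \<beta> (DD y) (CC y) x"
proof -
  have "((\<lambda>x. F (x, y)) has_vector_derivative
      \<alpha> *\<^sub>R J1 (wave \<alpha> \<beta> (CC y) (DD y) x) + \<beta> *\<^sub>R wave \<alpha> \<beta> (DD y) (CC y) x) (at x)"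
    by (rule has_vector_derivative_transform_within_open[OF wave_has_vector_derivative open_I x])
      (simp add: F_eq_wave y)
  from vector_derivative_unique_at[OF F_dx[OF x y] this]
  have "\<beta> *\<^sub>R G (x, y) = \<beta> *\<^sub>R wave \<alpha> \<beta> (DD y) (CC y) x"
    unfolding T_eq_G F_eq_wave[OF x y] by simp
  then show ?thesis
    using \<beta>_pos by simp
qed

lemma CC_DD_relations:
  assumes y: "y \<in> J"
  shows "coefficient_relations (CC y) (DD y)"
proof -
  have "axis_tangent (F (x0, y)) (\<alpha> *\<^sub>R J1 (F (x0, y)) + \<beta> *\<^sub>R G (x0, y))"
    unfolding T_eq_G[symmetric] using tangent x0 y by simp
  then show ?thesis
    unfolding axis_tangent_iff_relations F_eq_wave[OF x0 y] G_eq_wave[OF x0 y] coefficient_relations_wave .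
qed

lemma smooth_CC: "smooth_on J CC" and smooth_DD: "smooth_on J DD"
proof -
  have F: "smooth_on J (\<lambda>y. F (x0, y))" and T: "smooth_on J (\<lambda>y. T (x0, y))"
    by (rule smooth_on_Pair_left[OF open_J x0 smooth_F] smooth_on_Pair_left[OF open_J x0 smooth_T])+
  note l = smooth_on_bounded_linear[OF bounded_linear_scaleR_right open_J]
    smooth_on_bounded_linear[OF bounded_linear_J1 open_J]
  have G: "smooth_on J (\<lambda>y. G (x0, y))"
    unfolding G_def by (intro l smooth_on_diff[OF open_J] F T)
  show "smooth_on J CC" "smooth_on J DD"
    unfolding CC_def[abs_def] DD_def[abs_def] rot_def
    by (intro l smooth_on_diff[OF open_J] smooth_on_add[OF open_J] F G)+
qed

lemma CC_dy: "y \<in> J \<Longrightarrow> (CC has_vector_derivative CC' y) (at y)"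
  and DD_dy: "y \<in> J \<Longrightarrow> (DD has_vector_derivative DD' y) (at y)"
  unfolding CC'_def DD'_def
  by (rule smooth_on_vector_derivative[OF smooth_CC] smooth_on_vector_derivative[OF smooth_DD], assumption)+

lemma Y_eq_wave:
  assumes x: "x \<in> I" and y: "y \<in> J"
  shows "Y (x, y) = wave \<alpha> \<beta> (CC' y) (DD' y) x"
proof -
  have "((\<lambda>y. F (x, y)) has_vector_derivative wave \<alpha> \<beta> (CC' y) (DD' y) x) (at y)"
    by (rule has_vector_derivative_transform_within_open[OF
          wave_has_vector_derivative_coeffs[OF CC_dy[OF y] DD_dy[OF y]] open_J y])
      (simp add: F_eq_wave x)
  from vector_derivative_unique_at[OF F_dy[OF x y] this] show ?thesis .
qed

lemma g0_DD_CC':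
  assumes y: "y \<in> J"
  shows "g0 (DD y) (CC' y) = 0"
proof -
  have "g0 (\<beta> *\<^sub>R G (x0, y)) (Y (x0, y)) = 0"
    using orthogonal_Y[of "(x0, y)"] x0 y by (simp add: T_eq_G)
  then have "g0 (G (x0, y)) (Y (x0, y)) = 0"
    using \<beta>_pos by (simp add: g0_bilinear)
  then show ?thesis
    unfolding G_eq_wave[OF x0 y] Y_eq_wave[OF x0 y]
    using g0_wave_partials[OF open_J y CC_DD_relations CC_dy[OF y] DD_dy[OF y], of x0] by simp
qed

text \<open>\<open>F\<close> and \<open>T\<close> depend on \<open>y\<close> through a complex linear differential equation, whose trace
  vanishes.\<close>

lemma det2_F_T_constant:
  assumes x: "x \<in> I" and y: "y \<in> J"
  shows "((\<lambda>y. det2 (F (x, y)) (T (x, y))) has_vector_derivative 0) (at y)"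
proof -
  let ?F = "F (x, y)" and ?T = "T (x, y)" and ?d = "det2 (F (x, y)) (T (x, y))"
  have anti: "det2 ?T ?F = - ?d"
    by (simp add: det2_def)
  \<comment> \<open>The trace of the flow, split into real and imaginary part. The real part
    vanishes because c - \<alpha> = lam k \<tau> \<nu>^2, the imaginary part because \<alpha> a = -
    k \<rho> sinh (phase).\<close>
  have "det2 (Y (x, y)) ?T + det2 ?F (frechet_derivative T (at (x, y)) (0, 1))
    = of_real (b x y * (2 * (c - \<alpha>) / \<nu> - 2 * lam * \<tau> * k * \<nu>)) * ?d
      + \<i> * of_real (2 * (\<alpha> * a x y + k * \<rho> * sinh (phase x y))) * ?d"
    unfolding Y_eq[OF x y] T_dy_eq[OF x y] T_dx_eq[OF x y] J1_linear det2_simps anti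
    by (simp add: algebra_simps diff_divide_distrib add_divide_distrib)
  also have "2 * (c - \<alpha>) / \<nu> - 2 * lam * \<tau> * k * \<nu> = 0"
    using \<nu> by (simp add: \<alpha>_minus_c power2_eq_square)
  also have "\<alpha> * a x y + k * \<rho> * sinh (phase x y) = 0"
    using \<tau>_pos \<rho>_pos by (simp add: \<alpha>_def a_def power2_eq_square lam_mult)
  finally have "det2 (Y (x, y)) ?T + det2 ?F (frechet_derivative T (at (x, y)) (0, 1)) = 0"
    by simp
  then show ?thesis
    using has_vector_derivative_det2[OF F_dy[OF x y] T_dy[OF x y]] by simp
qed

lemma det2_CC_DD_constant: "\<exists>z. \<forall>y\<in>J. det2 (CC y) (DD y) = z"
proof -
  have "convex J"
    using J by (simp add: open_interval_def is_interval_convex)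
  moreover have "((\<lambda>y. det2 (F (x0, y)) (T (x0, y))) has_vector_derivative 0) (at y within J)" if "y \<in> J" for y
    by (rule has_vector_derivative_at_within[OF det2_F_T_constant[OF x0 that]])
  ultimately obtain z where z: "\<And>y. y \<in> J \<Longrightarrow> det2 (F (x0, y)) (T (x0, y)) = z"
    by (rule has_vector_derivative_zero_constant) (assumption, rule that)
  have "det2 (CC y) (DD y) = z / (of_real \<beta> * (cis (\<alpha> * x0) * cis (\<alpha> * x0)))" if y: "y \<in> J" for y
  proof -
    have "z = of_real \<beta> * det2 (F (x0, y)) (G (x0, y))"
      using z[OF y] by (simp add: T_eq_G det2_simps)
    also have "\<dots> = of_real \<beta> * (cis (\<alpha> * x0) * cis (\<alpha> * x0)) * det2 (CC y) (DD y)"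
      unfolding F_eq_wave[OF x0 y] G_eq_wave[OF x0 y] det2_wave by simp
    finally show ?thesis
      using \<beta>_pos by (simp add: field_simps)
  qed
  then show ?thesis
    by blast
qed

lemma cfst_wave: "cfst (wave \<alpha> \<beta> C D x) =
    cis (\<alpha> * x) * (of_real (cosh (\<beta> * x)) * cfst C + of_real (sinh (\<beta> * x)) * cfst D)"
  by (simp add: wave_def cfst_rot scaleR_conv_of_real[where 'a=complex])

text \<open>If C and C' both vanished in the first coordinate, then F, T and F_y would all have
  first coordinates proportional to that of D or D'. The imaginary part of the equation for F_y,
  divided by D, would read k \<rho> cosh(\<eta> + \<omega> x) = z sinh(\<omega> x) on
  \<open>I\<close>, contradicting the independence of cosh and sinh.\<close>

lemma cfst_CC_simple_zero:
  assumes y: "y \<in> J" and D: "cfst (DD y) \<noteq> 0" and C: "cfst (CC y) = 0"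
  shows "cfst (CC' y) \<noteq> 0"
proof
  assume C': "cfst (CC' y) = 0"
  define w where "w = cfst (DD' y) / cfst (DD y)"
  define z where "z = Im w"
  define \<omega> where "\<omega> = \<nu> * k * \<rho>"
  have eq: "cosh (\<omega> * x) *\<^sub>R (k * \<rho> * cosh (\<eta> y)) + sinh (\<omega> * x) *\<^sub>R (k * \<rho> * sinh (\<eta> y) - z) = 0"
    if x: "x \<in> I" for x
  proof -
    let ?ch = "cosh (\<beta> * x)" and ?sh = "sinh (\<beta> * x)" and ?D = "cfst (DD y)" and ?D' = "cfst (DD' y)"
      and ?e = "cis (\<alpha> * x)"
    have F: "cfst (F (x, y)) = ?e * (of_real ?sh * ?D)"
      by (simp add: F_eq_wave x y cfst_wave C)
    have T: "cfst (T (x, y)) = ?e * (\<i> * of_real \<alpha> * of_real ?sh * ?D + of_real \<beta> * of_real ?ch * ?D)"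
      unfolding T_eq_G G_eq_wave[OF x y] using F
      by (simp add: cfst_wave C scaleR_conv_of_real[where 'a=complex] algebra_simps)
    have "cfst (Y (x, y)) = ?e * (of_real ?sh * ?D')"
      by (simp add: Y_eq_wave x y cfst_wave C')
    moreover have "cfst (Y (x, y)) = of_real (a x y) * cfst (T (x, y))
        + of_real (b x y / \<nu>) * (\<i> * cfst (T (x, y)) + of_real c * cfst (F (x, y)))"
      by (simp add: Y_eq[OF x y] scaleR_conv_of_real[where 'a=complex])
    ultimately have "?e * (of_real ?sh * ?D') = ?e * (?D * (of_real (a x y) * (\<i> * of_real \<alpha> * of_real ?sh + of_real \<beta> * of_real ?ch)
        + of_real (b x y / \<nu>) * (\<i> * (\<i> * of_real \<alpha> * of_real ?sh + of_real \<beta> * of_real ?ch) + of_real c * of_real ?sh)))"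
      unfolding F T by (simp add: algebra_simps)
    then have "of_real ?sh * ?D' = ?D * (of_real (a x y) * (\<i> * of_real \<alpha> * of_real ?sh + of_real \<beta> * of_real ?ch)
        + of_real (b x y / \<nu>) * (\<i> * (\<i> * of_real \<alpha> * of_real ?sh + of_real \<beta> * of_real ?ch) + of_real c * of_real ?sh))"
      by simp
    then have "of_real ?sh * (?D' / ?D) = of_real (a x y) * (\<i> * of_real \<alpha> * of_real ?sh + of_real \<beta> * of_real ?ch)
        + of_real (b x y / \<nu>) * (\<i> * (\<i> * of_real \<alpha> * of_real ?sh + of_real \<beta> * of_real ?ch) + of_real c * of_real ?sh)"
      using D by (simp add: divide_eq_eq mult.commute)
    from arg_cong[OF this[folded w_def], of Im]
    have im: "?sh * z = a x y * (\<alpha> * ?sh) + (b x y / \<nu>) * (\<beta> * ?ch)"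
      unfolding z_def by simp
    \<comment> \<open>The sign of \<nu>. It reconciles \<beta>, which contains |\<nu>|, with the
      phase, which contains \<nu>.\<close>
    define \<sigma> where "\<sigma> = \<bar>\<nu>\<bar> / \<nu>"
    have \<sigma>: "\<sigma> = 1 \<or> \<sigma> = - 1"
      using \<nu> by (auto simp: \<sigma>_def abs_if)
    have \<beta>: "\<beta> = \<sigma> * \<omega>"
      using \<nu> by (auto simp: \<beta>_def \<omega>_def \<sigma>_def)
    have chsh: "?ch = cosh (\<omega> * x)" "?sh = \<sigma> * sinh (\<omega> * x)"
      using \<sigma> unfolding \<beta> by auto
    have ph: "phase x y = \<eta> y + \<omega> * x + \<omega> * x"
      by (simp add: phase_def \<omega>_def)
    have aa: "a x y * \<alpha> = - (k * \<rho>) * sinh (phase x y)"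
      using \<tau>_pos \<rho>_pos by (simp add: \<alpha>_def a_def power2_eq_square lam_mult)
    have bb: "b x y / \<nu> * \<beta> = \<sigma> * (k * \<rho>) * cosh (phase x y)"
      by (simp add: b_def \<beta>_def \<sigma>_def)
    have "\<sigma> * (sinh (\<omega> * x) * z) = \<sigma> * (k * \<rho> * (cosh (phase x y) * cosh (\<omega> * x) - sinh (phase x y) * sinh (\<omega> * x)))"
      using im unfolding mult.assoc[symmetric] aa bb chsh by (simp add: algebra_simps)
    then have "sinh (\<omega> * x) * z = k * \<rho> * (cosh (phase x y) * cosh (\<omega> * x) - sinh (phase x y) * sinh (\<omega> * x))"
      using \<sigma> by auto
    \<comment> \<open>The phase is \<eta> y + 2 \<omega> x, so the subtraction formula leaves \<eta>
      y + \<omega> x, which expands into cosh(\<omega> x) and sinh(\<omega> x) with coefficients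
      free of x.\<close>
    also have "cosh (phase x y) * cosh (\<omega> * x) - sinh (phase x y) * sinh (\<omega> * x) = cosh (\<eta> y + \<omega> * x)"
      unfolding cosh_diff[symmetric] ph by simp
    finally show ?thesis
      by (simp add: cosh_add algebra_simps)
  qed
  have "\<omega> \<noteq> 0"
    using \<nu> k_pos \<rho>_pos by (simp add: \<omega>_def)
  from cosh_sinh_independent[OF open_I x0 this eq]
  show False
    using k_pos \<rho>_pos by (simp add: less_imp_neq[symmetric])
qed

theorem adapted_helix_representation:
  "\<exists>\<xi> \<xi>1 \<xi>2 \<xi>3. smooth_on J \<xi>1 \<and> smooth_on J \<xi>2 \<and> smooth_on J \<xi>3 \<and>
     (\<forall>y\<in>J. helix_ode \<tau> lam \<nu> \<xi>1 \<xi>2 \<xi>3 y) \<and>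
     (\<forall>x\<in>I. \<forall>y\<in>J. F (x, y) = Amat \<xi> (\<xi>1 y) (\<xi>2 y) (\<xi>3 y) *v helix_curve \<kappa> \<tau> lam \<nu> x)"
proof -
  obtain y0 where y0: "y0 \<in> J"
    using J by (auto simp: open_interval_def)
  have pos: "lam + \<nu>\<^sup>2 > 0"
    using horizontal_part(4)[of "(x0, y0)"] x0 y0 by simp
  define q1 where "q1 = complex_of_real (s / (k * \<rho>))"
  define q2 where "q2 = \<i> * complex_of_real (lam * \<tau> * \<bar>\<nu>\<bar> / (k * \<rho>))"
  define a12 where "a12 y = of_real k * cfst (CC y)" for y
  define a22 where "a22 y = of_real k * csnd (CC y)" for y
  define a11 where "a11 y = (cfst (DD y) - a12 y * q2) / q1" for y
  define a21 where "a21 y = (csnd (DD y) - a22 y * q2) / q1" for y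
  define \<Delta> where "\<Delta> y = a11 y * a22 y - a12 y * a21 y" for y
  note rel = coefficient_relations_unitary[OF pos CC_DD_relations,
      folded q1_def q2_def, folded a12_def a22_def, folded a11_def a21_def]
  note uni = unitary_completion[OF rel(1-3), folded \<Delta>_def]
  have q1: "q1 \<noteq> 0"
    using rel(5) y0 by blast
  obtain z where z: "\<And>y. y \<in> J \<Longrightarrow> det2 (CC y) (DD y) = z"
    using det2_CC_DD_constant by blast
  have \<Delta>: "\<Delta> y = \<Delta> y0" if "y \<in> J" for y
  proof -
    have "- (q1 / of_real k) * \<Delta> y = - (q1 / of_real k) * \<Delta> y0"
      using rel(4)[OF that] rel(4)[OF y0] z[OF that] z[OF y0] unfolding \<Delta>_def det2_def by simp
    then show ?thesis
      using q1 k_pos by simp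
  qed
  \<comment> \<open>The determinant of the matrix family is -i cis \<xi>, and it has to equal the
    constant \<Delta>.\<close>
  define \<xi> where "\<xi> = Arg (\<i> * \<Delta> y0)"
  have \<xi>: "\<Delta> y = - \<i> * cis \<xi>" if "y \<in> J" for y
  proof -
    have "complex_of_real ((cmod (\<Delta> y0))\<^sup>2) = of_real 1"
      using uni(3)[OF y0 y0 y0] by (simp add: complex_norm_square[symmetric])
    then have "(cmod (\<Delta> y0))\<^sup>2 = 1\<^sup>2"
      by (simp only: of_real_eq_iff one_power2)
    then have "cmod (\<Delta> y0) = 1"
      by (rule power2_eq_imp_eq) simp_all
    then have "cmod (\<i> * \<Delta> y0) = 1"
      by (simp add: norm_mult)
    moreover from this have "\<i> * \<Delta> y0 \<noteq> 0"
      by auto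
    ultimately have "cis \<xi> = \<i> * \<Delta> y0"
      unfolding \<xi>_def using cis_Arg[of "\<i> * \<Delta> y0"] by (simp only: sgn_div_norm) simp
    then show ?thesis
      using \<Delta>[OF that] by simp
  qed
  have smooth: "smooth_on J a12" "smooth_on J a11"
    unfolding a11_def[abs_def] a12_def[abs_def] divide_inverse diff_conv_add_uminus
    by (intro smooth_on_mult[OF open_J] smooth_on_add[OF open_J] smooth_on_minus[OF open_J] smooth_on_const
        smooth_on_bounded_linear[OF bounded_linear_cfst open_J] smooth_CC smooth_DD)+
  \<comment> \<open>Consequently \<open>a11\<close> has no zeros and its phase lifts directly,
    whereas \<open>a12\<close> may vanish and needs \<open>smooth_polar\<close>.\<close>
  have abs11: "(cmod (a11 y))\<^sup>2 = 1 + (cmod (a12 y))\<^sup>2" if y: "y \<in> J" for y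
  proof -
    have "a11 y * cnj (a11 y) = 1 + (\<Delta> y * cnj (\<Delta> y)) * (a12 y * cnj (a12 y))"
      using rel(1)[OF y] uni(2)[OF y y y] by (simp add: algebra_simps)
    then have "a11 y * cnj (a11 y) = 1 + a12 y * cnj (a12 y)"
      unfolding uni(3)[OF y y y] by simp
    then have "complex_of_real ((cmod (a11 y))\<^sup>2) = of_real (1 + (cmod (a12 y))\<^sup>2)"
      unfolding complex_norm_square[symmetric] by simp
    then show ?thesis
      by (simp only: of_real_eq_iff)
  qed
  \<comment> \<open>Where \<open>a12\<close> vanishes, \<open>a11\<close> has modulus 1 and is the
    first coordinate of D divided by q1, so that coordinate is nonzero and the simple zero criterion
    applies.\<close>
  have "\<not> (a12 has_vector_derivative 0) (at y)" if y: "y \<in> J" and 0: "a12 y = 0" for y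
  proof
    assume "(a12 has_vector_derivative 0) (at y)"
    moreover have "(a12 has_vector_derivative of_real k * cfst (CC' y)) (at y)"
      unfolding a12_def[abs_def]
      by (intro has_vector_derivative_mult_right bounded_linear.has_vector_derivative[OF bounded_linear_cfst]
          CC_dy y)
    ultimately have "of_real k * cfst (CC' y) = 0"
      using vector_derivative_unique_at by metis
    moreover have "cfst (DD y) \<noteq> 0"
      using abs11[OF y] 0 by (auto simp: a11_def)
    moreover have "cfst (CC y) = 0"
      using 0 k_pos by (simp add: a12_def)
    ultimately show False
      using cfst_CC_simple_zero[OF y] k_pos by simp
  qed
  then obtain r \<xi>3 where r: "smooth_on J r" "smooth_on J \<xi>3" "\<And>y. y \<in> J \<Longrightarrow> a12 y = of_real (r y) * cis (\<xi>3 y)"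
    by (rule smooth_polar[OF J smooth(1)]) (assumption, assumption, rule that)
  \<comment> \<open>As sinh is onto the real line, arsinh also takes the negative values of
    \<open>r\<close>, so its sign changes are absorbed in \<xi>1.\<close>
  define \<xi>1 where "\<xi>1 y = arsinh (r y)" for y
  have sm1: "smooth_on J \<xi>1"
    unfolding \<xi>1_def by (intro smooth_on_arsinh_compose open_J r)
  have sinh1: "sinh (\<xi>1 y) = r y" for y
    by (simp add: \<xi>1_def)
  have cosh1: "cmod (a11 y) = cosh (\<xi>1 y)" if y: "y \<in> J" for y
  proof -
    have "(cmod (a11 y))\<^sup>2 = (cosh (\<xi>1 y))\<^sup>2"
      using abs11[OF y] r(3)[OF y] by (simp add: norm_mult cosh_square_eq sinh1)
    then show ?thesis
      by (rule power2_eq_imp_eq) simp_all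
  qed
  have "smooth_on J (\<lambda>y. a11 y * of_real (inverse (cosh (\<xi>1 y))))"
    by (intro smooth_on_mult[OF open_J] smooth_on_complex_of_real[OF open_J] smooth_on_inverse[OF open_J]
        smooth smooth_on_cosh_compose open_J sm1) simp
  moreover have "cmod (a11 y * of_real (inverse (cosh (\<xi>1 y)))) = 1" if "y \<in> J" for y
    using cosh1[OF that] cosh_real_pos[of "\<xi>1 y"] by (simp add: norm_mult norm_inverse)
  ultimately obtain \<xi>2 where \<xi>2: "smooth_on J \<xi>2"
    "\<And>y. y \<in> J \<Longrightarrow> a11 y * of_real (inverse (cosh (\<xi>1 y))) = cis (\<xi>2 y)"
    by (rule smooth_unit_lift[OF J]) (assumption, rule that)
  have a11: "a11 y = of_real (cosh (\<xi>1 y)) * cis (\<xi>2 y)" if "y \<in> J" for y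
    using \<xi>2(2)[OF that, symmetric] by simp
  have a12: "a12 y = of_real (sinh (\<xi>1 y)) * cis (\<xi>3 y)" if "y \<in> J" for y
    using r(3)[OF that] by (simp add: sinh1)
  have AP: "Amat \<xi> (\<xi>1 y) (\<xi>2 y) (\<xi>3 y) *v P = CC y"
    and AQ: "Amat \<xi> (\<xi>1 y) (\<xi>2 y) (\<xi>3 y) *v Q = DD y" if y: "y \<in> J" for y
  proof -
    have a21: "- \<i> * cis \<xi> * cnj (a12 y) = a21 y" and a22: "- \<i> * cis \<xi> * cnj (a11 y) = a22 y"
      using uni(1,2)[OF y y y] \<xi>[OF y] by simp_all
    have PQ: "cfst P = 0" "csnd P = of_real (1 / k)" "cfst Q = q1" "csnd Q = q2"
      by (simp_all add: P_def Q_def q1_def q2_def)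
    have A: "cfst (Amat \<xi> (\<xi>1 y) (\<xi>2 y) (\<xi>3 y) *v w) = a11 y * cfst w + a12 y * csnd w"
      "csnd (Amat \<xi> (\<xi>1 y) (\<xi>2 y) (\<xi>3 y) *v w) = a21 y * cfst w + a22 y * csnd w" for w
      unfolding cfst_Amat csnd_Amat a11[OF y, symmetric] a12[OF y, symmetric] a21[symmetric] a22[symmetric]
      by (simp_all only: distrib_left mult.assoc)
    show "Amat \<xi> (\<xi>1 y) (\<xi>2 y) (\<xi>3 y) *v P = CC y"
      by (rule real4_eqI; unfold A PQ) (use k_pos in \<open>simp_all add: a12_def a22_def\<close>)
    show "Amat \<xi> (\<xi>1 y) (\<xi>2 y) (\<xi>3 y) *v Q = DD y"
      by (rule real4_eqI; unfold A PQ) (use q1 in \<open>simp_all add: a11_def a21_def\<close>)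
  qed
  have "F (x, y) = Amat \<xi> (\<xi>1 y) (\<xi>2 y) (\<xi>3 y) *v helix_curve \<kappa> \<tau> lam \<nu> x" if "x \<in> I" "y \<in> J" for x y
    unfolding F_eq_wave[OF that] helix_curve_eq Amat_wave AP[OF that(2)] AQ[OF that(2)] ..
  moreover have "helix_ode \<tau> lam \<nu> \<xi>1 \<xi>2 \<xi>3 y" if y: "y \<in> J" for y
  proof -
    have d: "(f has_real_derivative vector_derivative f (at y)) (at y)" if "smooth_on J f" for f
      unfolding has_real_derivative_iff_has_vector_derivative using smooth_on_vector_derivative[OF that y] .
    have "((\<lambda>y. Amat \<xi> (\<xi>1 y) (\<xi>2 y) (\<xi>3 y) *v P) has_vector_derivative CC' y) (at y)"
      by (rule has_vector_derivative_transform_within_open[OF CC_dy[OF y] open_J y]) (simp add: AP)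
    from helix_ode_iff[OF d[OF sm1] d[OF \<xi>2(1)] d[OF r(2)] this]
    show ?thesis
      using g0_DD_CC'[OF y] AQ[OF y] by simp
  qed
  ultimately show ?thesis
    using sm1 \<xi>2(1) r(2) by blast
qed

end

theorem theorem6p3:
  fixes \<kappa> \<tau> lam \<nu> :: real
  assumes "\<kappa> > 0" and "\<tau> > 0" and "lam \<in> {-1, 1}" and "\<nu> \<noteq> 0"
    and "B_const \<tau> lam \<nu> < 0"
  shows
    "(\<forall>I J \<eta> F N.
        helix_surface \<kappa> \<tau> lam \<nu> (I \<times> J) F N \<and> helix_coordinates \<kappa> \<tau> lam \<nu> \<eta> I J F N \<longrightarrow>
        (\<exists>\<xi> \<xi>1 \<xi>2 \<xi>3.
           smooth_on J \<xi>1 \<and> smooth_on J \<xi>2 \<and> smooth_on J \<xi>3 \<and>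
           (\<forall>y\<in>J. pseudo_orthogonal (Amat \<xi> (\<xi>1 y) (\<xi>2 y) (\<xi>3 y)) \<and>
                   commutes_J1 (Amat \<xi> (\<xi>1 y) (\<xi>2 y) (\<xi>3 y)) \<and>
                   helix_ode \<tau> lam \<nu> \<xi>1 \<xi>2 \<xi>3 y) \<and>
           (\<forall>x\<in>I. \<forall>y\<in>J.
              F (x, y) = Amat \<xi> (\<xi>1 y) (\<xi>2 y) (\<xi>3 y) *v helix_curve \<kappa> \<tau> lam \<nu> x)))
     \<and>
     (lam + \<nu>^2 > 0 \<longrightarrow>
      (\<forall>I J \<xi> \<xi>1 \<xi>2 \<xi>3 F.
        open_interval I \<and> open_interval J \<and>
        smooth_on J \<xi>1 \<and> smooth_on J \<xi>2 \<and> smooth_on J \<xi>3 \<and>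
        (\<forall>y\<in>J. helix_ode \<tau> lam \<nu> \<xi>1 \<xi>2 \<xi>3 y) \<and>
        F = (\<lambda>(x, y). Amat \<xi> (\<xi>1 y) (\<xi>2 y) (\<xi>3 y) *v helix_curve \<kappa> \<tau> lam \<nu> x) \<and>
        immersion_on (I \<times> J) F \<longrightarrow>
        (\<exists>N. helix_surface \<kappa> \<tau> lam \<nu> (I \<times> J) F N)))"
proof (intro conjI impI allI)
  interpret helix_constants \<kappa> \<tau> lam \<nu>
    by unfold_locales (fact assms)+
  fix I J \<eta> F N
  assume "helix_surface \<kappa> \<tau> lam \<nu> (I \<times> J) F N \<and> helix_coordinates \<kappa> \<tau> lam \<nu> \<eta> I J F N"
  then interpret adapted_helix \<kappa> \<tau> lam \<nu> \<eta> I J F N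
    by unfold_locales auto
  show "\<exists>\<xi> \<xi>1 \<xi>2 \<xi>3.
      smooth_on J \<xi>1 \<and> smooth_on J \<xi>2 \<and> smooth_on J \<xi>3 \<and>
      (\<forall>y\<in>J. pseudo_orthogonal (Amat \<xi> (\<xi>1 y) (\<xi>2 y) (\<xi>3 y)) \<and>
              commutes_J1 (Amat \<xi> (\<xi>1 y) (\<xi>2 y) (\<xi>3 y)) \<and>
              helix_ode \<tau> lam \<nu> \<xi>1 \<xi>2 \<xi>3 y) \<and>
      (\<forall>x\<in>I. \<forall>y\<in>J.
         F (x, y) = Amat \<xi> (\<xi>1 y) (\<xi>2 y) (\<xi>3 y) *v helix_curve \<kappa> \<tau> lam \<nu> x)"
    using adapted_helix_representation by (simp add: pseudo_orthogonal_Amat commutes_J1_Amat)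
next
  interpret helix_constants \<kappa> \<tau> lam \<nu>
    by unfold_locales (fact assms)+
  fix I J \<xi> \<xi>1 \<xi>2 \<xi>3 F
  assume "0 < lam + \<nu>\<^sup>2"
    and "open_interval I \<and> open_interval J \<and>
      smooth_on J \<xi>1 \<and> smooth_on J \<xi>2 \<and> smooth_on J \<xi>3 \<and>
      (\<forall>y\<in>J. helix_ode \<tau> lam \<nu> \<xi>1 \<xi>2 \<xi>3 y) \<and>
      F = (\<lambda>(x, y). Amat \<xi> (\<xi>1 y) (\<xi>2 y) (\<xi>3 y) *v helix_curve \<kappa> \<tau> lam \<nu> x) \<and>
      immersion_on (I \<times> J) F"
  then show "\<exists>N. helix_surface \<kappa> \<tau> lam \<nu> (I \<times> J) F N"
    using helix_surface_of_ode by blast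
qed

end
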